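(* For each $n$, let $C$ be uniformly distributed on $\mathcal{E}_n$. Then, as $n\to\infty$, the exceedance process $\Xi_n$ converges in distribution (with respect to the vague topology on the space of Radon measures on $(-\infty,\infty]$) to a Poisson point process with intensity measure $\Lambda(dt)=\frac{1}{2\sqrt{8\pi}}e^{-t/2}\,dt$. Equivalently, for any finite collection of disjoint Borel sets $B_1,\ldots,B_m\subseteq\mathbb{R}$ bounded away from $-\infty$, with $\Lambda(B_r)<\infty$ and $\Lambda(\partial B_r)=0$ for each $r$, $$ \bigl(\Xi_n(B_1),\ldots,\Xi_n(B_m)\bigr)\overset{d}{\longrightarrow}(Z_1,\ldots,Z_m),\qquad n\to\infty, $$ where $Z_1,\ldots,Z_m$ are independent with $Z_r\sim\operatorname{Poisson}(\Lambda(B_r))$.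
   Context: $\mathcal{E}_n=\{C\in\mathbb{R}^{n\times n}: C=C',\ C\succeq 0,\ C_{ii}=1 \text{ for all } i\}$ is the set of $n\times n$ correlation matrices; the uniform distribution on it is normalized $d$-dimensional Lebesgue measure, $d=n(n-1)/2$, in the off-diagonal coordinates $(C_{ij})_{i<j}$. Let $\mu_n=\log\frac{n^4}{\log n}$. The exceedance point process is the random counting measure $$\Xi_n(B)=\#\{(i,j): 1\le i<j\le n,\ (n+1)C_{ij}^2-\mu_n\in B\}$$ for Borel $B\subseteq\mathbb{R}$. A set $B$ is bounded away from $-\infty$ if $\inf B>-\infty$. *)

theory Defs
  imports "HOL-Probability.Probability" "Jordan_Normal_Form.Matrix"
begin

definition psd_mat :: "real mat \<Rightarrow> bool" where
  "psd_mat A \<longleftrightarrow>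
     (\<forall>x \<in> carrier_vec (dim_row A). 0 \<le> scalar_prod x (mult_mat_vec A x))"

definition correlation_matrices :: "nat \<Rightarrow> real mat set" where
  "correlation_matrices n =
     {C \<in> carrier_mat n n. transpose_mat C = C \<and> psd_mat C \<and> (\<forall>i<n. C $$ (i, i) = 1)}"

text \<open>Matrix indices run from \<open>0\<close> to \<open>n - 1\<close>, so the index pairs \<open>1 \<le> i < j \<le> n\<close> are
  shifted by one.\<close>

definition upper_pairs :: "nat \<Rightarrow> (nat \<times> nat) set" where
  "upper_pairs n = {(i, j). i < j \<and> j < n}"

definition upper_entries :: "nat \<Rightarrow> real mat \<Rightarrow> (nat \<times> nat \<Rightarrow> real)" where
  "upper_entries n C = (\<lambda>p \<in> upper_pairs n. C $$ p)"

text \<open>A symmetric matrix with unit diagonal is determined by its entries above the diagonal, so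
  the distribution of a random correlation matrix is the distribution of \<open>upper_entries\<close>.\<close>

definition uniform_correlation_matrix ::
    "'a measure \<Rightarrow> nat \<Rightarrow> ('a \<Rightarrow> real mat) \<Rightarrow> bool" where
  "uniform_correlation_matrix M n C \<longleftrightarrow>
     prob_space M \<and>
     (\<forall>\<omega> \<in> space M. C \<omega> \<in> correlation_matrices n) \<and>
     (\<lambda>\<omega>. upper_entries n (C \<omega>)) \<in> M \<rightarrow>\<^sub>M (\<Pi>\<^sub>M p \<in> upper_pairs n. lborel) \<and>
     distr M (\<Pi>\<^sub>M p \<in> upper_pairs n. lborel) (\<lambda>\<omega>. upper_entries n (C \<omega>)) =
       uniform_measure (\<Pi>\<^sub>M p \<in> upper_pairs n. lborel)
         (upper_entries n ` correlation_matrices n)"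

definition borel_of :: "'b topology \<Rightarrow> 'b measure" where
  "borel_of T = sigma (topspace T) {U. openin T U}"

text \<open>Here \<open>X n\<close> on \<open>M n\<close> and \<open>Y\<close> on \<open>P\<close> are random elements of \<open>T\<close>, possibly on different
  probability spaces.\<close>

definition converges_in_distribution ::
    "'b topology \<Rightarrow> (nat \<Rightarrow> 'a measure) \<Rightarrow> (nat \<Rightarrow> 'a \<Rightarrow> 'b) \<Rightarrow> 'c measure \<Rightarrow> ('c \<Rightarrow> 'b) \<Rightarrow> bool"
  where
  "converges_in_distribution T M X P Y \<longleftrightarrow>
     (\<forall>n. X n \<in> M n \<rightarrow>\<^sub>M borel_of T) \<and> Y \<in> P \<rightarrow>\<^sub>M borel_of T \<and>
     (\<forall>F. continuous_map T euclideanreal F \<and> bounded (F ` topspace T) \<longrightarrow>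
        (\<lambda>n. \<integral>\<omega>. F (X n \<omega>) \<partial>M n) \<longlonglongrightarrow> (\<integral>\<omega>. F (Y \<omega>) \<partial>P))"

abbreviation right_line :: "ereal set" where
  "right_line \<equiv> {-\<infinity><..}"

abbreviation right_borel :: "ereal measure" where
  "right_borel \<equiv> restrict_space borel right_line"

text \<open>The space \<open>(-\<infinity>, \<infinity>]\<close> is locally compact with a countable base, so a Borel measure that is
  finite on compact sets is automatically regular.\<close>

definition radon_measures :: "ereal measure set" where
  "radon_measures =
     {\<nu>. sets \<nu> = sets right_borel \<and> (\<forall>K. compact K \<and> K \<subseteq> right_line \<longrightarrow> emeasure \<nu> K < \<infinity>)}"

definition vague_test_functions :: "(ereal \<Rightarrow> real) set" where
  "vague_test_functions =
     {f. continuous_on right_line f \<and>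
         (\<exists>K. compact K \<and> K \<subseteq> right_line \<and> (\<forall>x \<in> right_line - K. f x = 0))}"

definition vague_topology :: "ereal measure topology" where
  "vague_topology = topology_generated_by
     {{\<nu> \<in> radon_measures. (\<integral>x. f x \<partial>\<nu>) \<in> U} | f U. f \<in> vague_test_functions \<and> open U}"

lemma topspace_vague_topology: "topspace vague_topology = radon_measures"
proof -
  have "(\<lambda>_. 0) \<in> vague_test_functions"
    by (auto simp: vague_test_functions_def intro!: exI[of _ "{}"])
  then have "radon_measures \<in>
      {{\<nu> \<in> radon_measures. (\<integral>x. f x \<partial>\<nu>) \<in> U} | f U. f \<in> vague_test_functions \<and> open U}"
    by (intro CollectI exI[of _ "\<lambda>_. 0"] exI[of _ UNIV]) auto
  then show ?thesis
    unfolding vague_topology_def topology_generated_by_topspace by blast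
qed

text \<open>The library's \<^const>\<open>poisson_pmf\<close> is only specified for positive rates.\<close>

definition poisson_law :: "real \<Rightarrow> nat pmf" where
  "poisson_law rate = (if rate = 0 then return_pmf 0 else poisson_pmf rate)"

definition poisson_distributed ::
    "'a measure \<Rightarrow> ('a \<Rightarrow> 'b :: {semiring_1, topological_space}) \<Rightarrow> real \<Rightarrow> bool" where
  "poisson_distributed P X rate \<longleftrightarrow>
     X \<in> borel_measurable P \<and>
     distr P borel X = distr (measure_pmf (poisson_law rate)) borel of_nat"

text \<open>On sets of infinite intensity the count is almost surely infinite as a consequence, because
  \<open>right_intensity\<close> is finite on every \<open>{a<..}\<close> with \<open>a > -\<infinity>\<close>.\<close>

definition poisson_point_process ::
    "'a measure \<Rightarrow> ('a \<Rightarrow> ereal measure) \<Rightarrow> ereal measure \<Rightarrow> bool" where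
  "poisson_point_process P N \<Lambda> \<longleftrightarrow>
     prob_space P \<and>
     N \<in> P \<rightarrow>\<^sub>M borel_of vague_topology \<and>
     (\<forall>A \<in> sets right_borel. emeasure \<Lambda> A < \<infinity> \<longrightarrow>
        poisson_distributed P (\<lambda>\<omega>. emeasure (N \<omega>) A) (measure \<Lambda> A)) \<and>
     (\<forall>m (A :: nat \<Rightarrow> ereal set).
        (\<forall>r<m. A r \<in> sets right_borel) \<and> disjoint_family_on A {..<m} \<longrightarrow>
        prob_space.indep_vars P (\<lambda>_. borel) (\<lambda>r \<omega>. emeasure (N \<omega>) (A r)) {..<m})"

definition exceedance_level :: "nat \<Rightarrow> real" where
  "exceedance_level n = ln (real n ^ 4 / ln (real n))"

definition exceedance_point :: "nat \<Rightarrow> real mat \<Rightarrow> nat \<times> nat \<Rightarrow> real" where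
  "exceedance_point n C p = (real n + 1) * (C $$ p)\<^sup>2 - exceedance_level n"

definition exceedance_count :: "nat \<Rightarrow> real mat \<Rightarrow> real set \<Rightarrow> nat" where
  "exceedance_count n C B = card {p \<in> upper_pairs n. exceedance_point n C p \<in> B}"

definition exceedance_process :: "nat \<Rightarrow> real mat \<Rightarrow> ereal measure" where
  "exceedance_process n C =
     distr (count_space (upper_pairs n)) right_borel (\<lambda>p. ereal (exceedance_point n C p))"

lemma finite_upper_pairs: "finite (upper_pairs n)"
  by (rule finite_subset[of _ "{..<n} \<times> {..<n}"]) (auto simp: upper_pairs_def)

lemma emeasure_exceedance_process:
  assumes "A \<in> sets right_borel"
  shows "emeasure (exceedance_process n C) A = of_nat (exceedance_count n C (ereal -` A))"
proof -
  let ?g = "\<lambda>p. ereal (exceedance_point n C p)"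
  have "?g \<in> count_space (upper_pairs n) \<rightarrow>\<^sub>M right_borel"
    by (auto simp: space_restrict_space)
  moreover have "?g -` A \<inter> upper_pairs n =
      {p \<in> upper_pairs n. exceedance_point n C p \<in> ereal -` A}"
    by auto
  ultimately show ?thesis
    using assms finite_upper_pairs[of n]
    by (simp add: exceedance_process_def exceedance_count_def emeasure_distr)
qed

definition intensity :: "real measure" where
  "intensity = density lborel (\<lambda>t. ennreal (1 / (2 * sqrt (8 * pi)) * exp (- t / 2)))"

text \<open>The point \<open>\<infinity>\<close> is not charged.\<close>

definition right_intensity :: "ereal measure" where
  "right_intensity = distr intensity right_borel ereal"

end

theory Submission
  imports Defs "HOL-Real_Asymp.Real_Asymp"
begin

text \<open>If \<open>X\<close> is the matrix obtained from a uniform correlation matrix by the substitution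
  \<open>C\<^sub>j\<^sub>k = a C\<^sub>i\<^sub>k + sqrt (1 - a\<^sup>2) X\<^sub>j\<^sub>k\<close> with \<open>a = C\<^sub>i\<^sub>j\<close>, then \<open>C\<close> is positive semidefinite iff \<open>X\<close>,
  with \<open>(i, j)\<close> entry \<open>0\<close>, is. The Jacobian is \<open>(1 - a\<^sup>2)\<^bsup>(n - 2)/2\<^esup>\<close>, so \<open>C\<^sub>i\<^sub>j\<close> has
  density proportional to this power and is independent of all entries outside row \<open>j\<close>. In
  particular distinct entries are pairwise independent, and \<open>C\<^sub>i\<^sub>j\<close> is independent of the
  entries that avoid both \<open>i\<close> and \<open>j\<close>. Under this local dependence
  \<open>E (\<Prod>p. 1 - g p)\<close> differs from \<open>\<Prod>p. (1 - E (g p))\<close> by at most a sum of \<open>O(n\<^sup>3)\<close> products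
  of two marginal expectations, and each such product is of order \<open>n\<^sup>-\<^sup>4\<close>. Hence the generating functions of the counts
  converge to those of independent Poisson variables.

  For the vague topology, a test function \<open>F\<close> is compared with its value at the discretised
  configuration, which depends on finitely many counts. The error is uniformly small on
  configurations with a bounded number of points above each level, by compactness, and such
  configurations carry almost all the mass by Markov's inequality.\<close>

section \<open>The uniform law on correlation matrices\<close>

text \<open>Full independence of the entries is impossible: positive semidefiniteness of a 3 x 3
  block ties C_ij, C_jk and C_ik together, although any two of them are independent. A comparison
  with independent variables therefore has to get by with joint information on only two entries
  whenever the index pairs meet. The level is the one at which about n^2/2 pairs leave a bounded
  mean number of points. The density of x = (n+1) C_ij^2 behaves like exp(-x/2) / sqrt x, and
  exp(-x/2) at the level is sqrt(log n) / n^2; the root of the logarithm is absorbed by sqrt x,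
  which is about 2 sqrt(log n). Together with n^2/2 this leaves the factor 1/4, the Gaussian
  normalisation contributes 1 / sqrt(2 pi), and 1/(4 sqrt(2 pi)) = 1/(2 sqrt(8 pi)). The limit
  process has infinitely many points, accumulating at minus infinity. No finite family of counts
  determines it, which is why the number of points must be controlled above every level -j
  simultaneously before a continuous functional can be discretised.\<close>

definition corr_entry :: "(nat \<times> nat \<Rightarrow> real) \<Rightarrow> nat \<Rightarrow> nat \<Rightarrow> real" where
  "corr_entry x k l = (if k = l then 1 else x (min k l, max k l))"

definition corr_form :: "nat \<Rightarrow> (nat \<times> nat \<Rightarrow> real) \<Rightarrow> (nat \<Rightarrow> real) \<Rightarrow> real" where
  "corr_form n x v = (\<Sum>k<n. \<Sum>l<n. corr_entry x k l * v k * v l)"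

text \<open>A cylinder in the full function space: coordinates outside \<open>upper_pairs n\<close>
  are free. It is thus a closed set of the product topology, and extensionality enters only in the
  comparison with \<open>correlation_matrices\<close>.\<close>

definition corr_psd :: "nat \<Rightarrow> (nat \<times> nat \<Rightarrow> real) set" where
  "corr_psd n = {x. \<forall>v. 0 \<le> corr_form n x v}"

lemma corr_entry_sym: "corr_entry x k l = corr_entry x l k"
  by (simp add: corr_entry_def min.commute max.commute)

section \<open>The quadratic form under the shear\<close>

lemma corr_form_split:
  assumes ij: "i \<noteq> j" "i < n" "j < n" and R: "R = {..<n} - {i, j}"
  shows "corr_form n x v = (\<Sum>k\<in>R. \<Sum>l\<in>R. corr_entry x k l * v k * v l)
    + 2 * v i * (\<Sum>k\<in>R. corr_entry x i k * v k) + 2 * v j * (\<Sum>k\<in>R. corr_entry x j k * v k)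
    + (v i)\<^sup>2 + (v j)\<^sup>2 + 2 * corr_entry x i j * v i * v j"
proof -
  have eq: "{..<n} = insert i (insert j R)" and fin: "finite R" and nin: "i \<notin> insert j R" "j \<notin> R"
    using ij R by auto
  have row: "(\<Sum>l<n. corr_entry x k l * v k * v l) = corr_entry x k i * v k * v i
     + (corr_entry x k j * v k * v j + (\<Sum>l\<in>R. corr_entry x k l * v k * v l))" for k
    unfolding eq using fin nin by simp
  have one: "corr_entry x k k = 1" for k by (simp add: corr_entry_def)
  have "corr_form n x v = (\<Sum>l<n. corr_entry x i l * v i * v l) + ((\<Sum>l<n. corr_entry x j l * v j * v l)
     + (\<Sum>k\<in>R. \<Sum>l<n. corr_entry x k l * v k * v l))"
    unfolding corr_form_def using fin nin by (subst eq) simp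
  also have "(\<Sum>k\<in>R. \<Sum>l<n. corr_entry x k l * v k * v l) =
      v i * (\<Sum>k\<in>R. corr_entry x i k * v k) + v j * (\<Sum>k\<in>R. corr_entry x j k * v k)
      + (\<Sum>k\<in>R. \<Sum>l\<in>R. corr_entry x k l * v k * v l)"
    unfolding row sum.distrib
    by (simp add: sum_distrib_left corr_entry_sym[of x _ i] corr_entry_sym[of x _ j] algebra_simps)
  finally show ?thesis
    unfolding row one
    by (simp add: corr_entry_sym[of x j i] power2_eq_square sum_distrib_left algebra_simps)
qed

text \<open>With \<open>x\<close> the matrix whose \<open>(i, j)\<close> entry is zero, the sheared matrix is \<open>L X L\<^sup>T\<close>, where
  \<open>L\<close> is the identity except for \<open>L\<^sub>j\<^sub>i = a\<close> and \<open>L\<^sub>j\<^sub>j = s\<close>.\<close>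

lemma corr_psd_shear:
  assumes ij: "i \<noteq> j" "i < n" "j < n" and s: "a\<^sup>2 + s\<^sup>2 = 1" "s \<noteq> 0"
    and x0: "corr_entry x i j = 0" and ya: "corr_entry y i j = a"
    and yj: "\<And>k. k < n \<Longrightarrow> k \<noteq> i \<Longrightarrow> k \<noteq> j \<Longrightarrow> corr_entry y j k = a * corr_entry x i k + s * corr_entry x j k"
    and yr: "\<And>k l. k < n \<Longrightarrow> l < n \<Longrightarrow> k \<noteq> j \<Longrightarrow> l \<noteq> j \<Longrightarrow> corr_entry y k l = corr_entry x k l"
  shows "y \<in> corr_psd n \<longleftrightarrow> x \<in> corr_psd n"
proof -
  define R where "R = {..<n} - {i, j}"
  \<comment> \<open>The form of L X L^T at v is the form of X at L^T v, and L^T changes only the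
    coordinates i and j of v.\<close>
  have key: "corr_form n y v = corr_form n x (v(i := v i + a * v j, j := s * v j))" for v
  proof -
    have 1: "(\<Sum>k\<in>R. \<Sum>l\<in>R. corr_entry y k l * v k * v l) = (\<Sum>k\<in>R. \<Sum>l\<in>R. corr_entry x k l * v k * v l)"
      by (intro sum.cong refl) (use yr in \<open>auto simp: R_def\<close>)
    have 2: "(\<Sum>k\<in>R. corr_entry y i k * v k) = (\<Sum>k\<in>R. corr_entry x i k * v k)"
      by (intro sum.cong refl) (use yr ij in \<open>auto simp: R_def\<close>)
    have 3: "(\<Sum>k\<in>R. corr_entry y j k * v k) = a * (\<Sum>k\<in>R. corr_entry x i k * v k) + s * (\<Sum>k\<in>R. corr_entry x j k * v k)"
      unfolding sum_distrib_left sum.distrib[symmetric]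
      by (intro sum.cong refl) (use yj in \<open>auto simp: R_def algebra_simps\<close>)
    define u where "u = v(i := v i + a * v j, j := s * v j)"
    have u: "u i = v i + a * v j" "u j = s * v j" "\<And>k. k \<in> R \<Longrightarrow> u k = v k"
      using ij by (auto simp: u_def R_def)
    have 4: "(v i + a * v j)\<^sup>2 + (s * v j)\<^sup>2 = (v i)\<^sup>2 + (v j)\<^sup>2 + 2 * a * v i * v j"
    proof -
      have "(v i + a * v j)\<^sup>2 + (s * v j)\<^sup>2 = (v i)\<^sup>2 + (a\<^sup>2 + s\<^sup>2) * (v j)\<^sup>2 + 2 * a * v i * v j"
        by (simp add: power2_eq_square algebra_simps)
      then show ?thesis using s by simp
    qed
    show ?thesis
      unfolding u_def[symmetric] corr_form_split[OF ij R_def] 1 2 3 u(1,2) x0 ya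
      using u(3) 4 by (simp add: algebra_simps)
  qed
  \<comment> \<open>As s is nonzero, L^T is invertible, so nonnegativity for all v is the same
    condition on both sides.\<close>
  have surj: "\<exists>v. u = v(i := v i + a * v j, j := s * v j)" for u
    using s ij by (intro exI[of _ "u(i := u i - a * (u j / s), j := u j / s)"]) auto
  show ?thesis
    unfolding corr_psd_def mem_Collect_eq key using surj by metis
qed

text \<open>The shear exists only for |a| < 1; this bound disposes of the values |a| > 1.\<close>

lemma corr_psd_entry_le_1:
  assumes ij: "i \<noteq> j" "i < n" "j < n" and x: "x \<in> corr_psd n"
  shows "\<bar>corr_entry x i j\<bar> \<le> 1"
proof -
  define a where "a = corr_entry x i j"
  define R where "R = {..<n} - {i, j}"
  \<comment> \<open>On the vectors e_i + t e_j the form is 1 + 2 a t + t^2, which is least at t = -a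
    with value 1 - a^2.\<close>
  define v where "v = (\<lambda>k. if k = i then 1 else if k = j then - a else 0)"
  have v: "v i = 1" "v j = - a" "\<And>k. k \<in> R \<Longrightarrow> v k = 0" using ij by (auto simp: v_def R_def)
  have "0 \<le> corr_form n x v" using x by (simp add: corr_psd_def)
  also have "\<dots> = 1 - a\<^sup>2"
    unfolding corr_form_split[OF ij R_def] a_def[symmetric] v(1,2)
    using v(3) by (simp add: power2_eq_square)
  finally show ?thesis by (simp add: a_def abs_square_le_1)
qed

section \<open>Passage to the off-diagonal coordinates\<close>

lemma closed_corr_psd: "closed (corr_psd n)"
proof -
  have "continuous_on UNIV (\<lambda>x. corr_entry x k l)" for k l
    by (cases "k = l") (auto simp: corr_entry_def)
  then have "continuous_on UNIV (\<lambda>x. corr_form n x v)" for v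
    unfolding corr_form_def by (intro continuous_intros) auto
  then show ?thesis
    unfolding corr_psd_def
    by (intro closed_Collect_all closed_Collect_le continuous_on_const) auto
qed

lemma borel_corr_psd [measurable]: "corr_psd n \<in> sets borel"
  by (intro borel_closed closed_corr_psd)

lemma corr_entry_upper_entries:
  assumes C: "C \<in> correlation_matrices n" and kl: "k < n" "l < n"
  shows "corr_entry (upper_entries n C) k l = C $$ (k, l)"
proof -
  have car: "C \<in> carrier_mat n n" and sym: "transpose_mat C = C"
    using C by (auto simp: correlation_matrices_def)
  have "C $$ (l, k) = transpose_mat C $$ (k, l)"
    using car kl by (subst index_transpose_mat) auto
  then have "C $$ (l, k) = C $$ (k, l)"
    unfolding sym .
  then show ?thesis
    using C kl by (auto simp: corr_entry_def upper_entries_def upper_pairs_def correlation_matrices_def min_def max_def)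
qed

lemma quadratic_form_eq:
  fixes A :: "real mat"
  assumes A: "A \<in> carrier_mat n n" and v: "v \<in> carrier_vec n"
  shows "scalar_prod v (mult_mat_vec A v) = (\<Sum>k<n. \<Sum>l<n. A $$ (k, l) * v $ k * v $ l)"
proof -
  have "mult_mat_vec A v $ k = (\<Sum>l<n. A $$ (k, l) * v $ l)" if "k < n" for k
    using assms that by (simp add: scalar_prod_def atLeast0LessThan)
  then have "scalar_prod v (mult_mat_vec A v) = (\<Sum>k<n. v $ k * (\<Sum>l<n. A $$ (k, l) * v $ l))"
    using assms by (simp add: scalar_prod_def atLeast0LessThan)
  then show ?thesis by (simp add: sum_distrib_left ac_simps)
qed

lemma upper_entries_correlation_matrices:
  "upper_entries n ` correlation_matrices n = corr_psd n \<inter> extensional (upper_pairs n)"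
proof (intro Set.set_eqI iffI)
  fix x assume "x \<in> upper_entries n ` correlation_matrices n"
  then obtain C where C: "C \<in> correlation_matrices n" and x: "x = upper_entries n C" by auto
  have car: "C \<in> carrier_mat n n" and psd: "psd_mat C" using C by (auto simp: correlation_matrices_def)
  have "0 \<le> corr_form n x v" for v
  proof -
    have "0 \<le> scalar_prod (vec n v) (mult_mat_vec C (vec n v))"
      using psd car unfolding psd_mat_def by auto
    also have "\<dots> = corr_form n x v"
      by (subst quadratic_form_eq[OF car]) (auto simp: corr_form_def x corr_entry_upper_entries[OF C])
    finally show ?thesis .
  qed
  then show "x \<in> corr_psd n \<inter> extensional (upper_pairs n)"
    by (auto simp: corr_psd_def x upper_entries_def)
next
  fix x assume x: "x \<in> corr_psd n \<inter> extensional (upper_pairs n)"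
  define C where "C = mat n n (\<lambda>(k, l). corr_entry x k l)"
  have car: "C \<in> carrier_mat n n" by (simp add: C_def)
  have "psd_mat C"
    unfolding psd_mat_def
  proof
    fix v :: "real vec" assume "v \<in> carrier_vec (dim_row C)"
    then have v: "v \<in> carrier_vec n" by (simp add: C_def)
    have "scalar_prod v (mult_mat_vec C v) = corr_form n x (vec_index v)"
      unfolding quadratic_form_eq[OF car v] corr_form_def by (simp add: C_def)
    then show "0 \<le> scalar_prod v (mult_mat_vec C v)" using x by (simp add: corr_psd_def)
  qed
  moreover have "transpose_mat C = C"
    by (rule eq_matI) (auto simp: C_def corr_entry_sym)
  ultimately have "C \<in> correlation_matrices n"
    using car by (auto simp: correlation_matrices_def C_def corr_entry_def)
  moreover have "x = upper_entries n C"
    using x by (auto simp: upper_entries_def C_def upper_pairs_def corr_entry_def extensional_def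
        min_def max_def fun_eq_iff)
  ultimately show "x \<in> upper_entries n ` correlation_matrices n" by auto
qed

interpretation lborel_PiM: product_sigma_finite "\<lambda>_. lborel :: real measure"
  by unfold_locales

text \<open>Links the product sigma-algebra on extensional functions to the Borel sets of the
  product topology on all functions. Coordinates outside \<open>I\<close> are constantly
  \<open>undefined\<close>, hence measurable too.\<close>

lemma measurable_PiM_lborel_ident [measurable]:
  "(\<lambda>x. x) \<in> Pi\<^sub>M I (\<lambda>_. lborel :: real measure) \<rightarrow>\<^sub>M (borel :: ('i::countable \<Rightarrow> real) measure)"
proof (rule measurable_coordinatewise_then_product)
  fix i
  show "(\<lambda>x. x i) \<in> borel_measurable (Pi\<^sub>M I (\<lambda>_. lborel :: real measure))"
  proof (cases "i \<in> I")
    case True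
    then show ?thesis using measurable_component_singleton[of i I "\<lambda>_. lborel :: real measure"] by simp
  next
    case False
    then show ?thesis
      by (subst measurable_cong[where g = "\<lambda>_. undefined"]) (auto simp: space_PiM PiE_def extensional_def)
  qed
qed

text \<open>Fubini and the one-dimensional affine rule, one coordinate at a time. The shift may
  depend on the coordinate while the scale is common, exactly as in the shear: entry (j, k) is
  shifted by a multiple of entry (i, k), and all of row j is scaled by sqrt(1 - a^2).\<close>

lemma nn_integral_PiM_lborel_affine:
  fixes c :: real
  assumes J: "finite J" and c: "c \<noteq> 0"
    and h: "h \<in> borel_measurable (Pi\<^sub>M J (\<lambda>_. lborel))"
  shows "(\<integral>\<^sup>+ y. h y \<partial>Pi\<^sub>M J (\<lambda>_. lborel)) =
    ennreal (\<bar>c\<bar> ^ card J) * (\<integral>\<^sup>+ y. h (\<lambda>q\<in>J. t q + c * y q) \<partial>Pi\<^sub>M J (\<lambda>_. lborel))"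
  using J h
proof (induction J arbitrary: h)
  case empty
  show ?case by (simp add: PiM_empty nn_integral_count_space_finite restrict_def)
next
  case (insert q J)
  note [measurable] = insert.prems
  have [measurable]: "(\<lambda>p. (fst p)(q := snd p)) \<in>
      Pi\<^sub>M J (\<lambda>_. lborel) \<Otimes>\<^sub>M (lborel :: real measure) \<rightarrow>\<^sub>M Pi\<^sub>M (insert q J) (\<lambda>_. lborel)"
    using measurable_add_dim[of q J "\<lambda>_. lborel :: real measure"] by (simp add: case_prod_beta')
  have upd: "(\<lambda>p. h ((fst p)(q := t q + c * snd p))) \<in>
      borel_measurable (Pi\<^sub>M J (\<lambda>_. lborel) \<Otimes>\<^sub>M (lborel :: real measure))"
  proof -
    have "(\<lambda>p. (fst p, t q + c * snd p)) \<in> Pi\<^sub>M J (\<lambda>_. lborel) \<Otimes>\<^sub>M (lborel :: real measure) \<rightarrow>\<^sub>M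
        Pi\<^sub>M J (\<lambda>_. lborel) \<Otimes>\<^sub>M (lborel :: real measure)" by measurable
    from measurable_compose[OF this, of "\<lambda>p. h ((fst p)(q := snd p))"]
    show ?thesis by simp
  qed
  have slice: "(\<lambda>y. h (x(q := y))) \<in> borel_measurable borel" if "x \<in> space (Pi\<^sub>M J (\<lambda>_. lborel))" for x
  proof -
    have "(\<lambda>y. (x, y)) \<in> (lborel :: real measure) \<rightarrow>\<^sub>M Pi\<^sub>M J (\<lambda>_. lborel) \<Otimes>\<^sub>M (lborel :: real measure)"
      using that by measurable
    from measurable_compose[OF this, of "\<lambda>p. h ((fst p)(q := snd p))"] show ?thesis by simp
  qed
  let ?P = "Pi\<^sub>M J (\<lambda>_. lborel :: real measure)"
  have "(\<integral>\<^sup>+ y. h y \<partial>Pi\<^sub>M (insert q J) (\<lambda>_. lborel)) = (\<integral>\<^sup>+ x. (\<integral>\<^sup>+ y. h (x(q := y)) \<partial>lborel) \<partial>?P)"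
    by (rule lborel_PiM.product_nn_integral_insert) (use insert in auto)
  also have "\<dots> = (\<integral>\<^sup>+ x. ennreal \<bar>c\<bar> * (\<integral>\<^sup>+ y. h (x(q := t q + c * y)) \<partial>lborel) \<partial>?P)"
    by (intro nn_integral_cong nn_integral_real_affine slice c)
  \<comment> \<open>The induction hypothesis is applied to the inner integral as a function of the
    remaining coordinates, hence the induction for arbitrary \<open>h\<close>.\<close>
  also have "\<dots> = ennreal (\<bar>c\<bar> ^ card J) *
      (\<integral>\<^sup>+ x. ennreal \<bar>c\<bar> * (\<integral>\<^sup>+ y. h ((\<lambda>q\<in>J. t q + c * x q)(q := t q + c * y)) \<partial>lborel) \<partial>?P)"
    by (rule insert.IH) (intro borel_measurable_times_ennreal borel_measurable_const
        lborel.borel_measurable_nn_integral, use upd in \<open>simp add: case_prod_beta' fun_upd_def\<close>)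
  also have "\<dots> = ennreal (\<bar>c\<bar> ^ card J) * (ennreal \<bar>c\<bar> *
      (\<integral>\<^sup>+ x. (\<integral>\<^sup>+ y. h ((\<lambda>q\<in>J. t q + c * x q)(q := t q + c * y)) \<partial>lborel) \<partial>?P))"
  proof -
    have "(\<lambda>p. ((\<lambda>q\<in>J. t q + c * fst p q), snd p)) \<in> ?P \<Otimes>\<^sub>M (lborel :: real measure) \<rightarrow>\<^sub>M ?P \<Otimes>\<^sub>M (lborel :: real measure)"
      by measurable
    from measurable_compose[OF this upd]
    have "(\<lambda>x. (\<integral>\<^sup>+ y. h ((\<lambda>q\<in>J. t q + c * x q)(q := t q + c * y)) \<partial>lborel)) \<in> borel_measurable ?P"
      by (intro lborel.borel_measurable_nn_integral) (simp add: case_prod_beta')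
    then show ?thesis by (subst nn_integral_cmult) auto
  qed
  also have "(\<integral>\<^sup>+ x. (\<integral>\<^sup>+ y. h ((\<lambda>q\<in>J. t q + c * x q)(q := t q + c * y)) \<partial>lborel) \<partial>?P) =
      (\<integral>\<^sup>+ x. (\<integral>\<^sup>+ y. h (\<lambda>r\<in>insert q J. t r + c * (x(q := y)) r) \<partial>lborel) \<partial>?P)"
    by (intro nn_integral_cong arg_cong[of _ _ h]) (use insert.hyps in auto)
  also have "\<dots> = (\<integral>\<^sup>+ y. h (\<lambda>r\<in>insert q J. t r + c * y r) \<partial>Pi\<^sub>M (insert q J) (\<lambda>_. lborel))"
    by (rule lborel_PiM.product_nn_integral_insert[symmetric]) (use insert in auto)
  finally have "(\<integral>\<^sup>+ y. h y \<partial>Pi\<^sub>M (insert q J) (\<lambda>_. lborel)) = ennreal (\<bar>c\<bar> ^ card J) * (ennreal \<bar>c\<bar> *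
      (\<integral>\<^sup>+ y. h (\<lambda>r\<in>insert q J. t r + c * y r) \<partial>Pi\<^sub>M (insert q J) (\<lambda>_. lborel)))" .
  moreover have "ennreal (\<bar>c\<bar> ^ card (insert q J)) = ennreal (\<bar>c\<bar> ^ card J) * ennreal \<bar>c\<bar>"
    using insert.hyps by (simp add: ennreal_mult mult.commute)
  ultimately show ?case by (simp only: mult.assoc)
qed

text \<open>The unnormalised density of one entry: each of the n - 2 other entries of its row
  contributes a factor sqrt(1 - a^2) to the Jacobian. A power of the root avoids half-integer
  exponents.\<close>

definition corr_weight :: "nat \<Rightarrow> real \<Rightarrow> real" where
  "corr_weight n a = (if \<bar>a\<bar> < 1 then sqrt (1 - a\<^sup>2) ^ (n - 2) else 0)"

lemma corr_weight_borel [measurable]: "corr_weight n \<in> borel_measurable borel"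
  unfolding corr_weight_def[abs_def] by measurable

text \<open>The constant depends on G but not on f, and this is all that independence amounts to.
  The roles of i and j differ: row j is the one that is sheared, so it is row j that G must not
  see.\<close>

lemma corr_psd_integral_factorizes:
  fixes n :: nat
  assumes ij: "i \<noteq> j" "i < n" "j < n"
    and G [measurable]: "G \<in> borel_measurable borel"
    and G_cong: "\<And>x y. (\<And>q. q \<in> upper_pairs n \<Longrightarrow> fst q \<noteq> j \<Longrightarrow> snd q \<noteq> j \<Longrightarrow> x q = y q) \<Longrightarrow> G x = (G y :: ennreal)"
  obtains K where "\<And>f. f \<in> borel_measurable borel \<Longrightarrow>
    (\<integral>\<^sup>+ x. indicator (corr_psd n) x * (f (x (min i j, max i j)) * G x) \<partial>Pi\<^sub>M (upper_pairs n) (\<lambda>_. lborel))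
      = (\<integral>\<^sup>+ a. f a * ennreal (corr_weight n a) \<partial>lborel) * K"
proof -
  define p where "p = (min i j, max i j)"
  \<comment> \<open>The coordinates split into p itself, the rest \<open>J\<close> of row j, which
    is transformed, and the entries \<open>K\<close> avoiding j, which stay fixed.\<close>
  define J where "J = (\<lambda>k. (min j k, max j k)) ` ({..<n} - {i, j})"
  define K where "K = {q \<in> upper_pairs n. fst q \<noteq> j \<and> snd q \<noteq> j}"
  have inj: "inj_on (\<lambda>k. (min j k, max j k)) ({..<n} - {i, j})"
    by (auto simp: inj_on_def min_def max_def split: if_splits)
  have cJ: "card J = n - 2"
    unfolding J_def card_image[OF inj] using ij by (simp add: card_Diff_subset)
  have fin: "finite J" "finite K" using finite_upper_pairs[of n] by (auto simp: J_def K_def)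
  have I: "upper_pairs n = insert p (K \<union> J)"
  proof (intro Set.set_eqI iffI)
    fix q assume q: "q \<in> upper_pairs n"
    obtain k l where kl: "q = (k, l)" "k < l" "l < n" using q by (auto simp: upper_pairs_def)
    consider "k \<noteq> j" "l \<noteq> j" | "k = j" | "l = j" by auto
    then show "q \<in> insert p (K \<union> J)"
    proof cases
      case 1 then show ?thesis using q kl by (simp add: K_def)
    next
      case 2
      then show ?thesis
        using kl ij by (cases "l = i") (auto simp: p_def J_def min_def max_def intro!: image_eqI[of _ _ l])
    next
      case 3
      then show ?thesis
        using kl ij by (cases "k = i") (auto simp: p_def J_def min_def max_def intro!: image_eqI[of _ _ k])
    qed
  qed (use ij in \<open>auto simp: p_def J_def K_def upper_pairs_def min_def max_def split: if_splits\<close>)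
  have disj: "p \<notin> K \<union> J" "K \<inter> J = {}"
    using ij by (auto simp: p_def J_def K_def min_def max_def split: if_splits)
  \<comment> \<open>For q the entry with indices j and k, \<open>other q\<close> is k and
    \<open>\<sigma> q\<close> is the entry with indices i and k. The latter lies in
    \<open>K\<close>, so the shift is constant while the \<open>J\<close> coordinates are
    integrated.\<close>
  define other where "other q = (if fst q = j then snd q else fst q)" for q
  define \<sigma> where "\<sigma> q = (min i (other q), max i (other q))" for q
  define Z where "Z a x y = (merge K J (x, y))(p := a)" for a :: real and x y
  let ?PK = "Pi\<^sub>M K (\<lambda>_. lborel :: real measure)" and ?PJ = "Pi\<^sub>M J (\<lambda>_. lborel :: real measure)"
  have ZK: "Z a x y q = x q" if "q \<in> K" for a x y q using that disj by (auto simp: Z_def merge_def)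
  have ZJ: "Z a x y q = y q" if "q \<in> J" for a x y q using that disj by (auto simp: Z_def merge_def)
  have Zp: "Z a x y p = a" for a x y by (simp add: Z_def)
  \<comment> \<open>Both p and \<open>J\<close> lie in row j, so G sees neither a nor y.\<close>
  have GZ: "G (Z a x y) = G (Z 0 x z)" for a x y z
    by (rule G_cong) (use ZK in \<open>auto simp: K_def\<close>)
  have shear: "Z a x (\<lambda>q\<in>J. a * x (\<sigma> q) + sqrt (1 - a\<^sup>2) * y q) \<in> corr_psd n \<longleftrightarrow> Z 0 x y \<in> corr_psd n"
    if a: "\<bar>a\<bar> < 1" for a x y
  proof (rule corr_psd_shear[OF ij])
    have "a\<^sup>2 < 1" using a by (simp add: abs_square_less_1)
    then show "a\<^sup>2 + (sqrt (1 - a\<^sup>2))\<^sup>2 = 1" "sqrt (1 - a\<^sup>2) \<noteq> 0" by auto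
    show "corr_entry (Z 0 x y) i j = 0" using Zp ij by (simp add: corr_entry_def p_def)
    show "corr_entry (Z a x (\<lambda>q\<in>J. a * x (\<sigma> q) + sqrt (1 - a\<^sup>2) * y q)) i j = a"
      using Zp ij by (simp add: corr_entry_def p_def)
    fix k assume k: "k < n"
    { assume k': "k \<noteq> i" "k \<noteq> j"
      have qJ: "(min j k, max j k) \<in> J" using k k' by (auto simp: J_def)
      have "other (min j k, max j k) = k" using k' by (auto simp: other_def min_def max_def)
      then have "\<sigma> (min j k, max j k) = (min i k, max i k)" by (simp add: \<sigma>_def)
      moreover have "(min i k, max i k) \<in> K" using k k' ij by (auto simp: K_def upper_pairs_def min_def max_def)
      ultimately show "corr_entry (Z a x (\<lambda>q\<in>J. a * x (\<sigma> q) + sqrt (1 - a\<^sup>2) * y q)) j k =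
          a * corr_entry (Z 0 x y) i k + sqrt (1 - a\<^sup>2) * corr_entry (Z 0 x y) j k"
        using k' qJ ZJ ZK by (simp add: corr_entry_def) }
    fix l assume l: "l < n" "k \<noteq> j" "l \<noteq> j"
    have "k \<noteq> l \<Longrightarrow> (min k l, max k l) \<in> K"
      using k l by (auto simp: K_def upper_pairs_def min_def max_def)
    then show "corr_entry (Z a x (\<lambda>q\<in>J. a * x (\<sigma> q) + sqrt (1 - a\<^sup>2) * y q)) k l = corr_entry (Z 0 x y) k l"
      using ZK by (simp add: corr_entry_def)
  qed
  have Zout: "Z a x y \<notin> corr_psd n" if "\<bar>a\<bar> > 1" for a x y
  proof
    assume "Z a x y \<in> corr_psd n"
    from corr_psd_entry_le_1[OF ij this] show False
      using that Zp ij by (simp add: corr_entry_def p_def)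
  qed
  have Z_meas: "(\<lambda>w. Z (A w) (X w) (Y w)) \<in> borel_measurable N"
    if [measurable]: "A \<in> borel_measurable N" "X \<in> N \<rightarrow>\<^sub>M ?PK" "Y \<in> N \<rightarrow>\<^sub>M ?PJ"
    for N :: "'z measure" and A X Y
  proof (rule measurable_coordinatewise_then_product)
    fix q
    have *: "q \<in> K \<Longrightarrow> (\<lambda>w. X w q) \<in> borel_measurable N" "q \<in> J \<Longrightarrow> (\<lambda>w. Y w q) \<in> borel_measurable N"
      using measurable_compose[OF that(2) measurable_component_singleton[of q K]]
        measurable_compose[OF that(3) measurable_component_singleton[of q J]] by auto
    show "(\<lambda>w. Z (A w) (X w) (Y w) q) \<in> borel_measurable N"
      using * by (cases "q = p"; cases "q \<in> K"; cases "q \<in> J") (auto simp: Z_def merge_def)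
  qed
  \<comment> \<open>The integral over the slice on which the (i, j) entry is zero; every other slice
    is a scaled copy of it.\<close>
  define KG where "KG = (\<integral>\<^sup>+ x. \<integral>\<^sup>+ y. indicator (corr_psd n) (Z 0 x y) * G (Z 0 x y) \<partial>?PJ \<partial>?PK)"
  show thesis
  proof (rule that[of KG])
    fix f :: "real \<Rightarrow> ennreal" assume f [measurable]: "f \<in> borel_measurable borel"
    define h where "h x = indicator (corr_psd n) x * (f (x p) * G x)" for x
    have h [measurable]: "h \<in> borel_measurable borel" unfolding h_def by measurable
    \<comment> \<open>At a = 1 and a = -1 the shear degenerates while the bound on the entries does
      not yet exclude a; these two values form a null set and are removed below.\<close>
    have hZ: "(\<integral>\<^sup>+ y. h (Z a x y) \<partial>?PJ) = f a * ennreal (corr_weight n a) *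
        (\<integral>\<^sup>+ y. indicator (corr_psd n) (Z 0 x y) * G (Z 0 x y) \<partial>?PJ)"
      if a: "a \<noteq> 1" "a \<noteq> -1" and x: "x \<in> space ?PK" for a x
    proof (cases "\<bar>a\<bar> < 1")
      case False
      then show ?thesis using a Zout[of a x] by (auto simp: h_def corr_weight_def)
    next
      case True
      then have "a\<^sup>2 < 1" by (simp add: abs_square_less_1)
      then have s: "sqrt (1 - a\<^sup>2) > 0" by simp
      have [measurable]: "(\<lambda>y. Z b x y) \<in> borel_measurable ?PJ" for b
        using x by (intro Z_meas) auto
      have "(\<integral>\<^sup>+ y. h (Z a x y) \<partial>?PJ) = ennreal (\<bar>sqrt (1 - a\<^sup>2)\<bar> ^ card J) *
          (\<integral>\<^sup>+ y. h (Z a x (\<lambda>q\<in>J. a * x (\<sigma> q) + sqrt (1 - a\<^sup>2) * y q)) \<partial>?PJ)"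
        by (rule nn_integral_PiM_lborel_affine) (use fin s in auto)
      also have "(\<lambda>y. h (Z a x (\<lambda>q\<in>J. a * x (\<sigma> q) + sqrt (1 - a\<^sup>2) * y q))) =
          (\<lambda>y. f a * (indicator (corr_psd n) (Z 0 x y) * G (Z 0 x y)))"
      proof
        fix y
        show "h (Z a x (\<lambda>q\<in>J. a * x (\<sigma> q) + sqrt (1 - a\<^sup>2) * y q)) =
          f a * (indicator (corr_psd n) (Z 0 x y) * G (Z 0 x y))"
          unfolding h_def Zp GZ[of a x _ y] using shear[OF True, of x y]
          by (simp add: indicator_def)
      qed
      also have "(\<integral>\<^sup>+ y. f a * (indicator (corr_psd n) (Z 0 x y) * G (Z 0 x y)) \<partial>?PJ) =
          f a * (\<integral>\<^sup>+ y. indicator (corr_psd n) (Z 0 x y) * G (Z 0 x y) \<partial>?PJ)"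
        by (rule nn_integral_cmult) measurable
      finally show ?thesis using True s by (simp add: corr_weight_def cJ ac_simps)
    qed
    have [measurable]: "(\<lambda>x. \<integral>\<^sup>+ y. indicator (corr_psd n) (Z 0 x y) * G (Z 0 x y) \<partial>?PJ) \<in> borel_measurable ?PK"
    proof -
      interpret PJ: sigma_finite_measure ?PJ by (rule lborel_PiM.sigma_finite) (rule fin)
      have [measurable]: "(\<lambda>z. Z 0 (fst z) (snd z)) \<in> borel_measurable (?PK \<Otimes>\<^sub>M ?PJ)"
        by (rule Z_meas) auto
      show ?thesis
        by (rule PJ.borel_measurable_nn_integral) (simp add: case_prod_beta')
    qed
    have "(\<integral>\<^sup>+ x. indicator (corr_psd n) x * (f (x p) * G x) \<partial>Pi\<^sub>M (upper_pairs n) (\<lambda>_. lborel)) =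
        (\<integral>\<^sup>+ x. h x \<partial>Pi\<^sub>M (insert p (K \<union> J)) (\<lambda>_. lborel))"
      by (simp add: h_def I)
    also have "\<dots> = (\<integral>\<^sup>+ a. \<integral>\<^sup>+ x. h (x(p := a)) \<partial>Pi\<^sub>M (K \<union> J) (\<lambda>_. lborel) \<partial>lborel)"
      by (rule lborel_PiM.product_nn_integral_insert_rev) (use fin disj in auto)
    also have "\<dots> = (\<integral>\<^sup>+ a. \<integral>\<^sup>+ x. \<integral>\<^sup>+ y. h (Z a x y) \<partial>?PJ \<partial>?PK \<partial>lborel)"
      unfolding Z_def
    proof (intro nn_integral_cong lborel_PiM.product_nn_integral_fold disj fin)
      fix a :: real
      have "(\<lambda>x. x(p := a)) \<in> Pi\<^sub>M (K \<union> J) (\<lambda>_. lborel) \<rightarrow>\<^sub>M (borel :: (nat \<times> nat \<Rightarrow> real) measure)"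
      proof (rule measurable_coordinatewise_then_product)
        fix q
        have "(\<lambda>x. x q) \<in> borel_measurable (Pi\<^sub>M (K \<union> J) (\<lambda>_. lborel :: real measure))"
          by (rule measurable_compose[OF measurable_PiM_lborel_ident measurable_product_coordinates])
        then show "(\<lambda>x. (x(p := a)) q) \<in> borel_measurable (Pi\<^sub>M (K \<union> J) (\<lambda>_. lborel :: real measure))"
          by (cases "q = p") auto
      qed
      then show "(\<lambda>x. h (x(p := a))) \<in> borel_measurable (Pi\<^sub>M (K \<union> J) (\<lambda>_. lborel))"
        by measurable
    qed
    also have "\<dots> = (\<integral>\<^sup>+ a. (f a * ennreal (corr_weight n a)) * KG \<partial>lborel)"
    proof (rule nn_integral_cong_AE)
      have "AE a in lborel. a \<noteq> (1::real) \<and> a \<noteq> -1"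
        using AE_lborel_singleton[of "1::real"] AE_lborel_singleton[of "-1::real"] by eventually_elim auto
      then show "AE a in lborel. (\<integral>\<^sup>+ x. \<integral>\<^sup>+ y. h (Z a x y) \<partial>?PJ \<partial>?PK) = (f a * ennreal (corr_weight n a)) * KG"
      proof eventually_elim
        case (elim a)
        have "(\<integral>\<^sup>+ x. \<integral>\<^sup>+ y. h (Z a x y) \<partial>?PJ \<partial>?PK) = (\<integral>\<^sup>+ x. f a * ennreal (corr_weight n a) *
            (\<integral>\<^sup>+ y. indicator (corr_psd n) (Z 0 x y) * G (Z 0 x y) \<partial>?PJ) \<partial>?PK)"
          by (intro nn_integral_cong hZ) (use elim in auto)
        also have "\<dots> = (f a * ennreal (corr_weight n a)) * KG"
          unfolding KG_def by (rule nn_integral_cmult) measurable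
        finally show ?case .
      qed
    qed
    also have "\<dots> = (\<integral>\<^sup>+ a. f a * ennreal (corr_weight n a) \<partial>lborel) * KG"
      by (rule nn_integral_multc) measurable
    finally show "(\<integral>\<^sup>+ x. indicator (corr_psd n) x * (f (x (min i j, max i j)) * G x) \<partial>Pi\<^sub>M (upper_pairs n) (\<lambda>_. lborel))
      = (\<integral>\<^sup>+ a. f a * ennreal (corr_weight n a) \<partial>lborel) * KG"
      by (simp add: p_def)
  qed
qed

section \<open>Marginals and independence of the entries\<close>

context
  fixes M :: "'a measure" and n :: nat and C :: "'a \<Rightarrow> real mat"
  assumes U: "uniform_correlation_matrix M n C"
begin

abbreviation (input) "offdiag \<equiv> (\<lambda>\<omega>. upper_entries n (C \<omega>))"

lemma uniform_corr_prob_space: "prob_space M"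
  using U by (simp add: uniform_correlation_matrix_def)

lemma offdiag_borel [measurable]: "offdiag \<in> borel_measurable M"
proof -
  have "offdiag \<in> M \<rightarrow>\<^sub>M Pi\<^sub>M (upper_pairs n) (\<lambda>_. lborel)"
    using U by (simp add: uniform_correlation_matrix_def)
  from measurable_compose[OF this measurable_PiM_lborel_ident] show ?thesis .
qed

lemma uniform_corr_nn_integral:
  defines "V \<equiv> emeasure (Pi\<^sub>M (upper_pairs n) (\<lambda>_. lborel)) (upper_entries n ` correlation_matrices n)"
  assumes h [measurable]: "h \<in> borel_measurable borel"
  shows "(\<integral>\<^sup>+ \<omega>. h (offdiag \<omega>) \<partial>M) =
    (\<integral>\<^sup>+ x. indicator (corr_psd n) x * h x \<partial>Pi\<^sub>M (upper_pairs n) (\<lambda>_. lborel)) / V"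
proof -
  let ?P = "Pi\<^sub>M (upper_pairs n) (\<lambda>_. lborel :: real measure)"
  let ?S = "upper_entries n ` correlation_matrices n"
  have S: "?S = (\<lambda>x. x) -` corr_psd n \<inter> space ?P"
    unfolding upper_entries_correlation_matrices by (auto simp: space_PiM PiE_def)
  have Sm: "?S \<in> sets ?P"
    unfolding S by (rule measurable_sets[OF measurable_PiM_lborel_ident]) measurable
  have X: "offdiag \<in> M \<rightarrow>\<^sub>M ?P" and D: "distr M ?P offdiag = uniform_measure ?P ?S"
    using U by (simp_all add: uniform_correlation_matrix_def)
  have "(\<integral>\<^sup>+ \<omega>. h (offdiag \<omega>) \<partial>M) = (\<integral>\<^sup>+ x. h x \<partial>distr M ?P offdiag)"
    by (rule nn_integral_distr[symmetric, OF X]) measurable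
  also have "\<dots> = (\<integral>\<^sup>+ x. h x * indicator ?S x \<partial>?P) / V"
    unfolding D V_def by (rule nn_integral_uniform_measure) (use Sm in measurable)
  also have "(\<integral>\<^sup>+ x. h x * indicator ?S x \<partial>?P) = (\<integral>\<^sup>+ x. indicator (corr_psd n) x * h x \<partial>?P)"
    by (rule nn_integral_cong) (simp add: S indicator_def)
  finally show ?thesis .
qed

text \<open>Both facts come from the same factorisation, once with G = 1 and once with the given G.
  The volume V need not be known: the total mass of \<open>M\<close> fixes all constants.\<close>

lemma
  assumes ij: "i \<noteq> j" "i < n" "j < n"
    and f [measurable]: "f \<in> borel_measurable borel"
  shows uniform_corr_marginal:
      "(\<integral>\<^sup>+ \<omega>. f (C \<omega> $$ (min i j, max i j)) \<partial>M) =
        (\<integral>\<^sup>+ a. f a * ennreal (corr_weight n a) \<partial>lborel) / (\<integral>\<^sup>+ a. ennreal (corr_weight n a) \<partial>lborel)"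
    and uniform_corr_indep:
      "\<lbrakk>G \<in> borel_measurable borel;
        \<And>x y. (\<And>q. q \<in> upper_pairs n \<Longrightarrow> fst q \<noteq> j \<Longrightarrow> snd q \<noteq> j \<Longrightarrow> x q = y q) \<Longrightarrow> G x = (G y :: ennreal)\<rbrakk> \<Longrightarrow>
       (\<integral>\<^sup>+ \<omega>. f (C \<omega> $$ (min i j, max i j)) * G (offdiag \<omega>) \<partial>M) =
        (\<integral>\<^sup>+ \<omega>. f (C \<omega> $$ (min i j, max i j)) \<partial>M) * (\<integral>\<^sup>+ \<omega>. G (offdiag \<omega>) \<partial>M)"
proof -
  let ?p = "(min i j, max i j)"
  interpret prob_space M by (rule uniform_corr_prob_space)
  have p: "?p \<in> upper_pairs n" using ij by (auto simp: upper_pairs_def min_def max_def)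
  have Cp: "f (C \<omega> $$ ?p) = f (offdiag \<omega> ?p)" for \<omega> and f :: "real \<Rightarrow> ennreal"
    using p by (simp add: upper_entries_def)
  define W where "W = (\<integral>\<^sup>+ a. ennreal (corr_weight n a) \<partial>lborel)"
  define V where "V = emeasure (Pi\<^sub>M (upper_pairs n) (\<lambda>_. lborel)) (upper_entries n ` correlation_matrices n)"
  note nn = uniform_corr_nn_integral[folded V_def]
  obtain K1 where K1: "\<And>f. f \<in> borel_measurable borel \<Longrightarrow>
    (\<integral>\<^sup>+ x. indicator (corr_psd n) x * (f (x ?p) * 1) \<partial>Pi\<^sub>M (upper_pairs n) (\<lambda>_. lborel))
      = (\<integral>\<^sup>+ a. f a * ennreal (corr_weight n a) \<partial>lborel) * K1"
    using corr_psd_integral_factorizes[OF ij, of "\<lambda>_. 1"] by auto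
  have e1: "(\<integral>\<^sup>+ \<omega>. f (C \<omega> $$ ?p) \<partial>M) = (\<integral>\<^sup>+ a. f a * ennreal (corr_weight n a) \<partial>lborel) * K1 / V"
    if [measurable]: "f \<in> borel_measurable borel" for f
    unfolding Cp using nn[of "\<lambda>x. f (x ?p)"] K1[of f] by simp
  \<comment> \<open>The factorisation with f = G = 1 computes the total mass of \<open>M\<close>,
    which is 1. This identifies the constant K1 / V as 1 / W.\<close>
  have one: "W * (K1 * inverse V) = 1"
    using e1[of "\<lambda>_. 1"] by (simp add: W_def emeasure_space_1 divide_ennreal_def mult.assoc)
  have W: "W \<noteq> 0" "W \<noteq> \<top>"
  proof -
    show "W \<noteq> 0" using one by auto
    have "W \<le> (\<integral>\<^sup>+ a. indicator {-1..1::real} a \<partial>lborel)"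
      unfolding W_def
      by (intro nn_integral_mono) (auto simp: corr_weight_def indicator_def power_le_one abs_square_le_1)
    also have "\<dots> = emeasure lborel {-1..1::real}" by (rule nn_integral_indicator) simp
    finally show "W \<noteq> \<top>" by (auto simp: top_unique)
  qed
  have inv: "K1 * inverse V = inverse W"
  proof -
    have "inverse W = (inverse W * W) * (K1 * inverse V)" using one by (simp add: mult.assoc)
    also have "inverse W * W = 1" using W by (metis divide_ennreal_def ennreal_divide_self mult.commute less_top)
    finally show ?thesis by simp
  qed
  show "(\<integral>\<^sup>+ \<omega>. f (C \<omega> $$ ?p) \<partial>M) =
        (\<integral>\<^sup>+ a. f a * ennreal (corr_weight n a) \<partial>lborel) / (\<integral>\<^sup>+ a. ennreal (corr_weight n a) \<partial>lborel)"
    unfolding e1[OF f] W_def[symmetric] by (simp add: divide_ennreal_def mult.assoc inv)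
  assume G [measurable]: "G \<in> borel_measurable borel"
    and Gc: "\<And>x y. (\<And>q. q \<in> upper_pairs n \<Longrightarrow> fst q \<noteq> j \<Longrightarrow> snd q \<noteq> j \<Longrightarrow> x q = y q) \<Longrightarrow> G x = G y"
  from corr_psd_integral_factorizes[OF ij G Gc] obtain KG where KG: "\<And>f. f \<in> borel_measurable borel \<Longrightarrow>
    (\<integral>\<^sup>+ x. indicator (corr_psd n) x * (f (x ?p) * G x) \<partial>Pi\<^sub>M (upper_pairs n) (\<lambda>_. lborel))
      = (\<integral>\<^sup>+ a. f a * ennreal (corr_weight n a) \<partial>lborel) * KG" by blast
  have e2: "(\<integral>\<^sup>+ \<omega>. f (C \<omega> $$ ?p) * G (offdiag \<omega>) \<partial>M) =
      (\<integral>\<^sup>+ a. f a * ennreal (corr_weight n a) \<partial>lborel) * KG / V"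
    if [measurable]: "f \<in> borel_measurable borel" for f
    unfolding Cp using nn[of "\<lambda>x. f (x ?p) * G x"] KG[of f] by simp
  have e3: "(\<integral>\<^sup>+ \<omega>. G (offdiag \<omega>) \<partial>M) = W * KG / V"
    using e2[of "\<lambda>_. 1"] by (simp add: W_def)
  have "(\<integral>\<^sup>+ \<omega>. f (C \<omega> $$ ?p) \<partial>M) * (\<integral>\<^sup>+ \<omega>. G (offdiag \<omega>) \<partial>M) =
     (\<integral>\<^sup>+ a. f a * ennreal (corr_weight n a) \<partial>lborel) * KG * inverse V * (W * (K1 * inverse V))"
    unfolding e1[OF f] e3 by (simp add: divide_ennreal_def ac_simps)
  also have "\<dots> = (\<integral>\<^sup>+ \<omega>. f (C \<omega> $$ ?p) * G (offdiag \<omega>) \<partial>M)"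
    unfolding e2[OF f] one by (simp add: divide_ennreal_def)
  finally show "(\<integral>\<^sup>+ \<omega>. f (C \<omega> $$ ?p) * G (offdiag \<omega>) \<partial>M) =
        (\<integral>\<^sup>+ \<omega>. f (C \<omega> $$ ?p) \<partial>M) * (\<integral>\<^sup>+ \<omega>. G (offdiag \<omega>) \<partial>M)" by simp
qed

end

section \<open>Asymptotics of a single entry\<close>

lemma corr_weight_nonneg: "0 \<le> corr_weight n a"
  by (simp add: corr_weight_def abs_square_le_1)

lemma corr_weight_exp:
  assumes "\<bar>a\<bar> < 1" "2 \<le> n"
  shows "corr_weight n a = exp ((real n - 2) / 2 * ln (1 - a\<^sup>2))"
proof -
  have a: "0 < 1 - a\<^sup>2" using assms by (simp add: abs_square_less_1)
  have "sqrt (1 - a\<^sup>2) = exp (ln (1 - a\<^sup>2) / 2)"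
    using a by (simp add: ln_sqrt[symmetric])
  then have "corr_weight n a = exp (real (n - 2) * (ln (1 - a\<^sup>2) / 2))"
    using assms by (simp only: corr_weight_def exp_of_nat_mult if_True)
  then show ?thesis using assms by (simp add: of_nat_diff)
qed

text \<open>From ln(1 - x) at most -x. This Gaussian bound drives both dominated convergence
  arguments of the section.\<close>

lemma corr_weight_le_exp:
  assumes "2 \<le> n"
  shows "corr_weight n a \<le> exp (- ((real n - 2) / 2 * a\<^sup>2))"
proof (cases "\<bar>a\<bar> < 1")
  case True
  then have "0 < 1 - a\<^sup>2" by (simp add: abs_square_less_1)
  then have "ln (1 - a\<^sup>2) \<le> - a\<^sup>2" using ln_le_minus_one[of "1 - a\<^sup>2"] by simp
  then have "(real n - 2) / 2 * ln (1 - a\<^sup>2) \<le> (real n - 2) / 2 * (- a\<^sup>2)"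
    using assms by (intro mult_left_mono) auto
  then show ?thesis using corr_weight_exp[OF True assms] by simp
qed (simp add: corr_weight_def)

lemma integrable_corr_weight: "integrable lborel (corr_weight n)"
proof (rule Bochner_Integration.integrable_bound[of _ "indicat_real {-1..1::real}"])
  show "integrable lborel (indicat_real {-1..1::real})" by (rule integrable_real_indicator) auto
  show "AE a in lborel. norm (corr_weight n a) \<le> norm (indicat_real {- 1..1} a)"
    by (auto simp: corr_weight_def indicator_def power_le_one abs_square_le_1)
qed simp

text \<open>Laplace's method: after a = u / sqrt n the weight becomes (1 - u^2/n)^((n-2)/2), which
  tends to exp(-u^2/2).\<close>

lemma integral_corr_weight_tendsto:
  "(\<lambda>n. sqrt (real n) * (\<integral>a. corr_weight n a \<partial>lborel)) \<longlonglongrightarrow> sqrt (2 * pi)"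
proof -
  have gauss: "integrable lborel (\<lambda>u::real. exp (- u\<^sup>2 / 2))" "(\<integral>u. exp (- u\<^sup>2 / 2) \<partial>lborel) = sqrt (2 * pi)"
  proof -
    have eq: "(\<lambda>u::real. exp (- u\<^sup>2 / 2)) = (\<lambda>u. sqrt (2 * pi) * std_normal_density u)"
      by (simp add: std_normal_density_def)
    show "integrable lborel (\<lambda>u::real. exp (- u\<^sup>2 / 2))"
      unfolding eq by simp
    show "(\<integral>u. exp (- u\<^sup>2 / 2) \<partial>lborel) = sqrt (2 * pi)"
      unfolding eq by simp
  qed
  \<comment> \<open>The majorant: for indices m at least 3 one has (m - 2) / (2 m) at least 1/6. The
    sequence is therefore shifted by 3 below.\<close>
  have dom: "integrable lborel (\<lambda>u::real. exp (- u\<^sup>2 / 6))"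
  proof -
    have "integrable lborel (\<lambda>x::real. exp (- (0 + (1 / sqrt 3) * x)\<^sup>2 / 2))"
      by (rule lborel_integrable_real_affine[OF gauss(1)]) simp
    then show ?thesis by (simp add: power_divide)
  qed
  let ?s = "\<lambda>n u. corr_weight (n + 3) (u / sqrt (real (n + 3)))"
  have "(\<lambda>n. \<integral>u. ?s n u \<partial>lborel) \<longlonglongrightarrow> (\<integral>u. exp (- u\<^sup>2 / 2) \<partial>lborel)"
  proof (rule integral_dominated_convergence[OF _ _ dom])
    show "AE u in lborel. norm (?s n u) \<le> exp (- u\<^sup>2 / 6)" for n
    proof (rule AE_I2)
      fix u :: real
      have "?s n u \<le> exp (- ((real (n + 3) - 2) / 2 * (u / sqrt (real (n + 3)))\<^sup>2))"
        by (rule corr_weight_le_exp) simp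
      also have "\<dots> \<le> exp (- u\<^sup>2 / 6)"
      proof -
        have "(1 / 3) * u\<^sup>2 \<le> ((real (n + 3) - 2) / real (n + 3)) * u\<^sup>2"
          by (intro mult_right_mono) (auto simp: field_simps)
        then show ?thesis by (simp add: power_divide field_simps)
      qed
      finally show "norm (?s n u) \<le> exp (- u\<^sup>2 / 6)" using corr_weight_nonneg by simp
    qed
    show "AE u in lborel. (\<lambda>n. ?s n u) \<longlonglongrightarrow> exp (- u\<^sup>2 / 2)"
    proof (rule AE_I2)
      fix u :: real
      have "(\<lambda>n::nat. exp ((real n - 2) / 2 * ln (1 - u\<^sup>2 / real n))) \<longlonglongrightarrow> exp (- u\<^sup>2 / 2)"
        by real_asymp
      moreover have "eventually (\<lambda>n. exp ((real n - 2) / 2 * ln (1 - u\<^sup>2 / real n)) = corr_weight n (u / sqrt (real n))) sequentially"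
      proof -
        have "eventually (\<lambda>n. real n > max 2 (u\<^sup>2)) sequentially" by real_asymp
        then show ?thesis
        proof eventually_elim
          case (elim n)
          then have "(u / sqrt (real n))\<^sup>2 < 1" by (simp add: power_divide)
          then have "\<bar>u / sqrt (real n)\<bar> < 1" by (simp add: abs_square_less_1)
          from corr_weight_exp[OF this, of n] elim show ?case by (simp add: power_divide)
        qed
      qed
      ultimately have "(\<lambda>n. corr_weight n (u / sqrt (real n))) \<longlonglongrightarrow> exp (- u\<^sup>2 / 2)"
        by (rule Lim_transform_eventually)
      from LIMSEQ_ignore_initial_segment[OF this, of 3] show "(\<lambda>n. ?s n u) \<longlonglongrightarrow> exp (- u\<^sup>2 / 2)" .
    qed
  qed measurable
  moreover have "(\<integral>u. ?s n u \<partial>lborel) = sqrt (real (n + 3)) * (\<integral>a. corr_weight (n + 3) a \<partial>lborel)" for n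
    using lborel_integral_real_affine[of "1 / sqrt (real (n + 3))" "corr_weight (n + 3)" 0]
    by (simp add: field_simps)
  ultimately have "(\<lambda>n. sqrt (real (n + 3)) * (\<integral>a. corr_weight (n + 3) a \<partial>lborel)) \<longlonglongrightarrow> sqrt (2 * pi)"
    unfolding gauss(2) by (simp only:)
  then show ?thesis by (rule LIMSEQ_offset)
qed

lemma exceedance_level_eq:
  assumes "3 \<le> n"
  shows "exceedance_level n = 4 * ln (real n) - ln (ln (real n))"
proof -
  have "exp 1 < real n" using e_less_272 assms by linarith
  then have "0 < ln (real n)" using ln_gt_zero[of "real n"] assms by simp
  then show ?thesis using assms by (simp add: exceedance_level_def ln_div ln_realpow)
qed

section \<open>From the entry to the exceedance scale\<close>

text \<open>The map from a to (n+1) a^2 - c is two-to-one on [-1, 1]. By evenness the negative half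
  is folded onto [0, 1], and the resulting factor 2 cancels the 2 in the Jacobian of each
  branch.\<close>

lemma nn_integral_corr_weight_substitution:
  fixes g :: "real \<Rightarrow> real"
  assumes g [measurable]: "g \<in> borel_measurable borel" and g0: "\<And>t. 0 \<le> g t"
  shows "(\<integral>\<^sup>+ a. ennreal (g ((real n + 1) * a\<^sup>2 - c) * corr_weight n a) \<partial>lborel) =
    (\<integral>\<^sup>+ t. ennreal (g t * corr_weight n (sqrt ((t + c) / (real n + 1))) / sqrt ((real n + 1) * (t + c))
       * indicator {- c..real n + 1 - c} t) \<partial>lborel)"
proof -
  let ?N = "real n + 1"
  define \<phi> where "\<phi> a = ennreal (g (?N * a\<^sup>2 - c) * corr_weight n a)" for a
  have [measurable]: "\<phi> \<in> borel_measurable borel" unfolding \<phi>_def by measurable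
  \<comment> \<open>The contribution of a single branch, hence the 2 in the denominator.\<close>
  define f where "f t = ennreal (g t * corr_weight n (sqrt ((t + c) / ?N)) / (2 * sqrt (?N * (t + c))))" for t
  have [measurable]: "f \<in> borel_measurable borel" unfolding f_def by measurable
  have even: "\<phi> (- a) = \<phi> a" for a by (simp add: \<phi>_def corr_weight_def)
  have "(\<integral>\<^sup>+ a. \<phi> a \<partial>lborel) = (\<integral>\<^sup>+ a. \<phi> a * indicator {0..1} a + \<phi> a * indicator {-1..<0} a \<partial>lborel)"
    by (intro nn_integral_cong) (auto simp: \<phi>_def corr_weight_def indicator_def)
  also have "\<dots> = (\<integral>\<^sup>+ a. \<phi> a * indicator {0..1} a \<partial>lborel) + (\<integral>\<^sup>+ a. \<phi> a * indicator {-1..<0} a \<partial>lborel)"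
    by (rule nn_integral_add) measurable
  also have "(\<integral>\<^sup>+ a. \<phi> a * indicator {-1..<0} a \<partial>lborel) = (\<integral>\<^sup>+ a. \<phi> (0 + (-1) * a) * indicator {-1..<0} (0 + (-1) * a) \<partial>lborel)"
    by (subst nn_integral_real_affine[of _ "-1" 0]) auto
  also have "\<dots> = (\<integral>\<^sup>+ a. \<phi> a * indicator {0..1} a \<partial>lborel)"
  proof (rule nn_integral_cong_AE)
    have "AE a in lborel. a \<noteq> (0::real)" by (rule AE_lborel_singleton)
    then show "AE a in lborel. \<phi> (0 + (-1) * a) * indicator {-1..<0} (0 + (-1) * a) = \<phi> a * indicator {0..1} a"
      by eventually_elim (auto simp: even indicator_def)
  qed
  also have "(\<integral>\<^sup>+ a. \<phi> a * indicator {0..1} a \<partial>lborel) =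
      (\<integral>\<^sup>+ a. f (?N * a\<^sup>2 - c) * ennreal (2 * ?N * a) * indicator {0..1} a \<partial>lborel)"
  \<comment> \<open>At a = 0 the derivative vanishes and cannot be cancelled, so that point is left
    out.\<close>
  proof (rule nn_integral_cong_AE)
    have "AE a in lborel. a \<noteq> (0::real)" by (rule AE_lborel_singleton)
    then show "AE a in lborel. \<phi> a * indicator {0..1} a = f (?N * a\<^sup>2 - c) * ennreal (2 * ?N * a) * indicator {0..1} a"
    proof eventually_elim
      case (elim a)
      show ?case
      proof (cases "a \<in> {0..1}")
        case True
        then have a: "0 < a" using elim by auto
        have 1: "sqrt (?N * (?N * a\<^sup>2 - c + c)) = ?N * a"
          using a by (simp add: power2_eq_square real_sqrt_mult)
        have 2: "sqrt ((?N * a\<^sup>2 - c + c) / ?N) = a" using a by simp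
        have "f (?N * a\<^sup>2 - c) * ennreal (2 * ?N * a) =
            ennreal (g (?N * a\<^sup>2 - c) * corr_weight n a / (2 * (?N * a)) * (2 * ?N * a))"
          unfolding f_def 1 2 using a g0 corr_weight_nonneg
          by (intro ennreal_mult[symmetric]) (auto intro!: mult_nonneg_nonneg divide_nonneg_nonneg)
        also have "\<dots> = \<phi> a" using a by (simp add: \<phi>_def)
        finally show ?thesis by simp
      qed simp
    qed
  qed
  also have "\<dots> = (\<integral>\<^sup>+ t. f t * indicator {?N * 0\<^sup>2 - c..?N * 1\<^sup>2 - c} t \<partial>lborel)"
    by (rule nn_integral_substitution_aux[symmetric])
      (auto intro!: derivative_eq_intros continuous_intros)
  also have "\<dots> + \<dots> = (\<integral>\<^sup>+ t. f t * indicator {- c..?N - c} t + f t * indicator {- c..?N - c} t \<partial>lborel)"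
    by (subst nn_integral_add) auto
  also have "\<dots> = (\<integral>\<^sup>+ t. ennreal (g t * corr_weight n (sqrt ((t + c) / ?N)) / sqrt (?N * (t + c))
       * indicator {- c..?N - c} t) \<partial>lborel)"
  proof (rule nn_integral_cong)
    fix t
    show "f t * indicator {- c..?N - c} t + f t * indicator {- c..?N - c} t =
      ennreal (g t * corr_weight n (sqrt ((t + c) / ?N)) / sqrt (?N * (t + c)) * indicator {- c..?N - c} t)"
    proof (cases "t \<in> {- c..?N - c}")
      case True
      then have "0 \<le> g t * corr_weight n (sqrt ((t + c) / ?N)) / (2 * sqrt (?N * (t + c)))"
        using g0 corr_weight_nonneg by (auto intro!: divide_nonneg_nonneg mult_nonneg_nonneg)
      then show ?thesis
        using True by (simp add: f_def ennreal_plus[symmetric] del: ennreal_plus)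
    qed simp
  qed
  finally show ?thesis by (simp add: \<phi>_def)
qed

lemma integrable_exp_half_tail: "integrable lborel (\<lambda>t::real. exp (- t / 2) * indicator {t0..} t)"
proof -
  have "integrable lborel (\<lambda>t. exponential_density (1 / 2) t)"
    using prob_space_exponential_density[of "1/2"]
    by (intro integrableI_nonneg) (auto simp: exponential_density_nonneg dest!: prob_space.emeasure_space_1 simp: emeasure_density)
  then have "integrable lborel (\<lambda>t. 2 * exp (- t0 / 2) * exponential_density (1 / 2) (- t0 + 1 * t))"
    by (intro integrable_mult_right lborel_integrable_real_affine) auto
  moreover have "(\<lambda>t. 2 * exp (- t0 / 2) * exponential_density (1 / 2) (- t0 + 1 * t)) =
      (\<lambda>t. exp (- t / 2) * indicator {t0..} t)"
    by (auto simp: exponential_density_def fun_eq_iff indicator_def exp_add[symmetric] field_simps)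
  ultimately show ?thesis by (simp only:)
qed


text \<open>The image of \<open>corr_weight\<close> on the exceedance scale, multiplied by the
  number n(n-1)/2 of pairs. The factor sqrt n compensates the normalising integral of the weight,
  which is asymptotic to sqrt(2 pi / n).\<close>

definition exceedance_density :: "nat \<Rightarrow> real \<Rightarrow> real" where
  "exceedance_density n t = sqrt (real n) * (real n * (real n - 1) / 2) *
     corr_weight n (sqrt ((t + exceedance_level n) / (real n + 1))) /
     sqrt ((real n + 1) * (t + exceedance_level n))"

text \<open>The weight behaves like exp(-x/2) with x = t + level, that is, like exp(-t/2) sqrt(ln n)
  / n^2. The number of pairs cancels n^2 up to 1/2, and sqrt(ln n / x) tends to 1/2.\<close>

lemma exceedance_density_tendsto:
  "(\<lambda>n. exceedance_density n t) \<longlonglongrightarrow> exp (- t / 2) / 4"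
proof -
  \<comment> \<open>\<open>x n\<close> is the value of (n+1) times the squared entry at the point t,
    and \<open>y n\<close> is the squared entry itself.\<close>
  define x where "x n = 4 * ln (real n) - ln (ln (real n)) + t" for n :: nat
  define y where "y n = x n / (real n + 1)" for n
  have y0: "y \<longlonglongrightarrow> 0" unfolding y_def x_def by real_asymp
  have ny: "(\<lambda>n. sqrt (real n) * y n) \<longlonglongrightarrow> 0" unfolding y_def x_def by real_asymp
  have xpos: "eventually (\<lambda>n. 0 < x n) sequentially" unfolding x_def by real_asymp
  \<comment> \<open>Replacing ln(1 - y) by -y costs about n y^2, which vanishes because y is of
    order ln n / n.\<close>
  have err: "(\<lambda>n. (real n - 2) / 2 * (ln (1 - y n) + y n)) \<longlonglongrightarrow> 0"
  proof (rule Lim_null_comparison)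
    show "(\<lambda>n. (sqrt (real n) * y n)\<^sup>2) \<longlonglongrightarrow> 0" using tendsto_power[OF ny, of 2] by simp
    have "eventually (\<lambda>n. \<bar>y n\<bar> < 1 / 2) sequentially"
      using tendstoD[OF y0, of "1/2"] by (simp add: dist_real_def)
    then show "eventually (\<lambda>n. norm ((real n - 2) / 2 * (ln (1 - y n) + y n)) \<le> (sqrt (real n) * y n)\<^sup>2) sequentially"
      using eventually_ge_at_top[of 2]
    proof eventually_elim
      case (elim n)
      have "\<bar>ln (1 + - y n) - - y n\<bar> \<le> 2 * (- y n)\<^sup>2"
        using elim by (intro abs_ln_one_plus_x_minus_x_bound) auto
      then have "(real n - 2) / 2 * \<bar>ln (1 - y n) + y n\<bar> \<le> (real n - 2) / 2 * (2 * (y n)\<^sup>2)"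
        using elim by (intro mult_left_mono) auto
      also have "\<dots> \<le> real n * (y n)\<^sup>2"
        using elim by (simp add: algebra_simps)
      finally show ?case using elim by (simp add: abs_mult power_mult_distrib)
    qed
  qed
  \<comment> \<open>The term 3/2 y is the gap between the exponent (n - 2)/2 of the weight and the
    factor (n + 1)/2 for which (n + 1) y = x holds exactly.\<close>
  have "(\<lambda>n. exp ((real n - 2) / 2 * (ln (1 - y n) + y n) + (3 / 2 * y n - t / 2))) \<longlonglongrightarrow> exp (0 + (3 / 2 * 0 - t / 2))"
    by (intro tendsto_intros err y0)
  then have A: "(\<lambda>n. exp ((real n - 2) / 2 * (ln (1 - y n) + y n) + (3 / 2 * y n - t / 2))) \<longlonglongrightarrow> exp (- t / 2)" by simp
  \<comment> \<open>The limit is 1/2 * 1/2: one half from counting unordered pairs, the other from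
    sqrt(ln n / x), since x is asymptotic to 4 ln n.\<close>
  have B: "(\<lambda>n. sqrt (real n / (real n + 1)) * (1 - 1 / real n) / 2 * sqrt (ln (real n) / x n)) \<longlonglongrightarrow> 1 / 4"
  proof -
    have 1: "(\<lambda>n::nat. sqrt (real n / (real n + 1)) * (1 - 1 / real n) / 2) \<longlonglongrightarrow> 1 / 2" by real_asymp
    have 2: "(\<lambda>n. ln (real n) / x n) \<longlonglongrightarrow> 1 / 4" unfolding x_def by real_asymp
    have "(\<lambda>n. sqrt (real n / (real n + 1)) * (1 - 1 / real n) / 2 * sqrt (ln (real n) / x n)) \<longlonglongrightarrow> 1 / 2 * sqrt (1 / 4)"
      by (intro tendsto_intros 1 2)
    moreover have "sqrt (1 / 4) = (1 / 2 :: real)" by (rule real_sqrt_unique) (auto simp: power2_eq_square)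
    ultimately show ?thesis by simp
  qed
  have AB: "(\<lambda>n. exp ((real n - 2) / 2 * (ln (1 - y n) + y n) + (3 / 2 * y n - t / 2)) *
      (sqrt (real n / (real n + 1)) * (1 - 1 / real n) / 2 * sqrt (ln (real n) / x n))) \<longlonglongrightarrow> exp (- t / 2) * (1 / 4)"
    by (intro tendsto_mult A B)
  have "eventually (\<lambda>n. \<bar>y n\<bar> < 1) sequentially"
    using tendstoD[OF y0, of 1] by (simp add: dist_real_def)
  then have ev: "eventually (\<lambda>n. exp ((real n - 2) / 2 * (ln (1 - y n) + y n) + (3 / 2 * y n - t / 2)) *
      (sqrt (real n / (real n + 1)) * (1 - 1 / real n) / 2 * sqrt (ln (real n) / x n)) =
     exceedance_density n t) sequentially"
    using xpos eventually_ge_at_top[of 3]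
  proof eventually_elim
    case (elim n)
    have lev: "t + exceedance_level n = x n" using elim by (simp add: exceedance_level_eq x_def)
    have yp: "0 < y n" using elim by (simp add: y_def)
    have "exp 1 < real n" using e_less_272 elim by linarith
    then have ln: "0 < ln (real n)" using elim by simp
    have w: "corr_weight n (sqrt (x n / (real n + 1))) = exp ((real n - 2) / 2 * ln (1 - y n))"
    proof -
      have "\<bar>sqrt (y n)\<bar> < 1" using yp elim by simp
      from corr_weight_exp[OF this, of n] elim yp show ?thesis by (simp add: y_def)
    qed
    have "(real n - 2) / 2 * y n + 3 / 2 * y n - t / 2 = x n / 2 - t / 2"
    proof -
      have "(real n - 2) / 2 * y n + 3 / 2 * y n = (real n + 1) * y n / 2" by (simp add: field_simps)
      also have "(real n + 1) * y n = x n" by (simp add: y_def add_nonneg_eq_0_iff)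
      finally show ?thesis by simp
    qed
    then have "(real n - 2) / 2 * (ln (1 - y n) + y n) + (3 / 2 * y n - t / 2) =
       (real n - 2) / 2 * ln (1 - y n) + (2 * ln (real n) - ln (ln (real n)) / 2)"
    proof -
      assume *: "(real n - 2) / 2 * y n + 3 / 2 * y n - t / 2 = x n / 2 - t / 2"
      have "(real n - 2) / 2 * (ln (1 - y n) + y n) = (real n - 2) / 2 * ln (1 - y n) + (real n - 2) / 2 * y n"
        by (rule distrib_left)
      moreover have "x n / 2 - t / 2 = 2 * ln (real n) - ln (ln (real n)) / 2"
        by (simp add: x_def field_simps)
      ultimately show ?thesis using * by linarith
    qed
    moreover have "exp (2 * ln (real n) - ln (ln (real n)) / 2) = (real n)\<^sup>2 / sqrt (ln (real n))"
    proof -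
      have "exp (ln (ln (real n)) / 2) = sqrt (ln (real n))"
        using ln by (simp add: ln_sqrt[symmetric])
      moreover have "exp (2 * ln (real n)) = (real n)\<^sup>2"
        using elim by (simp add: exp_double)
      ultimately show ?thesis by (simp add: exp_diff)
    qed
    ultimately have e: "exp ((real n - 2) / 2 * (ln (1 - y n) + y n) + (3 / 2 * y n - t / 2)) =
        exp ((real n - 2) / 2 * ln (1 - y n)) * ((real n)\<^sup>2 / sqrt (ln (real n)))"
      by (simp add: exp_add)
    have alg: "E * (N\<^sup>2 / L) * (A / D * (1 - 1 / N) / 2 * (L / X)) = A * (N * (N - 1) / 2) * E / (D * X)"
      if "L \<noteq> 0" "N \<noteq> 0" "D \<noteq> 0" "X \<noteq> 0" for A D E L N X :: real
      using that by (simp add: field_simps power2_eq_square)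
    show ?case
      unfolding exceedance_density_def lev w e unfolding real_sqrt_mult real_sqrt_divide using elim ln by (intro alg) auto
  qed
  from Lim_transform_eventually[OF AB ev] show ?thesis by simp
qed

text \<open>Supplies the majorant for dominated convergence. The upper cutoff on t says that the
  entry is at most 1 in absolute value, and the lower one keeps the root in the denominator away
  from zero.\<close>

lemma exceedance_density_bound:
  "eventually (\<lambda>n. \<forall>t\<ge>t0. t \<le> real n + 1 - exceedance_level n \<longrightarrow>
     0 < t + exceedance_level n \<and>
     exceedance_density n t \<le> exp (3 / 2) / 2 * exp (- t / 2)) sequentially"
proof -
  \<comment> \<open>Above \<open>t0\<close> the shifted point x eventually exceeds ln n; this gives
    the lower bound for the denominator sqrt((n+1) x).\<close>
  have "eventually (\<lambda>n. ln (real n) \<le> 4 * ln (real n) - ln (ln (real n)) + t0) sequentially"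
    by real_asymp
  then show ?thesis using eventually_ge_at_top[of 3]
  proof eventually_elim
    case (elim n)
    show ?case
    proof (intro allI impI)
      fix t assume t: "t0 \<le> t" "t \<le> real n + 1 - exceedance_level n"
      define x where "x = t + exceedance_level n"
      have "exp 1 < real n" using e_less_272 elim by linarith
      then have ln: "0 < ln (real n)" using elim by simp
      have x: "ln (real n) \<le> x" "x \<le> real n + 1"
        using elim t by (auto simp: x_def exceedance_level_eq)
      have "corr_weight n (sqrt (x / (real n + 1))) \<le> exp (- ((real n - 2) / 2 * (sqrt (x / (real n + 1)))\<^sup>2))"
        using elim by (intro corr_weight_le_exp) auto
      also have "(sqrt (x / (real n + 1)))\<^sup>2 = x / (real n + 1)" using x ln by simp
      also have "- ((real n - 2) / 2 * (x / (real n + 1))) = - x / 2 + 3 / 2 * (x / (real n + 1))"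
        by (simp add: field_simps)
      \<comment> \<open>The origin of the constant exp(3/2): the correction 3/2 * x / (n+1) is at
        most 3/2 because the squared entry x / (n+1) is at most 1.\<close>
      also have "\<dots> \<le> - x / 2 + 3 / 2"
      proof -
        have "x / (real n + 1) \<le> 1" using x by simp
        then show ?thesis by linarith
      qed
      also have "- x / 2 + 3 / 2 = 3 / 2 + - t / 2 - (2 * ln (real n) - ln (ln (real n)) / 2)"
        using elim by (simp add: x_def exceedance_level_eq field_simps)
      also have "exp \<dots> = exp (3 / 2) * exp (- t / 2) * (sqrt (ln (real n)) / (real n)\<^sup>2)"
      proof -
        have "exp (ln (ln (real n)) / 2) = sqrt (ln (real n))"
          using ln by (simp add: ln_sqrt[symmetric])
        moreover have "exp (2 * ln (real n)) = (real n)\<^sup>2"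
          using elim by (simp add: exp_double)
        ultimately have "exp (2 * ln (real n) - ln (ln (real n)) / 2) = (real n)\<^sup>2 / sqrt (ln (real n))"
          by (simp add: exp_diff)
        then show ?thesis
          unfolding exp_diff[of "3 / 2 + - t / 2"] exp_add by simp
      qed
      finally have w: "corr_weight n (sqrt (x / (real n + 1))) \<le> exp (3 / 2) * exp (- t / 2) * (sqrt (ln (real n)) / (real n)\<^sup>2)"
        by simp
      let ?E = "exp (3 / 2) * exp (- t / 2)"
      have s: "sqrt (real n) * sqrt (ln (real n)) \<le> sqrt ((real n + 1) * x)"
        unfolding real_sqrt_mult[symmetric] using x ln by (intro real_sqrt_le_mono mult_mono) auto
      have "sqrt (real n) * (real n * (real n - 1) / 2) * corr_weight n (sqrt (x / (real n + 1)))
          \<le> sqrt (real n) * ((real n)\<^sup>2 / 2) * (?E * (sqrt (ln (real n)) / (real n)\<^sup>2))"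
        using w elim corr_weight_nonneg by (intro mult_mono) (auto simp: power2_eq_square)
      also have "\<dots> = ?E / 2 * (sqrt (real n) * sqrt (ln (real n)))"
        using elim by simp
      also have "\<dots> \<le> ?E / 2 * sqrt ((real n + 1) * x)"
        using s by (intro mult_left_mono) auto
      finally have "sqrt (real n) * (real n * (real n - 1) / 2) * corr_weight n (sqrt (x / (real n + 1)))
          \<le> ?E / 2 * sqrt ((real n + 1) * x)" .
      moreover have "0 < sqrt ((real n + 1) * x)" using x ln by simp
      ultimately have "sqrt (real n) * (real n * (real n - 1) / 2) * corr_weight n (sqrt (x / (real n + 1)))
           / sqrt ((real n + 1) * x) \<le> ?E / 2"
        by (simp only: pos_divide_le_eq)
      then show "0 < t + exceedance_level n \<and>
       exceedance_density n t \<le> exp (3 / 2) / 2 * exp (- t / 2)"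
        using x ln unfolding x_def exceedance_density_def by simp
    qed
  qed
qed

lemma integral_intensity:
  assumes [measurable]: "g \<in> borel_measurable borel"
  shows "(\<integral>t. g t \<partial>intensity) = (\<integral>t. 1 / (2 * sqrt (8 * pi)) * exp (- t / 2) * g t \<partial>lborel)"
  unfolding intensity_def by (subst integral_real_density) auto

text \<open>The mean of g at one exceedance point. No pair occurs in it, because all entries have
  the same law.\<close>

definition exceedance_mean :: "nat \<Rightarrow> (real \<Rightarrow> real) \<Rightarrow> real" where
  "exceedance_mean n g = (\<integral>a. g ((real n + 1) * a\<^sup>2 - exceedance_level n) * corr_weight n a \<partial>lborel) / (\<integral>a. corr_weight n a \<partial>lborel)"

text \<open>The densities on the exceedance scale converge pointwise under an integrable majorant,
  so the mean of g summed over all pairs converges to its integral against the limiting density.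
  Vanishing of g below \<open>t0\<close> keeps the non-integrable left tail of exp(-t/2)
  out.\<close>

lemma marginal_exceedance_tendsto:
  fixes g :: "real \<Rightarrow> real"
  assumes g [measurable]: "g \<in> borel_measurable borel"
    and g01: "\<And>t. 0 \<le> g t \<and> g t \<le> 1" and gt0: "\<And>t. t < t0 \<Longrightarrow> g t = 0"
  shows "(\<lambda>n. real n * (real n - 1) / 2 * exceedance_mean n g)
     \<longlonglongrightarrow> (\<integral>t. g t \<partial>intensity)"
proof -
  define \<mu> where "\<mu> = exceedance_level"
  define h where "h n t = g t * exceedance_density n t * indicator {- \<mu> n..real n + 1 - \<mu> n} t" for n t
  have [measurable]: "h n \<in> borel_measurable borel" for n
    unfolding h_def exceedance_density_def by measurable
  have subst: "sqrt (real n) * (real n * (real n - 1) / 2) *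
      (\<integral>a. g ((real n + 1) * a\<^sup>2 - \<mu> n) * corr_weight n a \<partial>lborel) = (\<integral>t. h n t \<partial>lborel)" for n
  proof -
    let ?k = "\<lambda>t. g t * corr_weight n (sqrt ((t + \<mu> n) / (real n + 1))) / sqrt ((real n + 1) * (t + \<mu> n))
       * indicator {- \<mu> n..real n + 1 - \<mu> n} t"
    have "(\<integral>a. g ((real n + 1) * a\<^sup>2 - \<mu> n) * corr_weight n a \<partial>lborel) =
        enn2real (\<integral>\<^sup>+ a. ennreal (g ((real n + 1) * a\<^sup>2 - \<mu> n) * corr_weight n a) \<partial>lborel)"
      by (rule integral_eq_nn_integral) (use g01 corr_weight_nonneg in \<open>auto intro!: mult_nonneg_nonneg\<close>)
    also have "\<dots> = enn2real (\<integral>\<^sup>+ t. ennreal (?k t) \<partial>lborel)"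
      by (subst nn_integral_corr_weight_substitution) (use g01 in auto)
    also have "\<dots> = (\<integral>t. ?k t \<partial>lborel)"
      by (rule integral_eq_nn_integral[symmetric])
        (use g01 corr_weight_nonneg in \<open>auto intro!: mult_nonneg_nonneg divide_nonneg_nonneg AE_I2 simp: indicator_def\<close>)
    finally have e: "(\<integral>a. g ((real n + 1) * a\<^sup>2 - \<mu> n) * corr_weight n a \<partial>lborel) = (\<integral>t. ?k t \<partial>lborel)" .
    have "sqrt (real n) * (real n * (real n - 1) / 2) * (\<integral>t. ?k t \<partial>lborel) =
      (\<integral>t. sqrt (real n) * (real n * (real n - 1) / 2) * ?k t \<partial>lborel)"
      by (rule integral_mult_right_zero[symmetric])
    also have "\<dots> = (\<integral>t. h n t \<partial>lborel)"
      by (intro Bochner_Integration.integral_cong) (auto simp: h_def exceedance_density_def \<mu>_def)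
    finally show ?thesis unfolding e .
  qed
  obtain n0 where n0: "\<And>n t. n \<ge> n0 \<Longrightarrow> t \<ge> t0 \<Longrightarrow> t \<le> real n + 1 - \<mu> n \<Longrightarrow>
     0 < t + \<mu> n \<and> exceedance_density n t \<le> exp (3 / 2) / 2 * exp (- t / 2)"
    using exceedance_density_bound[of t0] unfolding eventually_sequentially \<mu>_def by blast
  \<comment> \<open>The majorant holds only from \<open>n0\<close> on, while dominated convergence
    asks for it at every index; hence the shift.\<close>
  have "(\<lambda>n. \<integral>t. h (n + Suc n0) t \<partial>lborel) \<longlonglongrightarrow> (\<integral>t. g t * (exp (- t / 2) / 4) \<partial>lborel)"
  proof (rule integral_dominated_convergence)
    show "integrable lborel (\<lambda>t. exp (3 / 2) / 2 * (exp (- t / 2) * indicator {t0..} t))"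
      by (intro integrable_mult_right integrable_exp_half_tail)
    show "AE t in lborel. norm (h (n + Suc n0) t) \<le> exp (3 / 2) / 2 * (exp (- t / 2) * indicator {t0..} t)" for n
    proof (rule AE_I2)
      fix t
      let ?n = "n + Suc n0"
      show "norm (h ?n t) \<le> exp (3 / 2) / 2 * (exp (- t / 2) * indicator {t0..} t)"
      proof (cases "t0 \<le> t \<and> t \<in> {- \<mu> ?n..real ?n + 1 - \<mu> ?n}")
        case False
        then show ?thesis using gt0[of t] by (auto simp: h_def indicator_def)
      next
        case True
        let ?d = "exceedance_density ?n t"
        have b: "?d \<le> exp (3 / 2) / 2 * exp (- t / 2)" "0 < t + \<mu> ?n"
          using n0[of ?n t] True by auto
        have d0: "0 \<le> ?d"
          using b(2) corr_weight_nonneg unfolding exceedance_density_def \<mu>_def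
          by (intro divide_nonneg_nonneg mult_nonneg_nonneg) auto
        have "g t * ?d \<le> 1 * ?d" using g01 d0 by (intro mult_right_mono) auto
        moreover have "0 \<le> g t * ?d" using g01 d0 by (intro mult_nonneg_nonneg) auto
        moreover have "h ?n t = g t * ?d" using True by (simp add: h_def)
        ultimately have "0 \<le> h ?n t" "h ?n t \<le> exp (3 / 2) / 2 * exp (- t / 2)"
          using b(1) by linarith+
        moreover have "indicator {t0..} t = (1::real)" using True by simp
        ultimately show ?thesis by (simp only: real_norm_def abs_of_nonneg mult_1_right)
      qed
    qed
    show "AE t in lborel. (\<lambda>n. h (n + Suc n0) t) \<longlonglongrightarrow> g t * (exp (- t / 2) / 4)"
    proof (rule AE_I2)
      fix t
      show "(\<lambda>n. h (n + Suc n0) t) \<longlonglongrightarrow> g t * (exp (- t / 2) / 4)"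
      proof (rule LIMSEQ_ignore_initial_segment)
        have L: "(\<lambda>n. g t * exceedance_density n t) \<longlonglongrightarrow> g t * (exp (- t / 2) / 4)"
          by (intro tendsto_mult tendsto_const exceedance_density_tendsto)
        have "eventually (\<lambda>n. 0 \<le> 4 * ln (real n) - ln (ln (real n)) + t) sequentially" by real_asymp
        moreover have "eventually (\<lambda>n. 4 * ln (real n) - ln (ln (real n)) + t \<le> real n + 1) sequentially" by real_asymp
        ultimately have "eventually (\<lambda>n. g t * exceedance_density n t = h n t) sequentially"
          using eventually_ge_at_top[of 3]
          by eventually_elim (auto simp: h_def \<mu>_def exceedance_level_eq)
        from Lim_transform_eventually[OF L this] show "(\<lambda>n. h n t) \<longlonglongrightarrow> g t * (exp (- t / 2) / 4)" .
      qed
    qed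
  qed measurable
  then have lim: "(\<lambda>n. \<integral>t. h n t \<partial>lborel) \<longlonglongrightarrow> (\<integral>t. g t * (exp (- t / 2) / 4) \<partial>lborel)"
    by (rule LIMSEQ_offset)
  have "(\<lambda>n. (\<integral>t. h n t \<partial>lborel) / (sqrt (real n) * (\<integral>a. corr_weight n a \<partial>lborel))) \<longlonglongrightarrow>
      (\<integral>t. g t * (exp (- t / 2) / 4) \<partial>lborel) / sqrt (2 * pi)"
    by (intro tendsto_divide lim integral_corr_weight_tendsto) auto
  \<comment> \<open>The constants meet here: (1/4) / sqrt(2 pi) = 1 / (2 sqrt(8 pi)), as sqrt(8 pi)
    = 2 sqrt(2 pi).\<close>
  moreover have "(\<integral>t. g t * (exp (- t / 2) / 4) \<partial>lborel) / sqrt (2 * pi) = (\<integral>t. g t \<partial>intensity)"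
  proof -
    have "sqrt (8 * pi) = 2 * sqrt (2 * pi)"
      using real_sqrt_mult[of 4 "2 * pi"] by simp
    then have "(\<lambda>t. 1 / (2 * sqrt (8 * pi)) * exp (- t / 2) * g t) = (\<lambda>t. g t * (exp (- t / 2) / 4) / sqrt (2 * pi))"
      by (simp add: fun_eq_iff)
    then show ?thesis by (subst integral_intensity) (auto simp del: times_divide_eq_right)
  qed
  moreover have "eventually (\<lambda>n. (\<integral>t. h n t \<partial>lborel) / (sqrt (real n) * (\<integral>a. corr_weight n a \<partial>lborel)) =
    real n * (real n - 1) / 2 * exceedance_mean n g) sequentially"
    using eventually_gt_at_top[of 0]
    by eventually_elim (simp add: subst[symmetric] \<mu>_def exceedance_mean_def)
  ultimately show ?thesis
    using Lim_transform_eventually by fastforce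
qed

section \<open>Local dependence and generating functions\<close>

text \<open>Factors are added one at a time. For a new p, the neighbours of p are dropped from the
  product, independence splits off the mean of \<open>Y p\<close>, and the neighbours are put back.
  Each of the two changes costs at most the sum of the products of means over the neighbours of p,
  the first one by pairwise independence; this explains the factor 2.\<close>

lemma (in prob_space) expectation_prod_local_dependence:
  fixes Y :: "'i \<Rightarrow> 'a \<Rightarrow> real" and R :: "'i \<Rightarrow> 'i \<Rightarrow> bool"
  assumes fin: "finite I"
    and meas [measurable]: "\<And>p. p \<in> I \<Longrightarrow> Y p \<in> borel_measurable M"
    and bnd: "\<And>p \<omega>. p \<in> I \<Longrightarrow> 0 \<le> Y p \<omega> \<and> Y p \<omega> \<le> 1"
    and indep: "\<And>p S. p \<in> I \<Longrightarrow> S \<subseteq> I \<Longrightarrow> p \<notin> S \<Longrightarrow> (\<And>q. q \<in> S \<Longrightarrow> \<not> R p q) \<Longrightarrow>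
      expectation (\<lambda>\<omega>. Y p \<omega> * (\<Prod>q\<in>S. 1 - Y q \<omega>)) =
        expectation (Y p) * expectation (\<lambda>\<omega>. \<Prod>q\<in>S. 1 - Y q \<omega>)"
    and pair: "\<And>p q. p \<in> I \<Longrightarrow> q \<in> I \<Longrightarrow> p \<noteq> q \<Longrightarrow> R p q \<Longrightarrow>
      expectation (\<lambda>\<omega>. Y p \<omega> * Y q \<omega>) = expectation (Y p) * expectation (Y q)"
  shows "\<bar>expectation (\<lambda>\<omega>. \<Prod>p\<in>I. 1 - Y p \<omega>) - (\<Prod>p\<in>I. 1 - expectation (Y p))\<bar>
    \<le> (\<Sum>p\<in>I. \<Sum>q\<in>{q \<in> I. q \<noteq> p \<and> R p q}. 2 * expectation (Y p) * expectation (Y q))"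
proof -
  let ?e = "\<lambda>p. expectation (Y p)"
  have bounded_int: "integrable M f"
    if "f \<in> borel_measurable M" "\<And>\<omega>. 0 \<le> f \<omega> \<and> f \<omega> \<le> 1" for f :: "'a \<Rightarrow> real"
    using that by (intro integrable_const_bound[of _ 1]) (auto simp: abs_le_iff)
  have prod_bnd: "0 \<le> (\<Prod>q\<in>S. 1 - Y q \<omega>) \<and> (\<Prod>q\<in>S. 1 - Y q \<omega>) \<le> 1" if "S \<subseteq> I" for S \<omega>
    using that bnd by (auto intro!: prod_nonneg prod_le_1)
  have e_bnd: "0 \<le> ?e p \<and> ?e p \<le> 1" if "p \<in> I" for p
  proof -
    have "?e p \<le> expectation (\<lambda>_. 1)"
      using that bnd by (intro Bochner_Integration.integral_mono bounded_int) auto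
    then show ?thesis using that bnd by (auto intro!: Bochner_Integration.integral_nonneg simp: prob_space)
  qed
  have "finite J \<Longrightarrow> J \<subseteq> I \<Longrightarrow>
    \<bar>expectation (\<lambda>\<omega>. \<Prod>p\<in>J. 1 - Y p \<omega>) - (\<Prod>p\<in>J. 1 - ?e p)\<bar>
    \<le> (\<Sum>p\<in>J. \<Sum>q\<in>{q \<in> J. q \<noteq> p \<and> R p q}. 2 * ?e p * ?e q)" for J
  proof (induction J rule: finite_induct)
    case empty
    then show ?case by (simp add: prob_space)
  next
    case (insert p J)
    then have p: "p \<in> I" and J: "J \<subseteq> I" by auto
    have [measurable]: "Y p \<in> borel_measurable M" "\<And>q. q \<in> J \<Longrightarrow> Y q \<in> borel_measurable M"
      using p J by (auto intro: meas)
    \<comment> \<open>Neighbours of p go into \<open>A\<close>, the factors from which p is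
      independent into \<open>F\<close>.\<close>
    define A where "A = {q \<in> J. R p q}"
    define F where "F = {q \<in> J. \<not> R p q}"
    have AF: "J = A \<union> F" "A \<inter> F = {}" "finite A" "finite F" "A \<subseteq> I" "F \<subseteq> I"
      using insert.hyps J by (auto simp: A_def F_def)
    have [measurable]: "\<And>q. q \<in> A \<Longrightarrow> Y q \<in> borel_measurable M" "\<And>q. q \<in> F \<Longrightarrow> Y q \<in> borel_measurable M"
      using AF meas by auto
    let ?PJ = "\<lambda>\<omega>. \<Prod>q\<in>J. 1 - Y q \<omega>" and ?PF = "\<lambda>\<omega>. \<Prod>q\<in>F. 1 - Y q \<omega>"
    have intJ: "integrable M ?PJ" and intF: "integrable M ?PF" and intp: "integrable M (Y p)"
      and intpJ: "integrable M (\<lambda>\<omega>. Y p \<omega> * ?PJ \<omega>)" and intpF: "integrable M (\<lambda>\<omega>. Y p \<omega> * ?PF \<omega>)"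
      using prod_bnd[OF J] prod_bnd[OF AF(6)] bnd[OF p] by (auto intro!: bounded_int mult_le_one)
    have intq: "integrable M (Y q)" and intpq: "integrable M (\<lambda>\<omega>. Y p \<omega> * Y q \<omega>)" if "q \<in> A" for q
      using that AF p bnd meas by (auto intro!: bounded_int mult_le_one)
    \<comment> \<open>Dropping the factors in \<open>A\<close> changes the product by at most their
      sum, by Weierstrass' inequality.\<close>
    have diff: "0 \<le> ?PF \<omega> - ?PJ \<omega> \<and> ?PF \<omega> - ?PJ \<omega> \<le> (\<Sum>q\<in>A. Y q \<omega>)" for \<omega>
    proof -
      have eq: "?PJ \<omega> = (\<Prod>q\<in>A. 1 - Y q \<omega>) * ?PF \<omega>"
        unfolding AF(1) using AF by (intro prod.union_disjoint) auto
      have 1: "1 - (\<Sum>q\<in>A. Y q \<omega>) \<le> (\<Prod>q\<in>A. 1 - Y q \<omega>)"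
        using AF bnd by (intro Weierstrass_prod_ineq) auto
      note 2 = prod_bnd[OF AF(5), of \<omega>] and 3 = prod_bnd[OF AF(6), of \<omega>]
      have "?PF \<omega> - ?PJ \<omega> = (1 - (\<Prod>q\<in>A. 1 - Y q \<omega>)) * ?PF \<omega>" by (simp add: eq algebra_simps)
      moreover have "(1 - (\<Prod>q\<in>A. 1 - Y q \<omega>)) * ?PF \<omega> \<le> 1 - (\<Prod>q\<in>A. 1 - Y q \<omega>)"
        using 2 3 by (intro mult_left_le) auto
      moreover have "0 \<le> (1 - (\<Prod>q\<in>A. 1 - Y q \<omega>)) * ?PF \<omega>" using 2 3 by auto
      ultimately show ?thesis using 1 by linarith
    qed
    have err1: "\<bar>expectation (\<lambda>\<omega>. Y p \<omega> * ?PF \<omega>) - expectation (\<lambda>\<omega>. Y p \<omega> * ?PJ \<omega>)\<bar> \<le> (\<Sum>q\<in>A. ?e p * ?e q)"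
    proof -
      have "expectation (\<lambda>\<omega>. Y p \<omega> * ?PF \<omega>) - expectation (\<lambda>\<omega>. Y p \<omega> * ?PJ \<omega>) =
          expectation (\<lambda>\<omega>. Y p \<omega> * (?PF \<omega> - ?PJ \<omega>))"
        using intpF intpJ by (simp add: right_diff_distrib)
      moreover have "0 \<le> expectation (\<lambda>\<omega>. Y p \<omega> * (?PF \<omega> - ?PJ \<omega>))"
        using diff bnd[OF p] by (intro Bochner_Integration.integral_nonneg mult_nonneg_nonneg) auto
      moreover have "expectation (\<lambda>\<omega>. Y p \<omega> * (?PF \<omega> - ?PJ \<omega>)) \<le> expectation (\<lambda>\<omega>. \<Sum>q\<in>A. Y p \<omega> * Y q \<omega>)"
      proof (rule Bochner_Integration.integral_mono)
        show "integrable M (\<lambda>\<omega>. Y p \<omega> * (?PF \<omega> - ?PJ \<omega>))" using intpF intpJ by (simp add: right_diff_distrib)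
        show "integrable M (\<lambda>\<omega>. \<Sum>q\<in>A. Y p \<omega> * Y q \<omega>)" using intpq by auto
        show "Y p \<omega> * (?PF \<omega> - ?PJ \<omega>) \<le> (\<Sum>q\<in>A. Y p \<omega> * Y q \<omega>)" for \<omega>
          unfolding sum_distrib_left[symmetric] using diff bnd[OF p] by (intro mult_left_mono) auto
      qed
      moreover have "expectation (\<lambda>\<omega>. \<Sum>q\<in>A. Y p \<omega> * Y q \<omega>) = (\<Sum>q\<in>A. ?e p * ?e q)"
      proof -
        have "expectation (\<lambda>\<omega>. \<Sum>q\<in>A. Y p \<omega> * Y q \<omega>) = (\<Sum>q\<in>A. expectation (\<lambda>\<omega>. Y p \<omega> * Y q \<omega>))"
          using intpq by (rule Bochner_Integration.integral_sum)
        also have "\<dots> = (\<Sum>q\<in>A. ?e p * ?e q)"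
        proof (rule sum.cong[OF refl])
          fix q assume "q \<in> A"
          then have "q \<in> I" "q \<noteq> p" "R p q" using J insert.hyps by (auto simp: A_def)
          then show "expectation (\<lambda>\<omega>. Y p \<omega> * Y q \<omega>) = ?e p * ?e q" using pair[of p q] p by auto
        qed
        finally show ?thesis .
      qed
      ultimately show ?thesis by linarith
    qed
    have err2: "\<bar>?e p * expectation ?PF - ?e p * expectation ?PJ\<bar> \<le> (\<Sum>q\<in>A. ?e p * ?e q)"
    proof -
      have "expectation ?PF - expectation ?PJ = expectation (\<lambda>\<omega>. ?PF \<omega> - ?PJ \<omega>)"
        using intF intJ by simp
      moreover have "0 \<le> expectation (\<lambda>\<omega>. ?PF \<omega> - ?PJ \<omega>)"
        using diff by (intro Bochner_Integration.integral_nonneg) auto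
      moreover have "expectation (\<lambda>\<omega>. ?PF \<omega> - ?PJ \<omega>) \<le> expectation (\<lambda>\<omega>. \<Sum>q\<in>A. Y q \<omega>)"
        using diff intF intJ intq by (intro Bochner_Integration.integral_mono) auto
      moreover have "expectation (\<lambda>\<omega>. \<Sum>q\<in>A. Y q \<omega>) = (\<Sum>q\<in>A. ?e q)"
        using intq by (rule Bochner_Integration.integral_sum)
      ultimately have "\<bar>expectation ?PF - expectation ?PJ\<bar> \<le> (\<Sum>q\<in>A. ?e q)" by linarith
      then have "?e p * \<bar>expectation ?PF - expectation ?PJ\<bar> \<le> ?e p * (\<Sum>q\<in>A. ?e q)"
        using e_bnd[OF p] by (intro mult_left_mono) auto
      then show ?thesis using e_bnd[OF p]
        by (simp add: right_diff_distrib[symmetric] abs_mult sum_distrib_left)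
    qed
    have ind: "expectation (\<lambda>\<omega>. Y p \<omega> * ?PF \<omega>) = ?e p * expectation ?PF"
      using p AF(6) insert.hyps by (intro indep) (auto simp: F_def)
    have step: "expectation (\<lambda>\<omega>. \<Prod>q\<in>insert p J. 1 - Y q \<omega>) = expectation ?PJ - expectation (\<lambda>\<omega>. Y p \<omega> * ?PJ \<omega>)"
    proof -
      have "(\<lambda>\<omega>. \<Prod>q\<in>insert p J. 1 - Y q \<omega>) = (\<lambda>\<omega>. ?PJ \<omega> - Y p \<omega> * ?PJ \<omega>)"
        using insert.hyps by (simp add: algebra_simps)
      then show ?thesis using intJ intpJ by simp
    qed
    \<comment> \<open>The earlier error is multiplied by 1 minus a mean in [0, 1], so errors add up
      without growing.\<close>
    have old: "\<bar>(1 - ?e p) * (expectation ?PJ - (\<Prod>q\<in>J. 1 - ?e q))\<bar>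
        \<le> (\<Sum>r\<in>J. \<Sum>q\<in>{q \<in> J. q \<noteq> r \<and> R r q}. 2 * ?e r * ?e q)"
    proof -
      have "\<bar>(1 - ?e p) * (expectation ?PJ - (\<Prod>q\<in>J. 1 - ?e q))\<bar> \<le> \<bar>expectation ?PJ - (\<Prod>q\<in>J. 1 - ?e q)\<bar>"
        unfolding abs_mult using e_bnd[OF p] by (intro mult_left_le_one_le) auto
      then show ?thesis using insert.IH[OF J] by linarith
    qed
    have new: "(\<Sum>r\<in>J. \<Sum>q\<in>{q \<in> J. q \<noteq> r \<and> R r q}. 2 * ?e r * ?e q) + 2 * (\<Sum>q\<in>A. ?e p * ?e q)
        \<le> (\<Sum>r\<in>insert p J. \<Sum>q\<in>{q \<in> insert p J. q \<noteq> r \<and> R r q}. 2 * ?e r * ?e q)"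
    proof -
      have "{q \<in> insert p J. q \<noteq> p \<and> R p q} = A" using insert.hyps by (auto simp: A_def)
      moreover have "(\<Sum>r\<in>J. \<Sum>q\<in>{q \<in> J. q \<noteq> r \<and> R r q}. 2 * ?e r * ?e q)
          \<le> (\<Sum>r\<in>J. \<Sum>q\<in>{q \<in> insert p J. q \<noteq> r \<and> R r q}. 2 * ?e r * ?e q)"
        using insert.hyps insert.prems e_bnd
        by (intro sum_mono sum_mono2) (auto intro!: mult_nonneg_nonneg simp: subset_iff)
      ultimately show ?thesis
        using insert.hyps by (simp add: sum_distrib_left mult.assoc)
    qed
    have "expectation (\<lambda>\<omega>. \<Prod>q\<in>insert p J. 1 - Y q \<omega>) - (\<Prod>q\<in>insert p J. 1 - ?e q) =
       (1 - ?e p) * (expectation ?PJ - (\<Prod>q\<in>J. 1 - ?e q)) +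
       ((expectation (\<lambda>\<omega>. Y p \<omega> * ?PF \<omega>) - expectation (\<lambda>\<omega>. Y p \<omega> * ?PJ \<omega>))
        - (?e p * expectation ?PF - ?e p * expectation ?PJ))"
      unfolding step ind using insert.hyps by (simp add: algebra_simps)
    then show ?case using old new err1 err2 by linarith
  qed
  then show ?thesis using fin by auto
qed

text \<open>Dividing \<open>f z - f 0\<close> by \<open>z\<close> shifts the coefficients, and the value of the shifted series at
  \<open>0\<close> differs from that at \<open>z\<close> by at most \<open>z\<close>.\<close>

lemma power_series_coeff_tendsto:
  fixes a :: "nat \<Rightarrow> nat \<Rightarrow> real" and b :: "nat \<Rightarrow> real"
  assumes "\<And>n k. 0 \<le> a n k" "\<And>n. summable (a n)" "\<And>n. suminf (a n) \<le> 1"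
    and "\<And>k. 0 \<le> b k" "summable b" "suminf b \<le> 1"
    and "\<And>z. 0 \<le> z \<Longrightarrow> z \<le> 1 \<Longrightarrow> (\<lambda>n. \<Sum>k. a n k * z ^ k) \<longlonglongrightarrow> (\<Sum>k. b k * z ^ k)"
  shows "(\<lambda>n. a n k) \<longlonglongrightarrow> b k"
  using assms
proof (induction k arbitrary: a b)
  case 0
  from "0.prems"(7)[of 0] show ?case by simp
next
  case (Suc k)
  have shift: "summable (\<lambda>k. c (Suc k))" "suminf (\<lambda>k. c (Suc k)) \<le> 1"
    "\<And>z. 0 \<le> z \<Longrightarrow> z \<le> 1 \<Longrightarrow> summable (\<lambda>k. c k * z ^ k)"
    "\<And>z. 0 \<le> z \<Longrightarrow> z \<le> 1 \<Longrightarrow> summable (\<lambda>k. c (Suc k) * z ^ k)"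
    "\<And>z. 0 \<le> z \<Longrightarrow> z \<le> 1 \<Longrightarrow> 0 < z \<Longrightarrow> (\<Sum>k. c (Suc k) * z ^ k) = ((\<Sum>k. c k * z ^ k) - c 0) / z"
    "\<And>z. 0 \<le> z \<Longrightarrow> z \<le> 1 \<Longrightarrow> \<bar>(\<Sum>k. c (Suc k) * z ^ k) - c 1\<bar> \<le> z"
    if c: "\<And>k. 0 \<le> c k" "summable c" "suminf c \<le> 1" for c :: "nat \<Rightarrow> real"
  proof -
    show s: "summable (\<lambda>k. c (Suc k))" using c(2) by (simp add: summable_Suc_iff)
    have s_pow: "summable (\<lambda>k. d k * z ^ k)"
      if "\<And>k. 0 \<le> d k" "summable d" "0 \<le> z" "z \<le> 1" for d :: "nat \<Rightarrow> real" and z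
      using that by (intro summable_comparison_test'[OF that(2), of 0]) (auto simp: power_le_one mult_left_le)
    show "suminf (\<lambda>k. c (Suc k)) \<le> 1"
      using suminf_split_head[OF c(2)] c(1)[of 0] c(3) by simp
    fix z :: real assume z: "0 \<le> z" "z \<le> 1"
    show sz: "summable (\<lambda>k. c k * z ^ k)" and sz': "summable (\<lambda>k. c (Suc k) * z ^ k)"
      using s_pow[OF c(1,2) z] s_pow[OF c(1) s z] by auto
    have s2: "summable (\<lambda>k. c (Suc (Suc k)))"
      using s summable_Suc_iff[of "\<lambda>k. c (Suc k)"] by simp
    have sz'': "summable (\<lambda>k. c (Suc (Suc k)) * z ^ k)"
      by (rule s_pow[OF c(1) s2 z])
    have "(\<Sum>k. c (Suc k) * z ^ k) - c 1 = (\<Sum>k. c (Suc (Suc k)) * z ^ Suc k)"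
      using suminf_split_head[OF sz'] by simp
    also have "\<dots> = z * (\<Sum>k. c (Suc (Suc k)) * z ^ k)"
      by (subst suminf_mult[OF sz'', symmetric]) (simp add: ac_simps)
    finally have eq: "(\<Sum>k. c (Suc k) * z ^ k) - c 1 = z * (\<Sum>k. c (Suc (Suc k)) * z ^ k)" .
    have "(\<Sum>k. c (Suc (Suc k)) * z ^ k) \<le> (\<Sum>k. c (Suc (Suc k)))"
      using sz'' s2 c z by (intro suminf_le) (auto simp: power_le_one mult_left_le)
    also have "\<dots> \<le> 1"
      using suminf_split_head[OF s] suminf_split_head[OF c(2)] c(1)[of 0] c(1)[of "Suc 0"] c(3) by simp
    finally have "(\<Sum>k. c (Suc (Suc k)) * z ^ k) \<le> 1" .
    moreover have "0 \<le> (\<Sum>k. c (Suc (Suc k)) * z ^ k)"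
      using sz'' c z by (intro suminf_nonneg) auto
    ultimately show "\<bar>(\<Sum>k. c (Suc k) * z ^ k) - c 1\<bar> \<le> z"
      unfolding eq using z by (simp add: abs_mult mult_left_le)
    assume "0 < z"
    have "(\<Sum>k. c k * z ^ k) - c 0 = (\<Sum>k. c (Suc k) * z ^ Suc k)"
      using suminf_split_head[OF sz] by simp
    also have "\<dots> = z * (\<Sum>k. c (Suc k) * z ^ k)"
      by (subst suminf_mult[OF sz', symmetric]) (simp add: ac_simps)
    finally show "(\<Sum>k. c (Suc k) * z ^ k) = ((\<Sum>k. c k * z ^ k) - c 0) / z"
      using \<open>0 < z\<close> by (simp add: field_simps)
  qed
  note A = shift[OF Suc.prems(1-3)] and B = shift[OF Suc.prems(4-6)]
  have zero: "(\<lambda>n. a n 0) \<longlonglongrightarrow> b 0"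
    using Suc.prems(7)[of 0] by simp
  have pos: "(\<lambda>n. \<Sum>k. a n (Suc k) * z ^ k) \<longlonglongrightarrow> (\<Sum>k. b (Suc k) * z ^ k)" if "0 < z" "z \<le> 1" for z
    unfolding A(5)[OF less_imp_le[OF that(1)] that(2,1)] B(5)[OF less_imp_le[OF that(1)] that(2,1)]
    using that by (intro tendsto_intros zero Suc.prems(7)) auto
  have one: "(\<lambda>n. a n 1) \<longlonglongrightarrow> b 1"
  proof (rule LIMSEQ_I)
    fix e :: real assume e: "0 < e"
    \<comment> \<open>The values at z differ from the coefficients by at most z on each side, and
      from each other by less than e/4: in total less than 3e/4.\<close>
    define z where "z = min 1 (e / 4)"
    have z: "0 < z" "z \<le> 1" "z \<le> e / 4" using e by (auto simp: z_def)
    obtain N where N: "\<And>n. n \<ge> N \<Longrightarrow> \<bar>(\<Sum>k. a n (Suc k) * z ^ k) - (\<Sum>k. b (Suc k) * z ^ k)\<bar> < e / 4"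
      using LIMSEQ_D[OF pos[OF z(1,2)], of "e / 4"] e by auto
    show "\<exists>N. \<forall>n\<ge>N. norm (a n 1 - b 1) < e"
    proof (intro exI[of _ N] allI impI)
      fix n assume "N \<le> n"
      then show "norm (a n 1 - b 1) < e"
        using N[of n] A(6)[OF less_imp_le[OF z(1)] z(2), of n] B(6)[OF less_imp_le[OF z(1)] z(2)] z e
        unfolding real_norm_def One_nat_def by linarith
    qed
  qed
  show ?case
  proof (rule Suc.IH[of "\<lambda>n k. a n (Suc k)" "\<lambda>k. b (Suc k)"])
    fix z :: real assume z: "0 \<le> z" "z \<le> 1"
    show "(\<lambda>n. \<Sum>k. a n (Suc k) * z ^ k) \<longlonglongrightarrow> (\<Sum>k. b (Suc k) * z ^ k)"
    proof (cases "z = 0")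
      case True
      then show ?thesis using one by simp
    next
      case False
      then show ?thesis using pos[of z] z by auto
    qed
  qed (use A B Suc.prems in auto)
qed

section \<open>Poisson limits from generating functions\<close>

lemma pmf_poisson_law:
  assumes "0 \<le> l"
  shows "pmf (poisson_law l) k = l ^ k / fact k * exp (- l)"
proof (cases "l = 0")
  case True
  then show ?thesis by (cases k) (auto simp: poisson_law_def)
next
  case False
  then show ?thesis using assms by (simp add: poisson_law_def)
qed

lemma poisson_law_pgf:
  assumes "0 \<le> l"
  shows "(\<lambda>k. pmf (poisson_law l) k * z ^ k) sums exp (- ((1 - z) * l))"
proof -
  have "(\<lambda>k. exp (- l) * ((l * z) ^ k /\<^sub>R fact k)) sums (exp (- l) * exp (l * z))"
    by (intro sums_mult exp_converges)
  moreover have "exp (- l) * exp (l * z) = exp (- ((1 - z) * l))"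
    by (simp add: exp_add[symmetric] algebra_simps)
  ultimately show ?thesis
    using assms by (simp add: pmf_poisson_law power_mult_distrib field_simps)
qed

text \<open>The expansion in one variable only: the bounded weight \<open>W\<close> carries the
  factors that belong to all other coordinates.\<close>

lemma (in prob_space) expectation_power_sums:
  fixes W :: "'a \<Rightarrow> real" and X :: "'a \<Rightarrow> nat"
  assumes [measurable]: "W \<in> borel_measurable M" "X \<in> M \<rightarrow>\<^sub>M count_space UNIV"
    and W: "\<And>\<omega>. 0 \<le> W \<omega> \<and> W \<omega> \<le> 1" and z: "0 \<le> z" "z \<le> 1"
  shows "(\<lambda>k. expectation (\<lambda>\<omega>. W \<omega> * of_bool (X \<omega> = k)) * z ^ k) sums expectation (\<lambda>\<omega>. W \<omega> * z ^ X \<omega>)"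
proof -
  let ?f = "\<lambda>k \<omega>. W \<omega> * of_bool (X \<omega> = k) * z ^ k"
  have bint: "integrable M f"
    if "f \<in> borel_measurable M" "\<And>\<omega>. 0 \<le> f \<omega> \<and> f \<omega> \<le> 1" for f :: "'a \<Rightarrow> real"
    using that by (intro integrable_const_bound[of _ 1]) (auto simp: abs_le_iff)
  have bnd: "0 \<le> ?f k \<omega> \<and> ?f k \<omega> \<le> 1" for k \<omega>
    using W[of \<omega>] z by (auto intro!: mult_le_one power_le_one)
  have int: "integrable M (?f k)" for k by (rule bint[OF _ bnd]) measurable
  \<comment> \<open>The partial sums are truncations of the bounded variable, which yields pointwise
    convergence as well as the bound 1 on the summed means.\<close>
  have part: "(\<Sum>k<N. ?f k \<omega>) = (if X \<omega> < N then W \<omega> * z ^ X \<omega> else 0)" for N \<omega>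
  proof -
    have "(\<Sum>k<N. ?f k \<omega>) = (\<Sum>k<N. if X \<omega> = k then W \<omega> * z ^ k else 0)"
      by (intro sum.cong) auto
    then show ?thesis by simp
  qed
  have sums: "(\<lambda>k. ?f k \<omega>) sums (W \<omega> * z ^ X \<omega>)" for \<omega>
    unfolding sums_def part by (rule tendsto_eventually) (auto simp: eventually_at_top_dense)
  have "(\<lambda>k. integral\<^sup>L M (?f k)) sums (\<integral>\<omega>. (\<Sum>k. ?f k \<omega>) \<partial>M)"
  proof (rule sums_integral[OF int])
    show "AE \<omega> in M. summable (\<lambda>k. norm (?f k \<omega>))"
    proof (rule AE_I2)
      fix \<omega>
      have "(\<lambda>k. norm (?f k \<omega>)) = (\<lambda>k. ?f k \<omega>)" using bnd by (simp add: abs_of_nonneg)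
      then show "summable (\<lambda>k. norm (?f k \<omega>))" using sums_summable[OF sums[of \<omega>]] by simp
    qed
    have eq: "(\<integral>\<omega>. norm (?f k \<omega>) \<partial>M) = integral\<^sup>L M (?f k)" for k using bnd by (simp add: abs_of_nonneg)
    show "summable (\<lambda>k. \<integral>\<omega>. norm (?f k \<omega>) \<partial>M)"
      unfolding eq
    proof (rule summableI_nonneg_bounded[of _ 1])
      show "0 \<le> integral\<^sup>L M (?f k)" for k using bnd by (intro Bochner_Integration.integral_nonneg) auto
      fix N
      have "(\<Sum>k<N. integral\<^sup>L M (?f k)) = (\<integral>\<omega>. (\<Sum>k<N. ?f k \<omega>) \<partial>M)"
        by (rule Bochner_Integration.integral_sum[symmetric]) (rule int)
      also have "\<dots> \<le> (\<integral>\<omega>. 1 \<partial>M)"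
        using int W z unfolding part[symmetric]
        by (intro Bochner_Integration.integral_mono Bochner_Integration.integrable_sum)
          (auto simp only: part split: if_splits intro!: mult_le_one power_le_one, auto)
      finally show "(\<Sum>k<N. integral\<^sup>L M (?f k)) \<le> 1" by (simp add: prob_space)
    qed
  qed
  then show ?thesis
    unfolding sums_unique[OF sums, symmetric] by simp
qed

text \<open>The joint generating function is turned into joint probabilities coordinate by
  coordinate, each time by extracting a coefficient in a single variable.\<close>

lemma poisson_joint_limit:
  fixes M :: "nat \<Rightarrow> 'a measure" and X :: "nat \<Rightarrow> nat \<Rightarrow> 'a \<Rightarrow> nat"
  assumes M: "\<And>n. prob_space (M n)"
    and X [measurable]: "\<And>n r. r < m \<Longrightarrow> X n r \<in> M n \<rightarrow>\<^sub>M count_space UNIV"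
    and l: "\<And>r. r < m \<Longrightarrow> 0 \<le> l r"
    and pgf: "\<And>z. (\<And>r. 0 \<le> z r \<and> z r \<le> 1) \<Longrightarrow>
      (\<lambda>n. \<integral>\<omega>. (\<Prod>r<m. z r ^ X n r \<omega>) \<partial>M n) \<longlonglongrightarrow> exp (- (\<Sum>r<m. (1 - z r) * l r))"
  shows "(\<lambda>n. measure (M n) {\<omega> \<in> space (M n). \<forall>r<m. X n r \<omega> = k r}) \<longlonglongrightarrow>
    (\<Prod>r<m. pmf (poisson_law (l r)) (k r))"
proof -
  \<comment> \<open>An interpolation: the first j coordinates are already pinned to the values k,
    the others still appear through their powers. The claim is for all z, because the next
    extraction needs every value of the j-th variable.\<close>
  have step: "j \<le> m \<Longrightarrow> (\<And>r. 0 \<le> z r \<and> z r \<le> 1) \<Longrightarrow>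
     (\<lambda>n. \<integral>\<omega>. (\<Prod>r<m. if r < j then of_bool (X n r \<omega> = k r) else z r ^ X n r \<omega>) \<partial>M n) \<longlonglongrightarrow>
      (\<Prod>r<m. if r < j then pmf (poisson_law (l r)) (k r) else exp (- ((1 - z r) * l r)))" for j and z :: "nat \<Rightarrow> real"
  proof (induction j arbitrary: z)
    case 0
    then show ?case using pgf[of z] by (simp add: exp_sum[symmetric] sum_negf)
  next
    case (Suc j)
    then have j: "j < m" by simp
    define W where "W n \<omega> = (\<Prod>r\<in>{..<m} - {j}. if r < j then of_bool (X n r \<omega> = k r) else z r ^ X n r \<omega>)" for n \<omega>
    define c where "c = (\<Prod>r\<in>{..<m} - {j}. if r < j then pmf (poisson_law (l r)) (k r) else exp (- ((1 - z r) * l r)))"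
    have W: "0 \<le> W n \<omega> \<and> W n \<omega> \<le> 1" for n \<omega>
      using Suc.prems(2) unfolding W_def by (intro conjI prod_nonneg prod_le_1) (simp_all add: power_le_one)
    have c: "0 \<le> c" "c \<le> 1"
      using Suc.prems(2) l unfolding c_def by (intro prod_nonneg prod_le_1; simp add: pmf_le_1)+
    have Wm [measurable]: "W n \<in> borel_measurable (M n)" for n
      unfolding W_def by (intro borel_measurable_prod) auto
    have "(\<lambda>n. \<integral>\<omega>. W n \<omega> * of_bool (X n j \<omega> = i) \<partial>M n) \<longlonglongrightarrow> c * pmf (poisson_law (l j)) i" for i
    proof (rule power_series_coeff_tendsto)
      note psums = prob_space.expectation_power_sums[OF M Wm X[OF j] W]
      show "0 \<le> (\<integral>\<omega>. W n \<omega> * of_bool (X n j \<omega> = i) \<partial>M n)" for n i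
        using W by (intro Bochner_Integration.integral_nonneg) auto
      show "summable (\<lambda>i. \<integral>\<omega>. W n \<omega> * of_bool (X n j \<omega> = i) \<partial>M n)" for n
        using sums_summable[OF psums[of 1 n]] by simp
      show "(\<Sum>i. \<integral>\<omega>. W n \<omega> * of_bool (X n j \<omega> = i) \<partial>M n) \<le> 1" for n
      proof -
        interpret prob_space "M n" by (rule M)
        have "(\<Sum>i. \<integral>\<omega>. W n \<omega> * of_bool (X n j \<omega> = i) \<partial>M n) = expectation (W n)"
          using sums_unique[OF psums[of 1 n]] by simp
        also have "\<dots> \<le> expectation (\<lambda>_. 1)"
          using W by (intro Bochner_Integration.integral_mono integrable_const_bound[of _ 1]) (auto simp: abs_le_iff)
        finally show ?thesis by (simp add: prob_space)
      qed
      have lj: "0 \<le> l j" using l j by simp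
      show "0 \<le> c * pmf (poisson_law (l j)) i" for i using c by simp
      have "(\<lambda>i. c * pmf (poisson_law (l j)) i) sums c"
        using sums_mult[OF poisson_law_pgf[OF lj, of 1], of c] by simp
      then show "summable (\<lambda>i. c * pmf (poisson_law (l j)) i)" "(\<Sum>i. c * pmf (poisson_law (l j)) i) \<le> 1"
        using c by (auto simp: sums_iff)
      fix y :: real assume y: "0 \<le> y" "y \<le> 1"
      have lhs: "(\<Sum>i. (\<integral>\<omega>. W n \<omega> * of_bool (X n j \<omega> = i) \<partial>M n) * y ^ i) =
          (\<integral>\<omega>. (\<Prod>r<m. if r < j then of_bool (X n r \<omega> = k r) else (z(j := y)) r ^ X n r \<omega>) \<partial>M n)" for n
      proof -
        have "(\<Prod>r<m. if r < j then of_bool (X n r \<omega> = k r) else (z(j := y)) r ^ X n r \<omega>) = W n \<omega> * y ^ X n j \<omega>" for \<omega>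
        proof -
          have "W n \<omega> = (\<Prod>r\<in>{..<m} - {j}. if r < j then of_bool (X n r \<omega> = k r) else (z(j := y)) r ^ X n r \<omega>)"
            unfolding W_def by (rule prod.cong) auto
          then show ?thesis using j by (subst prod.remove[of _ j]) (simp_all add: mult.commute)
        qed
        then show ?thesis using sums_unique[OF psums[OF y, of n]] by simp
      qed
      have rhs: "(\<Sum>i. c * pmf (poisson_law (l j)) i * y ^ i) =
          (\<Prod>r<m. if r < j then pmf (poisson_law (l r)) (k r) else exp (- ((1 - (z(j := y)) r) * l r)))"
      proof -
        have "(\<Sum>i. c * pmf (poisson_law (l j)) i * y ^ i) = c * exp (- ((1 - y) * l j))"
          using sums_mult[OF poisson_law_pgf[OF lj, of y], of c] by (simp add: sums_iff mult.assoc)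
        also have "\<dots> = (\<Prod>r<m. if r < j then pmf (poisson_law (l r)) (k r) else exp (- ((1 - (z(j := y)) r) * l r)))"
        proof -
          have "c = (\<Prod>r\<in>{..<m} - {j}. if r < j then pmf (poisson_law (l r)) (k r) else exp (- ((1 - (z(j := y)) r) * l r)))"
            unfolding c_def by (rule prod.cong) auto
          then show ?thesis using j by (subst prod.remove[of _ j]) (simp_all add: mult.commute)
        qed
        finally show ?thesis .
      qed
      show "(\<lambda>n. \<Sum>i. (\<integral>\<omega>. W n \<omega> * of_bool (X n j \<omega> = i) \<partial>M n) * y ^ i) \<longlonglongrightarrow>
          (\<Sum>i. c * pmf (poisson_law (l j)) i * y ^ i)"
        unfolding lhs rhs using Suc.prems y by (intro Suc.IH) auto
    qed
    from this[of "k j"] have "(\<lambda>n. \<integral>\<omega>. W n \<omega> * of_bool (X n j \<omega> = k j) \<partial>M n) \<longlonglongrightarrow> c * pmf (poisson_law (l j)) (k j)" .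
    moreover have "(\<Prod>r<m. if r < Suc j then of_bool (X n r \<omega> = k r) else z r ^ X n r \<omega>) =
        W n \<omega> * of_bool (X n j \<omega> = k j)" for n \<omega>
    proof -
      have "W n \<omega> = (\<Prod>r\<in>{..<m} - {j}. if r < Suc j then of_bool (X n r \<omega> = k r) else z r ^ X n r \<omega>)"
        unfolding W_def by (rule prod.cong) auto
      then show ?thesis using j by (subst prod.remove[of _ j]) (simp_all add: mult.commute)
    qed
    moreover have "(\<Prod>r<m. if r < Suc j then pmf (poisson_law (l r)) (k r) else exp (- ((1 - z r) * l r))) =
        c * pmf (poisson_law (l j)) (k j)"
    proof -
      have "c = (\<Prod>r\<in>{..<m} - {j}. if r < Suc j then pmf (poisson_law (l r)) (k r) else exp (- ((1 - z r) * l r)))"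
        unfolding c_def by (rule prod.cong) auto
      then show ?thesis using j by (subst prod.remove[of _ j]) (simp_all add: mult.commute)
    qed
    ultimately show ?case by simp
  qed
  have "(\<Prod>r<m. if r < m then of_bool (X n r \<omega> = k r) else 1 ^ X n r \<omega>) =
      (of_bool (\<forall>r<m. X n r \<omega> = k r) :: real)" for n \<omega>
    by (auto simp: of_bool_def prod_zero_iff intro!: prod.neutral)
  moreover have "(\<integral>\<omega>. of_bool (\<forall>r<m. X n r \<omega> = k r) \<partial>M n) = measure (M n) {\<omega> \<in> space (M n). \<forall>r<m. X n r \<omega> = k r}" for n
  proof -
    have S: "{\<omega> \<in> space (M n). \<forall>r<m. X n r \<omega> = k r} \<in> sets (M n)"
    proof -
      have "{\<omega> \<in> space (M n). \<forall>r\<in>{..<m}. X n r \<omega> = k r} \<in> sets (M n)"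
      proof (rule sets.sets_Collect_finite_All)
        fix r assume "r \<in> {..<m}"
        then have [measurable]: "X n r \<in> M n \<rightarrow>\<^sub>M count_space UNIV" by simp
        show "{\<omega> \<in> space (M n). X n r \<omega> = k r} \<in> sets (M n)" by measurable
      qed simp
      then show ?thesis by (simp add: Ball_def)
    qed
    have "(\<integral>\<omega>. of_bool (\<forall>r<m. X n r \<omega> = k r) \<partial>M n) = (\<integral>\<omega>. indicat_real {\<omega> \<in> space (M n). \<forall>r<m. X n r \<omega> = k r} \<omega> \<partial>M n)"
      by (intro Bochner_Integration.integral_cong) (auto simp: indicator_def)
    also have "\<dots> = measure (M n) {\<omega> \<in> space (M n). \<forall>r<m. X n r \<omega> = k r}"
      using S by simp
    finally show ?thesis .
  qed
  moreover have "(\<Prod>r<m. if r < m then pmf (poisson_law (l r)) (k r) else exp (- ((1 - 1) * l r))) =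
      (\<Prod>r<m. pmf (poisson_law (l r)) (k r))" by (intro prod.cong) auto
  ultimately show ?thesis using step[of m "\<lambda>_. 1"] by simp
qed

lemma (in prob_space) countable_tight:
  fixes Y :: "'a \<Rightarrow> 'd :: countable"
  assumes [measurable]: "Y \<in> M \<rightarrow>\<^sub>M count_space UNIV" and e: "0 < e"
  obtains D where "finite D" "1 - e < (\<Sum>d\<in>D. prob {\<omega> \<in> space M. Y \<omega> = d})"
proof -
  let ?A = "\<lambda>N. {\<omega> \<in> space M. to_nat (Y \<omega>) < N}"
  have "(\<lambda>N. prob (?A N)) \<longlonglongrightarrow> prob (\<Union>N. ?A N)"
    by (rule finite_Lim_measure_incseq) (auto simp: incseq_def)
  moreover have "(\<Union>N. ?A N) = space M" by auto
  ultimately have "(\<lambda>N. prob (?A N)) \<longlonglongrightarrow> 1" by (simp add: prob_space)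
  from order_tendstoD(1)[OF this, of "1 - e"] e obtain N where N: "1 - e < prob (?A N)"
    by (auto simp: eventually_sequentially)
  define D where "D = {d :: 'd. to_nat d < N}"
  have fin: "finite D"
    by (rule finite_imageD[of to_nat])
      (auto simp: D_def inj_on_def image_def intro: finite_subset[of _ "{..<N}"])
  have "prob (?A N) = prob (\<Union>d\<in>D. {\<omega> \<in> space M. Y \<omega> = d})"
    by (intro arg_cong[of _ _ prob]) (auto simp: D_def)
  also have "\<dots> = (\<Sum>d\<in>D. prob {\<omega> \<in> space M. Y \<omega> = d})"
    using fin by (intro finite_measure_finite_Union) (auto simp: disjoint_family_on_def)
  finally show thesis using N fin by (intro that[of D]) auto
qed

text \<open>Convergence of point masses suffices on a countable space: the limit is a probability,
  so a finite set carrying almost all of it eventually carries almost all of the approximating laws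
  too, and no mass escapes.\<close>

lemma discrete_expectation_tendsto:
  fixes X :: "nat \<Rightarrow> 'a \<Rightarrow> 'd :: countable" and Y :: "'p \<Rightarrow> 'd" and G :: "'d \<Rightarrow> real"
  assumes M: "\<And>n. prob_space (M n)" and P: "prob_space P"
    and X [measurable]: "\<And>n. X n \<in> M n \<rightarrow>\<^sub>M count_space UNIV" and Y [measurable]: "Y \<in> P \<rightarrow>\<^sub>M count_space UNIV"
    and lim: "\<And>d. (\<lambda>n. measure (M n) {\<omega> \<in> space (M n). X n \<omega> = d}) \<longlonglongrightarrow> measure P {\<omega> \<in> space P. Y \<omega> = d}"
    and G: "\<And>d. \<bar>G d\<bar> \<le> B"
  shows "(\<lambda>n. \<integral>\<omega>. G (X n \<omega>) \<partial>M n) \<longlonglongrightarrow> (\<integral>\<omega>. G (Y \<omega>) \<partial>P)"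
proof -
  have B: "0 \<le> B" using G abs_ge_zero order_trans by blast
  have trunc: "\<bar>(\<integral>\<omega>. G (Z \<omega>) \<partial>N) - (\<Sum>d\<in>D. G d * measure N {\<omega> \<in> space N. Z \<omega> = d})\<bar>
      \<le> B * (1 - (\<Sum>d\<in>D. measure N {\<omega> \<in> space N. Z \<omega> = d}))"
    if "prob_space N" and [measurable]: "Z \<in> N \<rightarrow>\<^sub>M count_space UNIV" and D: "finite D"
    for N :: "'z measure" and Z :: "'z \<Rightarrow> 'd" and D
  proof -
    interpret prob_space N by fact
    have *: "(\<Sum>d\<in>D. h d * measure N {\<omega> \<in> space N. Z \<omega> = d}) = (\<integral>\<omega>. indicator D (Z \<omega>) * h (Z \<omega>) \<partial>N)"
      "integrable N (\<lambda>\<omega>. indicator D (Z \<omega>) * h (Z \<omega>))" for h :: "'d \<Rightarrow> real"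
    proof -
      have eq: "indicator D (Z \<omega>) * h (Z \<omega>) = (\<Sum>d\<in>D. h d * indicator {\<omega> \<in> space N. Z \<omega> = d} \<omega>)"
        if "\<omega> \<in> space N" for \<omega>
      proof -
        have "(\<Sum>d\<in>D. h d * indicator {\<omega> \<in> space N. Z \<omega> = d} \<omega>) = (\<Sum>d\<in>D. if Z \<omega> = d then h d else 0)"
          using that by (intro sum.cong) (auto simp: indicator_def)
        then show ?thesis using D by (simp add: indicator_def)
      qed
      have i: "integrable N (\<lambda>\<omega>. h d * indicat_real {\<omega> \<in> space N. Z \<omega> = d} \<omega>)" for d
        by (intro integrable_mult_right integrable_real_indicator) (auto simp: emeasure_eq_measure)
      have "(\<integral>\<omega>. indicator D (Z \<omega>) * h (Z \<omega>) \<partial>N) = (\<integral>\<omega>. (\<Sum>d\<in>D. h d * indicator {\<omega> \<in> space N. Z \<omega> = d} \<omega>) \<partial>N)"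
        by (rule Bochner_Integration.integral_cong) (use eq in auto)
      also have "\<dots> = (\<Sum>d\<in>D. \<integral>\<omega>. h d * indicator {\<omega> \<in> space N. Z \<omega> = d} \<omega> \<partial>N)"
        by (rule Bochner_Integration.integral_sum) (rule i)
      finally show "(\<Sum>d\<in>D. h d * measure N {\<omega> \<in> space N. Z \<omega> = d}) = (\<integral>\<omega>. indicator D (Z \<omega>) * h (Z \<omega>) \<partial>N)"
        by simp
      show "integrable N (\<lambda>\<omega>. indicator D (Z \<omega>) * h (Z \<omega>))"
        by (subst Bochner_Integration.integrable_cong[OF refl eq]) (auto intro: i)
    qed
    have GZ: "integrable N (\<lambda>\<omega>. G (Z \<omega>))"
      by (rule integrable_const_bound[of _ B]) (use G in auto)
    have "(\<integral>\<omega>. G (Z \<omega>) \<partial>N) - (\<Sum>d\<in>D. G d * measure N {\<omega> \<in> space N. Z \<omega> = d}) =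
        (\<integral>\<omega>. G (Z \<omega>) - indicator D (Z \<omega>) * G (Z \<omega>) \<partial>N)"
      unfolding *(1) by (rule Bochner_Integration.integral_diff[symmetric]) (rule GZ *)+
    also have "\<bar>\<dots>\<bar> \<le> (\<integral>\<omega>. \<bar>G (Z \<omega>) - indicator D (Z \<omega>) * G (Z \<omega>)\<bar> \<partial>N)" by (rule integral_abs_bound)
    also have "\<dots> \<le> (\<integral>\<omega>. B * (1 - indicator D (Z \<omega>) * 1) \<partial>N)"
      using GZ *(2)[of G] *(2)[of "\<lambda>_. 1"] G
      by (intro Bochner_Integration.integral_mono integrable_abs Bochner_Integration.integrable_diff integrable_mult_right)
        (auto simp: indicator_def)
    also have "\<dots> = B * (1 - (\<Sum>d\<in>D. measure N {\<omega> \<in> space N. Z \<omega> = d}))"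
      using *(1)[of "\<lambda>_. 1"] *(2)[of "\<lambda>_. 1"]
      by (subst integral_mult_right_zero, subst Bochner_Integration.integral_diff) (auto simp: prob_space)
    finally show ?thesis .
  qed
  show ?thesis
  proof (rule LIMSEQ_I)
    fix e :: real assume e: "0 < e"
    \<comment> \<open>Two truncation errors of at most B times this constant, each at most e/4, plus
      e/4 on the finite set. The +1 guards against B = 0.\<close>
    define \<delta> where "\<delta> = e / (4 * (B + 1))"
    have \<delta>: "0 < \<delta>" "B * \<delta> \<le> e / 4" using e B by (auto simp: \<delta>_def field_simps)
    obtain D where D: "finite D" "1 - \<delta> < (\<Sum>d\<in>D. measure P {\<omega> \<in> space P. Y \<omega> = d})"
      by (rule prob_space.countable_tight[OF P Y \<delta>(1)])
    let ?p = "\<lambda>n d. measure (M n) {\<omega> \<in> space (M n). X n \<omega> = d}" and ?q = "\<lambda>d. measure P {\<omega> \<in> space P. Y \<omega> = d}"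
    have "(\<lambda>n. \<Sum>d\<in>D. ?p n d) \<longlonglongrightarrow> (\<Sum>d\<in>D. ?q d)" by (intro tendsto_sum lim)
    from order_tendstoD(1)[OF this D(2)] have ev1: "eventually (\<lambda>n. 1 - \<delta> < (\<Sum>d\<in>D. ?p n d)) sequentially" .
    have "(\<lambda>n. \<Sum>d\<in>D. G d * ?p n d) \<longlonglongrightarrow> (\<Sum>d\<in>D. G d * ?q d)" by (intro tendsto_intros lim)
    from tendstoD[OF this, of "e / 4"] e
    have ev2: "eventually (\<lambda>n. \<bar>(\<Sum>d\<in>D. G d * ?p n d) - (\<Sum>d\<in>D. G d * ?q d)\<bar> < e / 4) sequentially"
      by (simp add: dist_real_def)
    from eventually_conj[OF ev1 ev2] obtain n0 where n0: "\<And>n. n \<ge> n0 \<Longrightarrow> 1 - \<delta> < (\<Sum>d\<in>D. ?p n d) \<and>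
        \<bar>(\<Sum>d\<in>D. G d * ?p n d) - (\<Sum>d\<in>D. G d * ?q d)\<bar> < e / 4"
      by (auto simp: eventually_sequentially)
    show "\<exists>n0. \<forall>n\<ge>n0. norm ((\<integral>\<omega>. G (X n \<omega>) \<partial>M n) - (\<integral>\<omega>. G (Y \<omega>) \<partial>P)) < e"
    proof (intro exI[of _ n0] allI impI)
      fix n assume "n0 \<le> n"
      note n = n0[OF this]
      have "B * (1 - (\<Sum>d\<in>D. ?p n d)) \<le> B * \<delta>" "B * (1 - (\<Sum>d\<in>D. ?q d)) \<le> B * \<delta>"
        using n D B by (auto intro!: mult_left_mono)
      then show "norm ((\<integral>\<omega>. G (X n \<omega>) \<partial>M n) - (\<integral>\<omega>. G (Y \<omega>) \<partial>P)) < e"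
        using trunc[OF M X D(1), of n] trunc[OF P Y D(1)] n \<delta> e by (simp only: real_norm_def) linarith
    qed
  qed
qed

section \<open>Convergence of the exceedance counts\<close>

lemma real_card_upper_pairs: "real (card (upper_pairs n)) = real n * (real n - 1) / 2"
proof (induction n)
  case 0
  then show ?case by (simp add: upper_pairs_def)
next
  case (Suc n)
  have "upper_pairs (Suc n) = upper_pairs n \<union> (\<lambda>i. (i, n)) ` {..<n}"
    by (auto simp: upper_pairs_def less_Suc_eq)
  moreover have "upper_pairs n \<inter> (\<lambda>i. (i, n)) ` {..<n} = {}" by (auto simp: upper_pairs_def)
  moreover have "card ((\<lambda>i. (i, n)) ` {..<n}) = n" by (subst card_image) (auto simp: inj_on_def)
  ultimately have "card (upper_pairs (Suc n)) = card (upper_pairs n) + n"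
    by (simp add: card_Un_disjoint finite_upper_pairs)
  then show ?case using Suc by (simp add: field_simps)
qed

context
  fixes M :: "'a measure" and n :: nat and C :: "'a \<Rightarrow> real mat"
  assumes U: "uniform_correlation_matrix M n C"
begin

interpretation prob_space M by (rule uniform_corr_prob_space[OF U])

lemma entry_borel [measurable]:
  assumes "p \<in> upper_pairs n"
  shows "(\<lambda>\<omega>. C \<omega> $$ p) \<in> borel_measurable M"
proof -
  have "(\<lambda>\<omega>. upper_entries n (C \<omega>) p) \<in> borel_measurable M"
    by (rule measurable_compose[OF offdiag_borel[OF U] measurable_product_coordinates])
  then show ?thesis using assms by (simp add: upper_entries_def)
qed

lemma exceedance_point_borel [measurable]:
  assumes [simp]: "p \<in> upper_pairs n"
  shows "(\<lambda>\<omega>. exceedance_point n (C \<omega>) p) \<in> borel_measurable M"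
  unfolding exceedance_point_def by measurable

lemma exceedance_count_measurable [measurable]:
  assumes [measurable]: "B \<in> sets borel"
  shows "(\<lambda>\<omega>. exceedance_count n (C \<omega>) B) \<in> M \<rightarrow>\<^sub>M count_space UNIV"
proof -
  have "exceedance_count n (C \<omega>) B = (\<Sum>p\<in>upper_pairs n. if exceedance_point n (C \<omega>) p \<in> B then 1 else 0)" for \<omega>
    using finite_upper_pairs[of n] by (simp add: exceedance_count_def sum.If_cases Int_def)
  moreover have "(\<lambda>\<omega>. \<Sum>p\<in>upper_pairs n. if exceedance_point n (C \<omega>) p \<in> B then 1 else (0::nat)) \<in> M \<rightarrow>\<^sub>M count_space UNIV"
    by (rule measurable_sum_nat) measurable
  ultimately show ?thesis by simp
qed

lemma expectation_entry:
  assumes p: "p \<in> upper_pairs n" and f [measurable]: "f \<in> borel_measurable borel"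
    and f01: "\<And>a. 0 \<le> f a \<and> f a \<le> (1::real)"
  shows "expectation (\<lambda>\<omega>. f (C \<omega> $$ p)) =
    (\<integral>a. f a * corr_weight n a \<partial>lborel) / (\<integral>a. corr_weight n a \<partial>lborel)"
proof -
  obtain i j where ij: "p = (i, j)" "i < j" "j < n" using p by (auto simp: upper_pairs_def)
  have int: "integrable lborel (\<lambda>a. f a * corr_weight n a)"
    by (rule Bochner_Integration.integrable_bound[OF integrable_corr_weight[of n]])
      (use f01 corr_weight_nonneg in \<open>auto simp: abs_mult mult_left_le_one_le\<close>)
  have W0: "0 \<le> (\<integral>a. corr_weight n a \<partial>lborel)" "0 \<le> (\<integral>a. f a * corr_weight n a \<partial>lborel)"
    using f01 corr_weight_nonneg by (auto intro!: Bochner_Integration.integral_nonneg)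
  have marg: "(\<integral>\<^sup>+ \<omega>. h (C \<omega> $$ p) \<partial>M) =
        (\<integral>\<^sup>+ a. h a * ennreal (corr_weight n a) \<partial>lborel) / (\<integral>\<^sup>+ a. ennreal (corr_weight n a) \<partial>lborel)"
    if "h \<in> borel_measurable borel" for h
    using uniform_corr_marginal[OF U, of i j h] that ij by simp
  have w: "(\<integral>\<^sup>+ a. ennreal (corr_weight n a) \<partial>lborel) = ennreal (\<integral>a. corr_weight n a \<partial>lborel)"
    by (rule nn_integral_eq_integral) (auto simp: integrable_corr_weight corr_weight_nonneg)
  have "(\<integral>\<^sup>+ a. ennreal (f a) * ennreal (corr_weight n a) \<partial>lborel) = (\<integral>\<^sup>+ a. ennreal (f a * corr_weight n a) \<partial>lborel)"
    using f01 by (simp add: ennreal_mult' mult.commute)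
  also have "\<dots> = ennreal (\<integral>a. f a * corr_weight n a \<partial>lborel)"
    by (rule nn_integral_eq_integral[OF int]) (use f01 corr_weight_nonneg in auto)
  finally have fw: "(\<integral>\<^sup>+ a. ennreal (f a) * ennreal (corr_weight n a) \<partial>lborel) = ennreal (\<integral>a. f a * corr_weight n a \<partial>lborel)" .
  \<comment> \<open>Were the normaliser zero, the marginal formula for h = 1 would say 1 = 0 / 0,
    and that quotient is 0 in \<open>ennreal\<close>.\<close>
  have Wpos: "0 < (\<integral>a. corr_weight n a \<partial>lborel)"
  proof (rule ccontr)
    assume "\<not> ?thesis"
    then have "(\<integral>a. corr_weight n a \<partial>lborel) = 0" using W0 by simp
    with w have "(\<integral>\<^sup>+ a. ennreal (corr_weight n a) \<partial>lborel) = 0" by simp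
    with marg[of "\<lambda>_. 1"] show False by (simp add: emeasure_space_1)
  qed
  have "expectation (\<lambda>\<omega>. f (C \<omega> $$ p)) = enn2real (\<integral>\<^sup>+ \<omega>. ennreal (f (C \<omega> $$ p)) \<partial>M)"
    by (rule integral_eq_nn_integral) (use f01 p in auto)
  also have "(\<integral>\<^sup>+ \<omega>. ennreal (f (C \<omega> $$ p)) \<partial>M) =
      ennreal ((\<integral>a. f a * corr_weight n a \<partial>lborel) / (\<integral>a. corr_weight n a \<partial>lborel))"
    by (subst marg[of "\<lambda>a. ennreal (f a)"]) (auto simp: fw w divide_ennreal W0 Wpos)
  finally show ?thesis using W0 by simp
qed

text \<open>Here v is the row to be sheared, and either index of p may be chosen. This freedom
  yields the independence of two entries that share an index.\<close>

lemma expectation_entry_indep: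
  assumes p: "p \<in> upper_pairs n" and v: "v = fst p \<or> v = snd p"
    and f [measurable]: "f \<in> borel_measurable borel" and f0: "\<And>a. 0 \<le> (f a :: real)"
    and G [measurable]: "G \<in> borel_measurable borel" and G0: "\<And>x. 0 \<le> (G x :: real)"
    and G_cong: "\<And>x y. (\<And>q. q \<in> upper_pairs n \<Longrightarrow> fst q \<noteq> v \<Longrightarrow> snd q \<noteq> v \<Longrightarrow> x q = y q) \<Longrightarrow> G x = G y"
  shows "expectation (\<lambda>\<omega>. f (C \<omega> $$ p) * G (upper_entries n (C \<omega>))) =
    expectation (\<lambda>\<omega>. f (C \<omega> $$ p)) * expectation (\<lambda>\<omega>. G (upper_entries n (C \<omega>)))"
proof -
  define i where "i = (if v = fst p then snd p else fst p)"
  have ij: "i \<noteq> v" "i < n" "v < n" "p = (min i v, max i v)"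
    using p v by (auto simp: i_def upper_pairs_def min_def max_def)
  note [measurable] = offdiag_borel[OF U]
  have "expectation (\<lambda>\<omega>. f (C \<omega> $$ p) * G (upper_entries n (C \<omega>))) =
      enn2real (\<integral>\<^sup>+ \<omega>. ennreal (f (C \<omega> $$ p) * G (upper_entries n (C \<omega>))) \<partial>M)"
    by (rule integral_eq_nn_integral) (use f0 G0 p in auto)
  also have "(\<integral>\<^sup>+ \<omega>. ennreal (f (C \<omega> $$ p) * G (upper_entries n (C \<omega>))) \<partial>M) =
      (\<integral>\<^sup>+ \<omega>. ennreal (f (C \<omega> $$ p)) \<partial>M) * (\<integral>\<^sup>+ \<omega>. ennreal (G (upper_entries n (C \<omega>))) \<partial>M)"
  proof -
    have "(\<integral>\<^sup>+ \<omega>. ennreal (f (C \<omega> $$ p)) * ennreal (G (upper_entries n (C \<omega>))) \<partial>M) =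
      (\<integral>\<^sup>+ \<omega>. ennreal (f (C \<omega> $$ p)) \<partial>M) * (\<integral>\<^sup>+ \<omega>. ennreal (G (upper_entries n (C \<omega>))) \<partial>M)"
      unfolding ij(4)
    proof (rule uniform_corr_indep[OF U ij(1-3), of "\<lambda>a. ennreal (f a)" "\<lambda>x. ennreal (G x)"])
      fix x y :: "nat \<times> nat \<Rightarrow> real"
      assume "\<And>q. q \<in> upper_pairs n \<Longrightarrow> fst q \<noteq> v \<Longrightarrow> snd q \<noteq> v \<Longrightarrow> x q = y q"
      then show "ennreal (G x) = ennreal (G y)" by (rule arg_cong[OF G_cong])
    qed measurable
    then show ?thesis using f0 G0 by (simp add: ennreal_mult)
  qed
  also have "enn2real \<dots> = expectation (\<lambda>\<omega>. f (C \<omega> $$ p)) * expectation (\<lambda>\<omega>. G (upper_entries n (C \<omega>)))"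
  proof -
    have "expectation (\<lambda>\<omega>. f (C \<omega> $$ p)) = enn2real (\<integral>\<^sup>+ \<omega>. ennreal (f (C \<omega> $$ p)) \<partial>M)"
      by (rule integral_eq_nn_integral) (use f0 p in auto)
    moreover have "expectation (\<lambda>\<omega>. G (upper_entries n (C \<omega>))) = enn2real (\<integral>\<^sup>+ \<omega>. ennreal (G (upper_entries n (C \<omega>))) \<partial>M)"
      by (rule integral_eq_nn_integral) (use G0 in auto)
    ultimately show ?thesis by (simp add: enn2real_mult)
  qed
  finally show ?thesis .
qed

text \<open>Two pairs are neighbours if they share an index. A pair has at most 2n neighbours, each
  contributing 2 e^2, hence 4 n e^2 per pair.\<close>

lemma exceedance_product_approx:
  fixes g :: "real \<Rightarrow> real"
  assumes g [measurable]: "g \<in> borel_measurable borel" and g01: "\<And>t. 0 \<le> g t \<and> g t \<le> 1"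
  defines "e \<equiv> exceedance_mean n g"
  shows "\<bar>expectation (\<lambda>\<omega>. \<Prod>p\<in>upper_pairs n. 1 - g (exceedance_point n (C \<omega>) p)) - (1 - e) ^ card (upper_pairs n)\<bar>
     \<le> real (card (upper_pairs n)) * (4 * real n * e\<^sup>2)"
proof -
  let ?I = "upper_pairs n"
  define f where "f a = g ((real n + 1) * a\<^sup>2 - exceedance_level n)" for a
  have fm [measurable]: "f \<in> borel_measurable borel" unfolding f_def by measurable
  have f01: "0 \<le> f a \<and> f a \<le> 1" for a using g01 by (simp add: f_def)
  define Y where "Y p \<omega> = f (C \<omega> $$ p)" for p \<omega>
  define R where "R p q \<longleftrightarrow> fst q = fst p \<or> fst q = snd p \<or> snd q = fst p \<or> snd q = snd p" for p q :: "nat \<times> nat"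
  have eY: "expectation (Y p) = e" if "p \<in> ?I" for p
    unfolding Y_def e_def using expectation_entry[OF that fm f01] by (simp add: f_def exceedance_mean_def)
  have "\<bar>expectation (\<lambda>\<omega>. \<Prod>p\<in>?I. 1 - Y p \<omega>) - (\<Prod>p\<in>?I. 1 - expectation (Y p))\<bar>
    \<le> (\<Sum>p\<in>?I. \<Sum>q\<in>{q \<in> ?I. q \<noteq> p \<and> R p q}. 2 * expectation (Y p) * expectation (Y q))"
  proof (rule expectation_prod_local_dependence)
    show "finite ?I" by (rule finite_upper_pairs)
    show "Y p \<in> borel_measurable M" if "p \<in> ?I" for p using that unfolding Y_def by measurable
    show "0 \<le> Y p \<omega> \<and> Y p \<omega> \<le> 1" for p \<omega> using f01 by (simp add: Y_def)
    show "expectation (\<lambda>\<omega>. Y p \<omega> * (\<Prod>q\<in>S. 1 - Y q \<omega>)) =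
        expectation (Y p) * expectation (\<lambda>\<omega>. \<Prod>q\<in>S. 1 - Y q \<omega>)"
      if "p \<in> ?I" "S \<subseteq> ?I" "p \<notin> S" "\<And>q. q \<in> S \<Longrightarrow> \<not> R p q" for p S
    proof -
      define G where "G x = (\<Prod>q\<in>S. 1 - f (x q))" for x :: "nat \<times> nat \<Rightarrow> real"
      have GS: "G (upper_entries n (C \<omega>)) = (\<Prod>q\<in>S. 1 - Y q \<omega>)" for \<omega>
        unfolding G_def Y_def upper_entries_def using that(2) by (intro prod.cong) auto
      have "expectation (\<lambda>\<omega>. f (C \<omega> $$ p) * G (upper_entries n (C \<omega>))) =
         expectation (\<lambda>\<omega>. f (C \<omega> $$ p)) * expectation (\<lambda>\<omega>. G (upper_entries n (C \<omega>)))"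
      proof (rule expectation_entry_indep[where v = "fst p"])
        show "G \<in> borel_measurable borel"
          unfolding G_def by (intro borel_measurable_prod borel_measurable_diff borel_measurable_const
              measurable_compose[OF measurable_product_coordinates]) measurable
        show "0 \<le> G x" for x using f01 by (auto simp: G_def intro!: prod_nonneg)
        show "G x = G y" if eq: "\<And>q. q \<in> upper_pairs n \<Longrightarrow> fst q \<noteq> fst p \<Longrightarrow> snd q \<noteq> fst p \<Longrightarrow> x q = y q" for x y
          unfolding G_def using \<open>S \<subseteq> ?I\<close> \<open>\<And>q. q \<in> S \<Longrightarrow> \<not> R p q\<close>
          by (intro prod.cong refl arg_cong[of _ _ "\<lambda>a. 1 - f a"] eq) (auto simp: R_def)
      qed (use f01 that in auto)
      then show ?thesis unfolding GS by (simp add: Y_def[abs_def])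
    qed
    show "expectation (\<lambda>\<omega>. Y p \<omega> * Y q \<omega>) = expectation (Y p) * expectation (Y q)"
      if pq: "p \<in> ?I" "q \<in> ?I" "p \<noteq> q" "R p q" for p q
    proof -
      \<comment> \<open>An index of p that does not occur in q. It exists because distinct ordered
        pairs cannot have both indices in common; shearing its row makes the two entries
        independent.\<close>
      define v where "v = (if fst p \<in> {fst q, snd q} then snd p else fst p)"
      have v: "v = fst p \<or> v = snd p" "fst q \<noteq> v" "snd q \<noteq> v"
        using pq by (auto simp: v_def upper_pairs_def)
      have "expectation (\<lambda>\<omega>. f (C \<omega> $$ p) * f (upper_entries n (C \<omega>) q)) =
         expectation (\<lambda>\<omega>. f (C \<omega> $$ p)) * expectation (\<lambda>\<omega>. f (upper_entries n (C \<omega>) q))"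
      proof (rule expectation_entry_indep[where v = v])
        show "(\<lambda>x. f (x q)) \<in> borel_measurable borel"
          by (rule measurable_compose[OF measurable_product_coordinates]) measurable
      qed (use f01 pq v in auto)
      then show ?thesis using pq by (simp add: Y_def[abs_def] upper_entries_def)
    qed
  qed
  also have "\<dots> \<le> (\<Sum>p\<in>?I. 4 * real n * e\<^sup>2)"
  proof (rule sum_mono)
    fix p assume p: "p \<in> ?I"
    let ?A = "{q \<in> ?I. q \<noteq> p \<and> R p q}"
    \<comment> \<open>All pairs meeting p arise by joining one of its two indices with some k below
      n, so at most 2n of them.\<close>
    let ?star = "(\<lambda>k. (min (fst p) k, max (fst p) k)) ` {..<n} \<union> (\<lambda>k. (min (snd p) k, max (snd p) k)) ` {..<n}"
    have "?A \<subseteq> ?star"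
    proof
      fix q assume q: "q \<in> ?A"
      then have lt: "fst q < snd q" "snd q < n" by (auto simp: upper_pairs_def)
      consider "fst q = fst p" | "fst q = snd p" | "snd q = fst p" | "snd q = snd p"
        using q by (auto simp only: R_def mem_Collect_eq)
      then show "q \<in> ?star"
      proof cases
        case 1 then show ?thesis using lt by (intro UnI1 image_eqI[of _ _ "snd q"]) (auto simp: prod_eq_iff)
      next
        case 2 then show ?thesis using lt by (intro UnI2 image_eqI[of _ _ "snd q"]) (auto simp: prod_eq_iff)
      next
        case 3 then show ?thesis using lt by (intro UnI1 image_eqI[of _ _ "fst q"]) (auto simp: prod_eq_iff)
      next
        case 4 then show ?thesis using lt by (intro UnI2 image_eqI[of _ _ "fst q"]) (auto simp: prod_eq_iff)
      qed
    qed
    then have "card ?A \<le> card ?star"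
      by (rule card_mono[rotated]) auto
    also have "\<dots> \<le> n + n"
      by (rule order_trans[OF card_Un_le] add_mono card_image_le[of "{..<n}", simplified])+
    finally have "real (card ?A) \<le> 2 * real n" by simp
    then have "real (card ?A) * (2 * e\<^sup>2) \<le> 2 * real n * (2 * e\<^sup>2)" by (rule mult_right_mono) simp
    moreover have "(\<Sum>q\<in>?A. 2 * expectation (Y p) * expectation (Y q)) = real (card ?A) * (2 * e\<^sup>2)"
      using p by (simp add: eY power2_eq_square)
    ultimately show "(\<Sum>q\<in>?A. 2 * expectation (Y p) * expectation (Y q)) \<le> 4 * real n * e\<^sup>2" by simp
  qed
  finally have "\<bar>expectation (\<lambda>\<omega>. \<Prod>p\<in>?I. 1 - Y p \<omega>) - (\<Prod>p\<in>?I. 1 - expectation (Y p))\<bar>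
      \<le> real (card ?I) * (4 * real n * e\<^sup>2)"
    by (simp only: sum_constant)
  moreover have "(\<Prod>p\<in>?I. 1 - expectation (Y p)) = (1 - e) ^ card ?I"
    by (simp add: eY)
  moreover have "Y p \<omega> = g (exceedance_point n (C \<omega>) p)" for p \<omega>
    by (simp only: Y_def f_def exceedance_point_def)
  ultimately show ?thesis by (simp only:)
qed

end

text \<open>ln(1 - e) = -e + O(e^2), and N e^2 = (N e) e vanishes since N e converges while N
  grows.\<close>

lemma power_one_minus_tendsto_exp:
  fixes e :: "nat \<Rightarrow> real" and N :: "nat \<Rightarrow> nat"
  assumes N: "filterlim (\<lambda>n. real (N n)) at_top sequentially" and l: "(\<lambda>n. real (N n) * e n) \<longlonglongrightarrow> l"
  shows "(\<lambda>n. (1 - e n) ^ N n) \<longlonglongrightarrow> exp (- l)"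
proof -
  have e0: "e \<longlonglongrightarrow> 0"
  proof -
    have "(\<lambda>n. (real (N n) * e n) * inverse (real (N n))) \<longlonglongrightarrow> l * 0"
      by (intro tendsto_mult l tendsto_inverse_0_at_top N)
    moreover have "eventually (\<lambda>n. (real (N n) * e n) * inverse (real (N n)) = e n) sequentially"
      using filterlim_at_top_dense[THEN iffD1, OF N, rule_format, of 0] by eventually_elim simp
    ultimately show ?thesis by (simp add: Lim_transform_eventually)
  qed
  have small: "eventually (\<lambda>n. \<bar>e n\<bar> < 1 / 2) sequentially"
    using tendstoD[OF e0, of "1/2"] by (simp add: dist_real_def)
  have "(\<lambda>n. real (N n) * (ln (1 - e n) + e n)) \<longlonglongrightarrow> 0"
  proof (rule Lim_null_comparison)
    have "(\<lambda>n. 2 * \<bar>real (N n) * e n\<bar> * \<bar>e n\<bar>) \<longlonglongrightarrow> 2 * \<bar>l\<bar> * \<bar>0\<bar>"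
      by (intro tendsto_intros l e0)
    then show "(\<lambda>n. 2 * \<bar>real (N n) * e n\<bar> * \<bar>e n\<bar>) \<longlonglongrightarrow> 0" by simp
    show "eventually (\<lambda>n. norm (real (N n) * (ln (1 - e n) + e n)) \<le> 2 * \<bar>real (N n) * e n\<bar> * \<bar>e n\<bar>) sequentially"
      using small
    proof eventually_elim
      case (elim n)
      have "\<bar>ln (1 + - e n) - - e n\<bar> \<le> 2 * (- e n)\<^sup>2"
        using elim by (intro abs_ln_one_plus_x_minus_x_bound) auto
      then have "real (N n) * \<bar>ln (1 - e n) + e n\<bar> \<le> real (N n) * (2 * (e n)\<^sup>2)"
        by (intro mult_left_mono) auto
      also have "\<dots> = 2 * \<bar>real (N n) * e n\<bar> * \<bar>e n\<bar>"
        by (simp add: abs_mult mult.assoc power2_eq_square)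
      finally show ?case by (simp add: abs_mult)
    qed
  qed
  then have "(\<lambda>n. exp (real (N n) * (ln (1 - e n) + e n) - real (N n) * e n)) \<longlonglongrightarrow> exp (0 - l)"
    by (intro tendsto_intros l)
  moreover have "eventually (\<lambda>n. exp (real (N n) * (ln (1 - e n) + e n) - real (N n) * e n) = (1 - e n) ^ N n) sequentially"
    using small
  proof eventually_elim
    case (elim n)
    have "real (N n) * (ln (1 - e n) + e n) - real (N n) * e n = real (N n) * ln (1 - e n)"
      by (simp add: algebra_simps)
    then show ?case using elim by (simp add: exp_of_nat_mult)
  qed
  ultimately show ?thesis by (simp add: Lim_transform_eventually)
qed

text \<open>The limit is the probability generating functional of the Poisson process with intensity
  measure \<open>intensity\<close>, evaluated at 1 - g.\<close>

lemma exceedance_product_tendsto: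
  fixes M :: "nat \<Rightarrow> 'a measure" and C :: "nat \<Rightarrow> 'a \<Rightarrow> real mat" and g :: "real \<Rightarrow> real"
  assumes U: "\<And>n. uniform_correlation_matrix (M n) n (C n)"
    and g [measurable]: "g \<in> borel_measurable borel" and g01: "\<And>t. 0 \<le> g t \<and> g t \<le> 1"
    and gt0: "\<And>t. t < t0 \<Longrightarrow> g t = 0"
  shows "(\<lambda>n. \<integral>\<omega>. (\<Prod>p\<in>upper_pairs n. 1 - g (exceedance_point n (C n \<omega>) p)) \<partial>M n) \<longlonglongrightarrow> exp (- (\<integral>t. g t \<partial>intensity))"
proof -
  define e where "e n = exceedance_mean n g" for n
  define N where "N n = card (upper_pairs n)" for n
  have N: "real (N n) = real n * (real n - 1) / 2" for n by (simp add: N_def real_card_upper_pairs)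
  have Ne: "(\<lambda>n. real (N n) * e n) \<longlonglongrightarrow> (\<integral>t. g t \<partial>intensity)"
    unfolding N e_def using marginal_exceedance_tendsto[OF g g01 gt0] by simp
  have "filterlim (\<lambda>n. real (N n)) at_top sequentially" unfolding N by real_asymp
  from power_one_minus_tendsto_exp[OF this Ne]
  have pow: "(\<lambda>n. (1 - e n) ^ N n) \<longlonglongrightarrow> exp (- (\<integral>t. g t \<partial>intensity))" .
  have "(\<lambda>n. (\<integral>\<omega>. (\<Prod>p\<in>upper_pairs n. 1 - g (exceedance_point n (C n \<omega>) p)) \<partial>M n) - (1 - e n) ^ N n) \<longlonglongrightarrow> 0"
  proof (rule Lim_null_comparison)
    \<comment> \<open>The bound N * 4 n e^2 rewritten with N = n(n-1)/2: as N e converges, it is of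
      order 1/n.\<close>
    have "(\<lambda>n. (real (N n) * e n)\<^sup>2 * (8 / (real n - 1))) \<longlonglongrightarrow> (\<integral>t. g t \<partial>intensity)\<^sup>2 * 0"
      by (intro tendsto_mult tendsto_power Ne) real_asymp
    then show "(\<lambda>n. (real (N n) * e n)\<^sup>2 * (8 / (real n - 1))) \<longlonglongrightarrow> 0" by simp
    show "eventually (\<lambda>n. norm ((\<integral>\<omega>. (\<Prod>p\<in>upper_pairs n. 1 - g (exceedance_point n (C n \<omega>) p)) \<partial>M n) - (1 - e n) ^ N n)
      \<le> (real (N n) * e n)\<^sup>2 * (8 / (real n - 1))) sequentially"
      using eventually_ge_at_top[of 2]
    proof eventually_elim
      case (elim n)
      have "real (N n) * (4 * real n * (e n)\<^sup>2) = (real (N n) * e n)\<^sup>2 * (8 / (real n - 1))"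
        using elim by (simp add: N power2_eq_square field_simps)
      then show ?case
        using exceedance_product_approx[OF U g g01, of n] by (simp add: e_def N_def)
    qed
  qed
  from tendsto_add[OF this pow] show ?thesis by simp
qed

lemma emeasure_intensity_bdd_below:
  assumes [measurable]: "B \<in> sets borel" and "bdd_below B"
  shows "emeasure intensity B < \<infinity>"
proof -
  obtain t0 where t0: "\<And>t. t \<in> B \<Longrightarrow> t0 \<le> t" using assms(2) by (auto simp: bdd_below_def)
  let ?c = "1 / (2 * sqrt (8 * pi))"
  have "emeasure intensity B = (\<integral>\<^sup>+ t. ennreal (?c * exp (- t / 2)) * indicator B t \<partial>lborel)"
    unfolding intensity_def by (rule emeasure_density) auto
  also have "\<dots> \<le> (\<integral>\<^sup>+ t. ennreal (?c * (exp (- t / 2) * indicator {t0..} t)) \<partial>lborel)"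
    using t0 by (intro nn_integral_mono) (auto simp: indicator_def)
  also have "\<dots> < \<infinity>"
    using integrableD(2)[OF integrable_mult_right[OF integrable_exp_half_tail[of t0], of ?c]]
    by (simp add: abs_mult top.not_eq_extremum)
  finally show ?thesis .
qed

lemma sets_intensity [simp, measurable_cong]: "sets intensity = sets borel"
  by (simp add: intensity_def)

lemma exceedance_counts_pgf_tendsto:
  fixes M :: "nat \<Rightarrow> 'a measure" and C :: "nat \<Rightarrow> 'a \<Rightarrow> real mat" and B :: "nat \<Rightarrow> real set"
  assumes U: "\<And>n. uniform_correlation_matrix (M n) n (C n)"
    and B: "\<And>r. r < m \<Longrightarrow> B r \<in> sets borel" "\<And>r. r < m \<Longrightarrow> bdd_below (B r)"
    and disj: "disjoint_family_on B {..<m}"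
    and z: "\<And>r. 0 \<le> z r \<and> z r \<le> (1::real)"
  shows "(\<lambda>n. \<integral>\<omega>. (\<Prod>r<m. z r ^ exceedance_count n (C n \<omega>) (B r)) \<partial>M n) \<longlonglongrightarrow>
    exp (- (\<Sum>r<m. (1 - z r) * measure intensity (B r)))"
proof -
  \<comment> \<open>By disjointness 1 - g takes the value \<open>z r\<close> on \<open>B r\<close>
    and 1 off all these sets, so the product over the points becomes the product of the powers of
    \<open>z r\<close>.\<close>
  define g where "g t = (\<Sum>r<m. (1 - z r) * indicator (B r) t)" for t :: real
  have cover: "(\<exists>r<m. t \<in> B r \<and> (\<forall>s<m. t \<in> B s \<longleftrightarrow> s = r)) \<or> (\<forall>r<m. t \<notin> B r)" for t
    using disj by (fastforce simp: disjoint_family_on_def)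
  have g1: "g t = 1 - z r" if "r < m" "\<And>s. s < m \<Longrightarrow> t \<in> B s \<longleftrightarrow> s = r" for t r
  proof -
    have "g t = (\<Sum>s<m. if s = r then 1 - z r else 0)"
      unfolding g_def by (intro sum.cong) (auto simp: that indicator_def)
    also have "\<dots> = 1 - z r" by (subst sum.delta) (use that(1) in auto)
    finally show ?thesis .
  qed
  have g0: "g t = 0" if "\<And>r. r < m \<Longrightarrow> t \<notin> B r" for t
    unfolding g_def using that by (intro sum.neutral) auto
  have g01: "0 \<le> g t \<and> g t \<le> 1" for t
    using cover[of t] z g0[of t] g1[of _ t] by fastforce
  have gm: "g \<in> borel_measurable borel"
    unfolding g_def using B by (intro borel_measurable_sum borel_measurable_times) auto
  obtain t0 where t0: "\<And>r t. r < m \<Longrightarrow> t \<in> B r \<Longrightarrow> t0 \<le> t"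
  proof -
    have "bdd_below (\<Union>r\<in>{..<m}. B r)" using B(2) by (subst bdd_below_UN) auto
    then show ?thesis using that by (auto simp: bdd_below_def)
  qed
  have prod: "(\<Prod>p\<in>upper_pairs n. 1 - g (exceedance_point n D p)) = (\<Prod>r<m. z r ^ exceedance_count n D (B r))" for n D
  proof -
    let ?x = "exceedance_point n D"
    have "1 - g t = (\<Prod>r<m. if t \<in> B r then z r else 1)" for t
      using cover[of t]
    proof
      assume "\<exists>r<m. t \<in> B r \<and> (\<forall>s<m. t \<in> B s \<longleftrightarrow> s = r)"
      then obtain r where r: "r < m" "\<And>s. s < m \<Longrightarrow> t \<in> B s \<longleftrightarrow> s = r" by blast
      have "(\<Prod>s<m. if t \<in> B s then z s else 1) = (\<Prod>s<m. if s = r then z r else 1)"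
        using r by (intro prod.cong) auto
      then show ?thesis using r g1 by simp
    qed (use g0 in simp)
    then have "(\<Prod>p\<in>upper_pairs n. 1 - g (?x p)) = (\<Prod>r<m. \<Prod>p\<in>upper_pairs n. if ?x p \<in> B r then z r else 1)"
      by (simp add: prod.swap[of _ "upper_pairs n"])
    also have "\<dots> = (\<Prod>r<m. z r ^ exceedance_count n D (B r))"
      using finite_upper_pairs[of n]
      by (intro prod.cong refl) (simp add: prod.If_cases exceedance_count_def Int_def)
    finally show ?thesis .
  qed
  have "(\<integral>t. g t \<partial>intensity) = (\<Sum>r<m. (1 - z r) * measure intensity (B r))"
  proof -
    have fin: "emeasure intensity (B r) < \<infinity>" if "r < m" for r
      by (rule emeasure_intensity_bdd_below[OF B(1)[OF that] B(2)[OF that]])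
    have "(\<integral>t. g t \<partial>intensity) = (\<Sum>r<m. \<integral>t. (1 - z r) * indicator (B r) t \<partial>intensity)"
      unfolding g_def using B fin
      by (intro Bochner_Integration.integral_sum integrable_mult_right integrable_real_indicator) auto
    also have "\<dots> = (\<Sum>r<m. (1 - z r) * measure intensity (B r))"
      using B by (intro sum.cong refl) (auto simp: space_density intensity_def)
    finally show ?thesis .
  qed
  moreover have "(\<lambda>n. \<integral>\<omega>. (\<Prod>p\<in>upper_pairs n. 1 - g (exceedance_point n (C n \<omega>) p)) \<partial>M n) \<longlonglongrightarrow> exp (- (\<integral>t. g t \<partial>intensity))"
  proof (rule exceedance_product_tendsto[OF U gm g01])
    show "g t = 0" if "t < t0" for t
      by (rule g0) (use t0[of _ t] that in \<open>meson not_less\<close>)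
  qed
  ultimately show ?thesis by (simp add: prod)
qed

text \<open>Vectors of counts are kept as lists because \<open>nat list\<close> is a countable type,
  where the discrete convergence criterion applies.\<close>

lemma measurable_map_upt:
  fixes X :: "nat \<Rightarrow> 'z \<Rightarrow> nat"
  assumes X: "\<And>r. r < m \<Longrightarrow> X r \<in> N \<rightarrow>\<^sub>M count_space UNIV"
  shows "(\<lambda>\<omega>. map (\<lambda>r. X r \<omega>) [0..<m]) \<in> N \<rightarrow>\<^sub>M count_space UNIV"
  using X
proof (induction m)
  case 0
  then show ?case by simp
next
  case (Suc m)
  then have 1: "(\<lambda>\<omega>. map (\<lambda>r. X r \<omega>) [0..<m]) \<in> N \<rightarrow>\<^sub>M count_space UNIV"
    and 2: "X m \<in> N \<rightarrow>\<^sub>M count_space UNIV" by auto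
  have "(\<lambda>\<omega>. map (\<lambda>r. X r \<omega>) [0..<m] @ [X m \<omega>]) \<in> N \<rightarrow>\<^sub>M count_space UNIV"
    by (rule measurable_compose_countable[OF measurable_compose_countable[OF _ 1] 2]) simp
  then show ?case by simp
qed

lemma exceedance_counts_tendsto:
  fixes M :: "nat \<Rightarrow> 'a measure" and C :: "nat \<Rightarrow> 'a \<Rightarrow> real mat" and K :: "nat \<Rightarrow> 'p \<Rightarrow> nat"
    and G :: "nat list \<Rightarrow> real"
  assumes U: "\<And>n. uniform_correlation_matrix (M n) n (C n)"
    and B: "\<And>r. r < m \<Longrightarrow> B r \<in> sets borel" "\<And>r. r < m \<Longrightarrow> bdd_below (B r)"
    and disj: "disjoint_family_on B {..<m}"
    and P: "prob_space P" and K [measurable]: "\<And>r. r < m \<Longrightarrow> K r \<in> P \<rightarrow>\<^sub>M count_space UNIV"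
    and law: "\<And>k. measure P {\<omega> \<in> space P. \<forall>r<m. K r \<omega> = k r} = (\<Prod>r<m. pmf (poisson_law (measure intensity (B r))) (k r))"
    and G: "\<And>x. \<bar>G x\<bar> \<le> b"
  shows "(\<lambda>n. \<integral>\<omega>. G (map (\<lambda>r. exceedance_count n (C n \<omega>) (B r)) [0..<m]) \<partial>M n) \<longlonglongrightarrow>
    (\<integral>\<omega>. G (map (\<lambda>r. K r \<omega>) [0..<m]) \<partial>P)"
proof (rule discrete_expectation_tendsto[OF _ P _ _ _ G])
  show M: "prob_space (M n)" for n by (rule uniform_corr_prob_space[OF U])
  have count: "(\<lambda>\<omega>. exceedance_count n (C n \<omega>) (B r)) \<in> M n \<rightarrow>\<^sub>M count_space UNIV" if "r < m" for n r
    by (rule exceedance_count_measurable[OF U B(1)[OF that]])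
  show "(\<lambda>\<omega>. map (\<lambda>r. exceedance_count n (C n \<omega>) (B r)) [0..<m]) \<in> M n \<rightarrow>\<^sub>M count_space UNIV" for n
    by (rule measurable_map_upt[OF count])
  show "(\<lambda>\<omega>. map (\<lambda>r. K r \<omega>) [0..<m]) \<in> P \<rightarrow>\<^sub>M count_space UNIV"
    by (rule measurable_map_upt[OF K])
  fix d :: "nat list"
  have ev: "map h [0..<m] = d \<longleftrightarrow> length d = m \<and> (\<forall>r<m. h r = d ! r)" for h :: "nat \<Rightarrow> nat"
    by (auto simp: list_eq_iff_nth_eq)
  have "(\<lambda>n. measure (M n) {\<omega> \<in> space (M n). \<forall>r<m. exceedance_count n (C n \<omega>) (B r) = d ! r}) \<longlonglongrightarrow>
      (\<Prod>r<m. pmf (poisson_law (measure intensity (B r))) (d ! r))"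
  proof (rule poisson_joint_limit[OF M count])
    show "(\<lambda>n. \<integral>\<omega>. (\<Prod>r<m. z r ^ exceedance_count n (C n \<omega>) (B r)) \<partial>M n) \<longlonglongrightarrow>
        exp (- (\<Sum>r<m. (1 - z r) * measure intensity (B r)))"
      if "\<And>r. 0 \<le> z r \<and> z r \<le> 1" for z
      by (rule exceedance_counts_pgf_tendsto[OF U B disj that])
  qed simp_all
  \<comment> \<open>A list of the wrong length has probability zero on both sides.\<close>
  then show "(\<lambda>n. measure (M n) {\<omega> \<in> space (M n). map (\<lambda>r. exceedance_count n (C n \<omega>) (B r)) [0..<m] = d})
      \<longlonglongrightarrow> measure P {\<omega> \<in> space P. map (\<lambda>r. K r \<omega>) [0..<m] = d}"
    unfolding ev law[symmetric] by (cases "length d = m") simp_all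
qed

section \<open>Reading off integers from Poisson variables\<close>

text \<open>A Poisson variable may take values in the reals or in \<open>ennreal\<close> and is an
  integer only almost surely. A measurable left inverse f of \<open>of_nat\<close> recovers the
  integer; both types are needed later, hence the generality.\<close>

lemma poisson_distributed_round:
  fixes V :: "'p \<Rightarrow> 'b :: {semiring_1, t2_space}" and f :: "'b \<Rightarrow> nat"
  assumes V: "poisson_distributed P V l" and f [measurable]: "f \<in> borel \<rightarrow>\<^sub>M count_space UNIV"
    and fk: "\<And>k. f (of_nat k) = k" and eq: "{y. y = of_nat (f y)} \<in> sets borel"
  shows "AE \<omega> in P. V \<omega> = of_nat (f (V \<omega>))"
    and "measure P {\<omega> \<in> space P. f (V \<omega>) = k} = pmf (poisson_law l) k"
proof -
  have Vm [measurable]: "V \<in> borel_measurable P" and D: "distr P borel V = distr (measure_pmf (poisson_law l)) borel of_nat"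
    using V by (auto simp: poisson_distributed_def)
  have "AE y in distr (measure_pmf (poisson_law l)) borel of_nat. y = of_nat (f y)"
    using eq fk by (subst AE_distr_iff) auto
  then show "AE \<omega> in P. V \<omega> = of_nat (f (V \<omega>))"
    unfolding D[symmetric] using eq by (subst (asm) AE_distr_iff) auto
  have S: "{y. f y = k} \<in> sets borel" by measurable
  have "measure P {\<omega> \<in> space P. f (V \<omega>) = k} = measure (distr P borel V) {y. f y = k}"
    using S by (subst measure_distr) (auto intro!: arg_cong[of _ _ "measure P"])
  also have "\<dots> = measure (measure_pmf (poisson_law l)) {k}"
    unfolding D using S by (subst measure_distr) (auto simp: fk vimage_def)
  finally show "measure P {\<omega> \<in> space P. f (V \<omega>) = k} = pmf (poisson_law l) k"
    by (simp add: measure_pmf_single)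
qed

lemma poisson_joint_round:
  fixes V :: "nat \<Rightarrow> 'p \<Rightarrow> 'b :: {semiring_1, t2_space}" and f :: "'b \<Rightarrow> nat"
  assumes P: "prob_space P" and V: "\<And>r. r < m \<Longrightarrow> poisson_distributed P (V r) (l r)"
    and ind: "prob_space.indep_vars P (\<lambda>_. borel) V {..<m}"
    and f [measurable]: "f \<in> borel \<rightarrow>\<^sub>M count_space UNIV"
    and fk: "\<And>k. f (of_nat k) = k" and eq: "{y. y = of_nat (f y)} \<in> sets borel"
  shows "measure P {\<omega> \<in> space P. \<forall>r<m. f (V r \<omega>) = k r} = (\<Prod>r<m. pmf (poisson_law (l r)) (k r))"
proof (cases "m = 0")
  \<comment> \<open>Without factors, the intersection used in the other case would be
    \<open>UNIV\<close> instead of \<open>space P\<close>.\<close>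
  case True
  then show ?thesis using prob_space.prob_space[OF P] by simp
next
  case False
  interpret prob_space P by (rule P)
  let ?A = "\<lambda>r. {y. f y = k r}"
  have "prob (\<Inter>r\<in>{..<m}. V r -` ?A r \<inter> space P) = (\<Prod>r\<in>{..<m}. prob (V r -` ?A r \<inter> space P))"
    using False by (intro indep_varsD[OF ind]) auto
  moreover have "(\<Inter>r\<in>{..<m}. V r -` ?A r \<inter> space P) = {\<omega> \<in> space P. \<forall>r<m. f (V r \<omega>) = k r}"
    using False by auto
  moreover have "prob (V r -` ?A r \<inter> space P) = pmf (poisson_law (l r)) (k r)" if "r < m" for r
    using poisson_distributed_round(2)[OF V[OF that] f fk eq, of "k r"]
    by (simp add: vimage_def Int_def conj_commute)
  ultimately show ?thesis by simp
qed

lemma borel_measurable_continuous_map: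
  assumes "continuous_map T euclideanreal F"
  shows "F \<in> borel_measurable (borel_of T)"
proof (rule borel_measurableI)
  fix S :: "real set" assume "open S"
  then have "openin T {x \<in> topspace T. F x \<in> S}"
    using assms openin_continuous_map_preimage[of T euclideanreal F S] by simp
  moreover have "F -` S \<inter> space (borel_of T) = {x \<in> topspace T. F x \<in> S}"
    by (auto simp: borel_of_def space_measure_of_conv)
  moreover have "{U. openin T U} \<subseteq> Pow (topspace T)" using openin_subset by auto
  ultimately show "F -` S \<inter> space (borel_of T) \<in> sets (borel_of T)"
    by (auto simp: borel_of_def sets_measure_of)
qed

lemma measurable_borel_ofI:
  assumes "\<And>\<omega>. \<omega> \<in> space N \<Longrightarrow> X \<omega> \<in> topspace T"
    and "\<And>U. openin T U \<Longrightarrow> X -` U \<inter> space N \<in> sets N"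
  shows "X \<in> N \<rightarrow>\<^sub>M borel_of T"
  unfolding borel_of_def
  using assms openin_subset[of T] by (intro measurable_measure_of) auto

text \<open>The vector is padded by zeros to a point of the full function space, whose Borel sets
  are handled coordinatewise; restriction back to the first m coordinates is continuous.\<close>

lemma measurable_finite_product_topology:
  fixes X :: "nat \<Rightarrow> 'a \<Rightarrow> real"
  assumes X: "\<And>r. r < m \<Longrightarrow> X r \<in> borel_measurable N"
  shows "(\<lambda>\<omega>. \<lambda>r\<in>{..<m}. X r \<omega>) \<in> N \<rightarrow>\<^sub>M borel_of (product_topology (\<lambda>_. euclideanreal) {..<m})"
proof (rule measurable_borel_ofI)
  let ?T = "product_topology (\<lambda>_. euclideanreal) {..<m}"
  define X' where "X' \<omega> = (\<lambda>r. if r < m then X r \<omega> else 0)" for \<omega>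
  have X'm: "X' \<in> borel_measurable N"
  proof (rule measurable_coordinatewise_then_product)
    show "(\<lambda>\<omega>. X' \<omega> r) \<in> borel_measurable N" for r
      using X[of r] by (cases "r < m") (simp_all add: X'_def)
  qed
  have cont: "continuous_map euclidean ?T (\<lambda>x::nat \<Rightarrow> real. restrict x {..<m})"
    by (rule continuous_map_coordinatewise_then_product) auto
  fix U assume "openin ?T U"
  from openin_continuous_map_preimage[OF cont this]
  have "open {x::nat \<Rightarrow> real. restrict x {..<m} \<in> U}" by simp
  then have "X' -` {x. restrict x {..<m} \<in> U} \<inter> space N \<in> sets N"
    by (intro measurable_sets[OF X'm] borel_open)
  moreover have "restrict (X' \<omega>) {..<m} = (\<lambda>r\<in>{..<m}. X r \<omega>)" for \<omega>
    by (auto simp: X'_def)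
  ultimately show "(\<lambda>\<omega>. \<lambda>r\<in>{..<m}. X r \<omega>) -` U \<inter> space N \<in> sets N"
    by (simp add: vimage_def)
qed auto

lemma exceedance_counts_converge_in_distribution:
  fixes M :: "nat \<Rightarrow> 'a measure" and C :: "nat \<Rightarrow> 'a \<Rightarrow> real mat" and B :: "nat \<Rightarrow> real set"
    and Z :: "nat \<Rightarrow> 'q \<Rightarrow> real"
  assumes U: "\<And>n. uniform_correlation_matrix (M n) n (C n)"
    and B: "\<And>r. r < m \<Longrightarrow> B r \<in> sets borel" "\<And>r. r < m \<Longrightarrow> bdd_below (B r)"
    and disj: "disjoint_family_on B {..<m}"
    and P: "prob_space P" and ind: "prob_space.indep_vars P (\<lambda>_. borel) Z {..<m}"
    and Z: "\<And>r. r < m \<Longrightarrow> poisson_distributed P (Z r) (measure intensity (B r))"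
  shows "converges_in_distribution (product_topology (\<lambda>_. euclideanreal) {..<m})
          M (\<lambda>n \<omega>. \<lambda>r\<in>{..<m}. real (exceedance_count n (C n \<omega>) (B r)))
          P (\<lambda>\<omega>. \<lambda>r\<in>{..<m}. Z r \<omega>)"
  unfolding converges_in_distribution_def
proof (intro conjI allI impI)
  let ?T = "product_topology (\<lambda>_. euclideanreal) {..<m}"
  have Zm: "Z r \<in> borel_measurable P" if "r < m" for r
    using Z[OF that] by (simp add: poisson_distributed_def)
  show "(\<lambda>\<omega>. \<lambda>r\<in>{..<m}. real (exceedance_count n (C n \<omega>) (B r))) \<in> M n \<rightarrow>\<^sub>M borel_of ?T" for n
    by (rule measurable_finite_product_topology)
      (rule measurable_compose[OF exceedance_count_measurable[OF U B(1)]], auto)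
  show Zt: "(\<lambda>\<omega>. \<lambda>r\<in>{..<m}. Z r \<omega>) \<in> P \<rightarrow>\<^sub>M borel_of ?T"
    by (rule measurable_finite_product_topology) (rule Zm)
  fix F :: "(nat \<Rightarrow> real) \<Rightarrow> real" assume F: "continuous_map ?T euclideanreal F \<and> bounded (F ` topspace ?T)"
  then obtain b where b: "\<And>x. x \<in> topspace ?T \<Longrightarrow> \<bar>F x\<bar> \<le> b"
    by (auto simp: bounded_iff)
  define f where "f y = nat \<lfloor>y\<rfloor>" for y :: real
  have f [measurable]: "f \<in> borel \<rightarrow>\<^sub>M count_space UNIV" unfolding f_def by measurable
  have fk: "f (of_nat k) = k" for k by (simp add: f_def)
  have feq: "{y. y = of_nat (f y)} \<in> sets borel" unfolding f_def by measurable
  \<comment> \<open>An integer-valued version of Z, almost surely equal to it, to which the discrete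
    limit applies.\<close>
  define K where "K r \<omega> = f (Z r \<omega>)" for r \<omega>
  have Km [measurable]: "K r \<in> P \<rightarrow>\<^sub>M count_space UNIV" if "r < m" for r
    unfolding K_def by (rule measurable_compose[OF Zm[OF that] f])
  define G where "G xs = F (\<lambda>r\<in>{..<m}. real (xs ! r))" for xs
  have "(\<lambda>n. \<integral>\<omega>. G (map (\<lambda>r. exceedance_count n (C n \<omega>) (B r)) [0..<m]) \<partial>M n) \<longlonglongrightarrow>
    (\<integral>\<omega>. G (map (\<lambda>r. K r \<omega>) [0..<m]) \<partial>P)"
  proof (rule exceedance_counts_tendsto[OF U B disj P Km])
    show "measure P {\<omega> \<in> space P. \<forall>r<m. K r \<omega> = k r} = (\<Prod>r<m. pmf (poisson_law (measure intensity (B r))) (k r))" for k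
      unfolding K_def by (rule poisson_joint_round[OF P Z ind f fk feq])
    show "\<bar>G xs\<bar> \<le> b" for xs unfolding G_def by (rule b) auto
  qed
  moreover have "G (map (\<lambda>r. X r) [0..<m]) = F (\<lambda>r\<in>{..<m}. real (X r))" for X :: "nat \<Rightarrow> nat"
    unfolding G_def by (intro arg_cong[of _ _ F]) auto
  moreover have "(\<integral>\<omega>. F (\<lambda>r\<in>{..<m}. real (K r \<omega>)) \<partial>P) = (\<integral>\<omega>. F (\<lambda>r\<in>{..<m}. Z r \<omega>) \<partial>P)"
  proof (rule integral_cong_AE)
    have Fm: "F \<in> borel_measurable (borel_of ?T)" using F by (intro borel_measurable_continuous_map) auto
    show "(\<lambda>\<omega>. F (\<lambda>r\<in>{..<m}. Z r \<omega>)) \<in> borel_measurable P"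
      by (rule measurable_compose[OF Zt Fm])
    show "(\<lambda>\<omega>. F (\<lambda>r\<in>{..<m}. real (K r \<omega>))) \<in> borel_measurable P"
      by (rule measurable_compose[OF measurable_finite_product_topology Fm])
        (rule measurable_compose[OF Km], auto)
    have "AE \<omega> in P. \<forall>r\<in>{..<m}. Z r \<omega> = of_nat (f (Z r \<omega>))"
      using poisson_distributed_round(1)[OF Z f fk feq] by (intro AE_finite_allI) auto
    then show "AE \<omega> in P. F (\<lambda>r\<in>{..<m}. real (K r \<omega>)) = F (\<lambda>r\<in>{..<m}. Z r \<omega>)"
    proof eventually_elim
      case (elim \<omega>)
      then have "(\<lambda>r\<in>{..<m}. real (K r \<omega>)) = (\<lambda>r\<in>{..<m}. Z r \<omega>)" by (auto simp: K_def)
      then show ?case by (simp only:)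
    qed
  qed
  ultimately show "(\<lambda>n. \<integral>\<omega>. F (\<lambda>r\<in>{..<m}. real (exceedance_count n (C n \<omega>) (B r))) \<partial>M n)
      \<longlonglongrightarrow> (\<integral>\<omega>. F (\<lambda>r\<in>{..<m}. Z r \<omega>) \<partial>P)"
    by simp
qed

section \<open>Discretisation in the vague topology\<close>

text \<open>The topology is given by a subbase, so the claim follows open sets through finite
  intersections and arbitrary unions.\<close>

lemma vague_tendsto_openin:
  assumes \<nu>: "\<And>i. \<nu> i \<in> radon_measures" and lim: "\<And>f. f \<in> vague_test_functions \<Longrightarrow> (\<lambda>i. \<integral>x. f x \<partial>\<nu> i) \<longlonglongrightarrow> (\<integral>x. f x \<partial>\<rho>)"
    and U: "openin vague_topology U" "\<rho> \<in> U"
  shows "eventually (\<lambda>i. \<nu> i \<in> U) sequentially"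
proof -
  have "generate_topology_on {{\<nu> \<in> radon_measures. (\<integral>x. f x \<partial>\<nu>) \<in> S} | f S. f \<in> vague_test_functions \<and> open S} U"
    using U(1) unfolding vague_topology_def openin_topology_generated_by_iff .
  then show ?thesis using U(2)
  proof induction
    case Empty
    then show ?case by simp
  next
    case (Int a b)
    then show ?case by (auto intro: eventually_conj)
  next
    case (UN K)
    then obtain k where k: "k \<in> K" "\<rho> \<in> k" by auto
    from UN.IH[OF this] show ?case by (rule eventually_mono) (use k in auto)
  next
    case (Basis s)
    then obtain f S where fS: "s = {\<nu> \<in> radon_measures. (\<integral>x. f x \<partial>\<nu>) \<in> S}" "f \<in> vague_test_functions" "open S"
      by auto
    then have "eventually (\<lambda>i. (\<integral>x. f x \<partial>\<nu> i) \<in> S) sequentially"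
      using topological_tendstoD[OF lim] Basis by auto
    then show ?case by (rule eventually_mono) (use fS \<nu> in auto)
  qed
qed

text \<open>In the limit arguments, continuity of a functional enters only in this sequential
  form.\<close>

lemma continuous_map_vague_sequentially:
  assumes F: "continuous_map vague_topology euclideanreal F"
    and \<nu>: "\<And>i. \<nu> i \<in> radon_measures" and \<rho>: "\<rho> \<in> radon_measures"
    and lim: "\<And>f. f \<in> vague_test_functions \<Longrightarrow> (\<lambda>i. \<integral>x. f x \<partial>\<nu> i) \<longlonglongrightarrow> (\<integral>x. f x \<partial>\<rho>)"
  shows "(\<lambda>i. F (\<nu> i)) \<longlonglongrightarrow> F \<rho>"
proof (rule topological_tendstoI)
  fix S :: "real set" assume S: "open S" "F \<rho> \<in> S"
  have "openin vague_topology {\<mu> \<in> radon_measures. F \<mu> \<in> S}"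
    using openin_continuous_map_preimage[OF F, of S] S by (simp add: topspace_vague_topology)
  from vague_tendsto_openin[OF \<nu> lim this] show "eventually (\<lambda>i. F (\<nu> i) \<in> S) sequentially"
    using S \<rho> by (auto elim: eventually_mono)
qed

text \<open>The line is closed off at plus infinity, so compactness only forces a distance from
  minus infinity. Integer levels -J serve as the exhausting sequence from here on.\<close>

lemma compact_right_line_bound:
  assumes "compact K" "K \<subseteq> right_line"
  shows "\<exists>J::nat. \<forall>y\<in>K. ereal (- real J) < y"
proof (cases "K = {}")
  case False
  then obtain a where a: "a \<in> K" "\<And>y. y \<in> K \<Longrightarrow> a \<le> y"
    using compact_attains_inf[OF assms(1)] by auto
  then have "-\<infinity> < a" using assms(2) by auto
  then obtain r where r: "ereal r < a" using ereal_dense2 by blast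
  define J where "J = nat \<lceil>- r\<rceil>"
  have "- real J \<le> r" unfolding J_def by linarith
  then have "ereal (- real J) < a" using r by (meson ereal_less_eq(3) le_less_trans)
  then show ?thesis using a by (intro exI[of _ J]) (auto intro: less_le_trans)
qed auto

text \<open>The value at \<open>-\<infinity>\<close> is the limit there, so that \<open>extend_test f\<close> is continuous on all of \<open>ereal\<close>.\<close>

definition extend_test :: "(ereal \<Rightarrow> real) \<Rightarrow> ereal \<Rightarrow> real" where
  "extend_test f y = (if y = -\<infinity> then 0 else f y)"

lemma extend_test_vanishes:
  assumes "f \<in> vague_test_functions"
  shows "\<exists>J::nat. \<forall>y. y \<le> ereal (- real J) \<longrightarrow> extend_test f y = 0"
proof -
  obtain K where K: "compact K" "K \<subseteq> right_line" "\<And>x. x \<in> right_line - K \<Longrightarrow> f x = 0"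
    using assms by (auto simp: vague_test_functions_def)
  obtain J where "\<forall>y\<in>K. ereal (- real J) < y" using compact_right_line_bound[OF K(1,2)] by auto
  then show ?thesis using K(3) by (intro exI[of _ J]) (force simp: extend_test_def)
qed

lemma extend_test_continuous:
  assumes f: "f \<in> vague_test_functions" and y: "(y \<longlongrightarrow> l) G"
  shows "((\<lambda>i. extend_test f (y i)) \<longlongrightarrow> extend_test f l) G"
proof (cases "l = -\<infinity>")
  case True
  obtain J where J: "\<And>y. y \<le> ereal (- real J) \<Longrightarrow> extend_test f y = 0"
    using extend_test_vanishes[OF f] by blast
  have "eventually (\<lambda>i. y i < ereal (- real J)) G"
    using order_tendstoD(2)[OF y, of "ereal (- real J)"] True by simp
  then have "eventually (\<lambda>i. extend_test f (y i) = 0) G"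
    by (rule eventually_mono) (simp add: J)
  then show ?thesis using True by (simp add: extend_test_def tendsto_eventually)
next
  case False
  have "continuous_on right_line f" using f by (simp add: vague_test_functions_def)
  moreover have "l \<in> right_line" using False by (cases l) auto
  ultimately have "isCont f l" by (simp add: continuous_on_eq_continuous_at)
  then have "((\<lambda>i. f (y i)) \<longlongrightarrow> f l) G" using y by (rule isCont_tendsto_compose)
  moreover have "eventually (\<lambda>i. -\<infinity> < y i) G"
    using order_tendstoD(1)[OF y, of "-\<infinity>"] False by simp
  then have "eventually (\<lambda>i. f (y i) = extend_test f (y i)) G"
    by (rule eventually_mono) (auto simp: extend_test_def)
  ultimately show ?thesis using False by (simp add: extend_test_def Lim_transform_eventually)
qed

lemma vague_test_function_borel:
  assumes "f \<in> vague_test_functions"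
  shows "f \<in> borel_measurable right_borel"
  using assms by (auto simp: vague_test_functions_def intro: borel_measurable_continuous_on_restrict)

lemma extend_test_borel:
  assumes f: "f \<in> vague_test_functions"
  shows "extend_test f \<in> borel_measurable borel"
proof (rule borel_measurable_continuous_onI)
  show "continuous_on UNIV (extend_test f)"
    unfolding continuous_on_def using extend_test_continuous[OF f] by (auto intro: tendsto_ident_at)
qed

lemma extend_test_bounded:
  assumes f: "f \<in> vague_test_functions"
  obtains b where "\<And>y. \<bar>extend_test f y\<bar> \<le> b"
proof -
  have "continuous_on UNIV (extend_test f)"
    unfolding continuous_on_def using extend_test_continuous[OF f] by (auto intro: tendsto_ident_at)
  then have "compact (extend_test f ` UNIV)" by (rule compact_continuous_image) (rule compact_UNIV)
  then have "bounded (range (extend_test f))" by (rule compact_imp_bounded)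
  then show thesis using that by (auto simp: bounded_iff)
qed

section \<open>Rounding to a finite grid\<close>

text \<open>Rounds up with mesh 1/(k+1) on the window from -(k+1) to k+1; points above it move to
  infinity, points below it to minus infinity, where test functions do not see them. Rounding
  upwards keeps a point at or below an integer level -J there, as that level is a grid value or lies
  below the window.\<close>

definition ereal_round :: "nat \<Rightarrow> ereal \<Rightarrow> ereal" where
  "ereal_round k y =
    (if y \<le> ereal (- real (Suc k)) then -\<infinity> else if ereal (real (Suc k)) < y then \<infinity>
     else ereal (of_int \<lceil>real (Suc k) * real_of_ereal y\<rceil> / real (Suc k)))"

text \<open>The window has 2(k+1)^2 + 1 grid values, both ends included; the one further index, the
  last, stands for infinity.\<close>

definition grid_size :: "nat \<Rightarrow> nat" where
  "grid_size k = 2 * (Suc k)\<^sup>2 + 2"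

definition grid :: "nat \<Rightarrow> nat \<Rightarrow> ereal" where
  "grid k j = (if j = 2 * (Suc k)\<^sup>2 + 1 then \<infinity> else ereal ((real j - (real (Suc k))\<^sup>2) / real (Suc k)))"

text \<open>Points rounded to minus infinity lie in no cell.\<close>

definition grid_cell :: "nat \<Rightarrow> nat \<Rightarrow> ereal set" where
  "grid_cell k j = {y. ereal_round k y = grid k j}"

lemma ereal_round_borel [measurable]: "ereal_round k \<in> borel_measurable borel"
  unfolding ereal_round_def[abs_def] by measurable

lemma grid_neq_minus_infinity: "grid k j \<noteq> -\<infinity>"
  by (simp add: grid_def)

lemma inj_grid: "inj (grid k)"
  by (auto simp: inj_def grid_def split: if_splits)

lemma ereal_round_cases: "ereal_round k y = -\<infinity> \<or> (\<exists>j<grid_size k. ereal_round k y = grid k j)"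
proof (cases "y \<le> ereal (- real (Suc k)) \<or> ereal (real (Suc k)) < y")
  case True
  then consider "y \<le> ereal (- real (Suc k))" | "\<not> y \<le> ereal (- real (Suc k))" "ereal (real (Suc k)) < y" by blast
  then show ?thesis
  proof cases
    case 2
    then show ?thesis
      by (intro disjI2 exI[of _ "2 * (Suc k)\<^sup>2 + 1"]) (simp add: ereal_round_def grid_size_def grid_def)
  qed (simp add: ereal_round_def)
next
  case False
  then obtain r where r: "y = ereal r" by (cases y) auto
  let ?K = "real (Suc k)"
  have b: "- ?K < r" "r \<le> ?K" using False r by auto
  define c where "c = \<lceil>?K * r\<rceil>"
  have "?K * (- ?K) < ?K * r" "?K * r \<le> ?K * ?K" using b by (auto intro!: mult_strict_left_mono mult_left_mono)
  then have c: "- (int (Suc k))\<^sup>2 \<le> c" "c \<le> (int (Suc k))\<^sup>2"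
    unfolding c_def by (auto simp: power2_eq_square le_ceiling_iff ceiling_le_iff simp del: of_nat_Suc)
  define j where "j = nat (c + (int (Suc k))\<^sup>2)"
  have j: "int j = c + (int (Suc k))\<^sup>2" using c by (simp add: j_def)
  have "int j \<le> int (2 * (Suc k)\<^sup>2)" using c unfolding j by simp
  then have jl: "j \<le> 2 * (Suc k)\<^sup>2" by linarith
  have "real j = real_of_int c + ?K\<^sup>2"
    using arg_cong[OF j, of real_of_int] by simp
  then have "ereal_round k y = grid k j"
    using False jl r by (simp add: ereal_round_def grid_def c_def)
  then show ?thesis using jl by (intro disjI2 exI[of _ j]) (simp add: grid_size_def)
qed

text \<open>After rounding, a test function is a step function over the cells, so its integral
  depends on the cell counts alone.\<close>

lemma extend_test_round:
  "extend_test f (ereal_round k y) = (\<Sum>j<grid_size k. f (grid k j) * indicator (grid_cell k j) y)"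
proof (cases "ereal_round k y = -\<infinity>")
  case True
  then have "(\<Sum>j<grid_size k. f (grid k j) * indicator (grid_cell k j) y) = 0"
    using grid_neq_minus_infinity[of k] by (intro sum.neutral ballI) (metis (mono_tags, lifting) True
        grid_cell_def indicator_simps(2) mem_Collect_eq mult_zero_right)
  then show ?thesis using True by (simp add: extend_test_def)
next
  case False
  then obtain j where j: "j < grid_size k" "ereal_round k y = grid k j" using ereal_round_cases by blast
  have "(\<Sum>i<grid_size k. f (grid k i) * indicator (grid_cell k i) y) = (\<Sum>i<grid_size k. if i = j then f (grid k j) else 0)"
    by (intro sum.cong) (auto simp: grid_cell_def indicator_def j inj_eq[OF inj_grid])
  then show ?thesis using j False by (simp add: extend_test_def)
qed

lemma ereal_round_gt_cell: "y \<in> grid_cell k j \<Longrightarrow> ereal (- real (Suc k)) < y"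
  using grid_neq_minus_infinity[of k j] by (auto simp: grid_cell_def ereal_round_def split: if_splits)

lemma grid_cell_borel [measurable]: "grid_cell k j \<in> sets borel"
  unfolding grid_cell_def by measurable

lemma grid_cell_right_borel: "grid_cell k j \<in> sets right_borel"
proof -
  have "grid_cell k j \<subseteq> right_line" using ereal_round_gt_cell by fastforce
  then show ?thesis by (simp add: sets_restrict_space_iff)
qed

lemma disjoint_grid_cell: "disjoint_family_on (grid_cell k) A"
  by (auto simp: disjoint_family_on_def grid_cell_def dest: injD[OF inj_grid])

text \<open>Ensures that points invisible to a test function stay invisible after rounding, whatever
  the mesh.\<close>

lemma ereal_round_le_neg:
  assumes "y \<le> ereal (- real J)"
  shows "ereal_round k y \<le> ereal (- real J)"
proof -
  consider "y \<le> ereal (- real (Suc k))" | r where "y = ereal r" "\<not> y \<le> ereal (- real (Suc k))"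
    using assms by (cases y) auto
  then show ?thesis
  proof cases
    case 2
    let ?K = "real (Suc k)"
    have "r \<le> - real J" using assms 2 by simp
    then have "\<not> ereal ?K < y" using 2 by simp
    moreover have "?K * r \<le> ?K * (- real J)" using assms 2 by (intro mult_left_mono) auto
    then have "\<lceil>?K * r\<rceil> \<le> - (int (Suc k) * int J)" by (subst ceiling_le_iff) simp
    then have "real_of_int \<lceil>?K * r\<rceil> \<le> - (?K * real J)"
      by (metis (no_types) of_int_le_iff of_int_minus of_int_mult of_int_of_nat_eq)
    then have "of_int \<lceil>?K * r\<rceil> / ?K \<le> - real J" by (simp add: field_simps)
    ultimately show ?thesis using 2 by (simp add: ereal_round_def)
  qed (simp add: ereal_round_def)
qed

lemma ereal_round_ge: "ereal (- real (Suc k)) < y \<Longrightarrow> y \<le> ereal_round k y"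
proof (cases "ereal (real (Suc k)) < y")
  case False
  assume y: "ereal (- real (Suc k)) < y"
  then obtain r where r: "y = ereal r" using False by (cases y) auto
  have "real (Suc k) * r \<le> of_int \<lceil>real (Suc k) * r\<rceil>" by (rule le_of_int_ceiling)
  then have "r \<le> of_int \<lceil>real (Suc k) * r\<rceil> / real (Suc k)" by (simp add: field_simps)
  then show ?thesis using y False r by (simp add: ereal_round_def)
qed (auto simp: ereal_round_def)

lemma ereal_round_le:
  assumes "y \<le> ereal r" "r \<le> real (Suc k)"
  shows "ereal_round k y \<le> ereal (r + 1 / real (Suc k))"
proof (cases "y \<le> ereal (- real (Suc k))")
  case False
  then obtain s where s: "y = ereal s" using assms by (cases y) auto
  have "of_int \<lceil>real (Suc k) * s\<rceil> \<le> real (Suc k) * s + 1" by (rule of_int_ceiling_le_add_one)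
  also have "\<dots> \<le> real (Suc k) * r + 1" using assms s by (simp add: mult_left_mono)
  finally have "of_int \<lceil>real (Suc k) * s\<rceil> / real (Suc k) \<le> (real (Suc k) * r + 1) / real (Suc k)"
    by (rule divide_right_mono) simp
  also have "\<dots> = r + 1 / real (Suc k)" by (simp add: add_divide_distrib del: of_nat_Suc)
  finally have "of_int \<lceil>real (Suc k) * s\<rceil> / real (Suc k) \<le> r + 1 / real (Suc k)" .
  then show ?thesis using False assms s by (auto simp: ereal_round_def)
qed (simp add: ereal_round_def)

text \<open>Mesh and argument vary together, as they do along the subsequence in the compactness
  argument; infinite limits are included.\<close>

lemma ereal_round_tendsto:
  assumes k: "filterlim k at_top G" and y: "(y \<longlongrightarrow> l) G"
  shows "((\<lambda>i. ereal_round (k i) (y i)) \<longlongrightarrow> l) G"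
proof (rule order_tendstoI)
  fix a assume a: "a < l"
  obtain r where r: "a < ereal r" "ereal r < l"
    using ereal_dense2[OF a] by blast
  have "eventually (\<lambda>i. nat \<lceil>- r\<rceil> \<le> k i) G" using k unfolding filterlim_at_top by blast
  moreover have "eventually (\<lambda>i. ereal r < y i) G" by (rule order_tendstoD(1)[OF y r(2)])
  ultimately show "eventually (\<lambda>i. a < ereal_round (k i) (y i)) G"
  proof eventually_elim
    case (elim i)
    have "- real (Suc (k i)) < r" using elim(1) by linarith
    then have "ereal (- real (Suc (k i))) < y i" using elim(2) by (meson ereal_less(1) less_ereal.simps(1) less_trans)
    from ereal_round_ge[OF this] elim(2) r(1) show ?case by order
  qed
next
  fix a assume a: "l < a"
  obtain s where s: "l < ereal s" "ereal s < a"
    using ereal_dense2[OF a] by blast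
  obtain r where r: "l < ereal r" "ereal r < ereal s"
    using ereal_dense2[OF s(1)] by blast
  have "((\<lambda>i. r + 1 / real (Suc (k i))) \<longlongrightarrow> r + 0) G"
    by (intro tendsto_intros filterlim_compose[OF LIMSEQ_Suc[OF lim_const_over_n] k, unfolded o_def])
  then have ev: "eventually (\<lambda>i. r + 1 / real (Suc (k i)) < s) G"
    using order_tendstoD(2) r(2) by fastforce
  have "eventually (\<lambda>i. nat \<lceil>r\<rceil> \<le> k i) G" using k unfolding filterlim_at_top by blast
  moreover have "eventually (\<lambda>i. y i < ereal r) G" by (rule order_tendstoD(2)[OF y r(1)])
  ultimately show "eventually (\<lambda>i. ereal_round (k i) (y i) < a) G"
    using ev
  proof eventually_elim
    case (elim i)
    have "r \<le> real (Suc (k i))" using elim(1) by linarith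
    from ereal_round_le[OF less_imp_le[OF elim(2)] this]
    have "ereal_round (k i) (y i) \<le> ereal (r + 1 / real (Suc (k i)))" .
    also have "\<dots> < ereal s" using elim(3) by simp
    finally show ?case using s(2) by order
  qed
qed

text \<open>Places the listed counts at the grid values. It is a finite measure for every list,
  whatever its length, so a bounded functional of it is bounded on all of
  \<open>nat list\<close>.\<close>

definition grid_measure :: "nat \<Rightarrow> nat list \<Rightarrow> ereal measure" where
  "grid_measure k c = distr (point_measure {..<grid_size k} (\<lambda>j. ennreal (real (c ! j)))) right_borel (grid k)"

lemma grid_measurable: "grid k \<in> point_measure A h \<rightarrow>\<^sub>M right_borel"
  using grid_neq_minus_infinity[of k]
  by (auto simp: measurable_def space_point_measure sets_point_measure space_restrict_space)

lemma grid_measure_radon: "grid_measure k c \<in> radon_measures"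
proof -
  let ?P = "point_measure {..<grid_size k} (\<lambda>j. ennreal (real (c ! j)))"
  have "finite_measure ?P"
    by (rule finite_measureI) (simp add: space_point_measure emeasure_point_measure_finite)
  then have "finite_measure (grid_measure k c)"
    unfolding grid_measure_def by (rule finite_measure.finite_measure_distr[OF _ grid_measurable])
  then have "emeasure (grid_measure k c) K < \<infinity>" for K
    using finite_measure.emeasure_finite[of "grid_measure k c" K] by (simp add: top.not_eq_extremum)
  then show ?thesis by (simp add: radon_measures_def grid_measure_def)
qed

lemma integral_grid_measure:
  assumes f: "f \<in> vague_test_functions"
  shows "(\<integral>x. f x \<partial>grid_measure k c) = (\<Sum>j<grid_size k. real (c ! j) * f (grid k j))"
  unfolding grid_measure_def
  by (subst integral_distr[OF grid_measurable vague_test_function_borel[OF f]])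
    (simp add: lebesgue_integral_point_measure_finite)

lemma points_measurable: "(\<lambda>p. ereal (y p)) \<in> count_space I \<rightarrow>\<^sub>M right_borel"
  by (auto simp: space_restrict_space)

lemma
  assumes I: "finite I"
  shows points_radon: "distr (count_space I) right_borel (\<lambda>p. ereal (y p)) \<in> radon_measures"
    and integral_points: "f \<in> vague_test_functions \<Longrightarrow>
      (\<integral>x. f x \<partial>distr (count_space I) right_borel (\<lambda>p. ereal (y p))) = (\<Sum>p\<in>I. f (ereal (y p)))"
proof -
  let ?D = "distr (count_space I) right_borel (\<lambda>p. ereal (y p))"
  have "finite_measure ?D"
    by (rule finite_measure.finite_measure_distr[OF finite_measure_count_space[OF I] points_measurable])
  then have "emeasure ?D K < \<infinity>" for K
    using finite_measure.emeasure_finite[of ?D K] by (simp add: top.not_eq_extremum)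
  then show "?D \<in> radon_measures" by (simp add: radon_measures_def)
  show "(\<integral>x. f x \<partial>?D) = (\<Sum>p\<in>I. f (ereal (y p)))" if "f \<in> vague_test_functions"
    by (subst integral_distr[OF points_measurable vague_test_function_borel[OF that]])
      (simp add: lebesgue_integral_count_space_finite I)
qed

section \<open>Compactness of point configurations\<close>

text \<open>Configurations of different sizes become points of one space of sequences: the points
  are sorted downwards and padded with minus infinity. A bound on the number of points above a level
  then bounds the tail of the sequence.\<close>

lemma decreasing_enumeration:
  fixes y :: "'i \<Rightarrow> real"
  assumes "finite I"
  shows "\<exists>z::nat \<Rightarrow> ereal.
    (\<forall>(h :: ereal \<Rightarrow> real) N. h (-\<infinity>) = 0 \<longrightarrow> (\<forall>l\<ge>N. h (z l) = 0) \<longrightarrow> (\<Sum>p\<in>I. h (ereal (y p))) = (\<Sum>l<N. h (z l))) \<and>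
    (\<forall>a l. card {p \<in> I. a \<le> y p} \<le> l \<longrightarrow> z l < ereal a)"
proof -
  obtain ps where ps: "set ps = I" "distinct ps" using finite_distinct_list[OF assms] by auto
  define xs where "xs = sort_key (\<lambda>p. - y p) ps"
  have xs: "set xs = I" "distinct xs" "sorted (map (\<lambda>p. - y p) xs)"
    using ps by (simp_all add: xs_def)
  define z where "z l = (if l < length xs then ereal (y (xs ! l)) else -\<infinity>)" for l
  show ?thesis
  proof (intro exI[of _ z] conjI allI impI)
    fix h :: "ereal \<Rightarrow> real" and N assume h: "h (-\<infinity>) = 0" "\<forall>l\<ge>N. h (z l) = 0"
    have "(\<Sum>p\<in>I. h (ereal (y p))) = (\<Sum>l<length xs. h (ereal (y (xs ! l))))"
      by (rule sum.reindex_bij_betw[symmetric]) (rule bij_betw_nth[OF xs(2) refl xs(1)[symmetric]])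
    also have "\<dots> = (\<Sum>l<length xs. h (z l))" by (simp add: z_def)
    also have "\<dots> = (\<Sum>l<max N (length xs). h (z l))"
      by (rule sum.mono_neutral_left) (auto simp: z_def h)
    also have "\<dots> = (\<Sum>l<N. h (z l))"
      by (rule sum.mono_neutral_right) (auto simp: h)
    finally show "(\<Sum>p\<in>I. h (ereal (y p))) = (\<Sum>l<N. h (z l))" .
  next
    fix a l assume card: "card {p \<in> I. a \<le> y p} \<le> l"
    show "z l < ereal a"
    proof (rule ccontr)
      assume "\<not> z l < ereal a"
      then have l: "l < length xs" "a \<le> y (xs ! l)" by (auto simp: z_def split: if_splits)
      \<comment> \<open>If the entry with index l were at least a, so would be the l + 1 entries
        with indices 0 to l, one more than the bound allows.\<close>
      have "(\<lambda>i. xs ! i) ` {..l} \<subseteq> {p \<in> I. a \<le> y p}"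
      proof
        fix p assume "p \<in> (\<lambda>i. xs ! i) ` {..l}"
        then obtain i where i: "i \<le> l" "p = xs ! i" by auto
        then have "- y (xs ! i) \<le> - y (xs ! l)"
          using sorted_nth_mono[OF xs(3), of i l] l by simp
        then show "p \<in> {p \<in> I. a \<le> y p}" using i l xs(1) nth_mem[of i xs] by auto
      qed
      then have "card ((\<lambda>i. xs ! i) ` {..l}) \<le> card {p \<in> I. a \<le> y p}"
        using assms by (intro card_mono) auto
      moreover have "inj_on (\<lambda>i. xs ! i) {..l}"
        using xs(2) l by (auto simp: inj_on_def nth_eq_iff_index_eq)
      ultimately show False using card by (simp add: card_image)
    qed
  qed
qed

text \<open>The measure belonging to a limit sequence. Entries equal to minus infinity are
  discarded. Infinitely many points may remain, but only finitely many above each level, so the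
  measure is Radon and test integrals are finite sums.\<close>

lemma
  fixes w :: "nat \<Rightarrow> ereal"
  defines "\<nu> \<equiv> distr (count_space {l. w l \<noteq> -\<infinity>}) right_borel w"
  assumes w: "\<And>j l. c j \<le> l \<Longrightarrow> w l \<le> ereal (- real j)"
  shows sequence_measure_radon: "\<nu> \<in> radon_measures"
    and integral_sequence_measure: "\<lbrakk>f \<in> vague_test_functions; \<And>y. y \<le> ereal (- real J) \<Longrightarrow> extend_test f y = 0\<rbrakk> \<Longrightarrow>
      (\<integral>x. f x \<partial>\<nu>) = (\<Sum>l<c J. extend_test f (w l))"
proof -
  let ?L = "{l. w l \<noteq> -\<infinity>}"
  have wm: "w \<in> count_space ?L \<rightarrow>\<^sub>M right_borel" by (auto simp: space_restrict_space)
  have "emeasure \<nu> K < \<infinity>" if K: "compact K" "K \<subseteq> right_line" for K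
  proof -
    obtain J where J: "\<forall>y\<in>K. ereal (- real J) < y" using compact_right_line_bound[OF K] by auto
    have "K \<in> sets right_borel"
      using K borel_closed[OF compact_imp_closed[OF K(1)]] by (simp add: sets_restrict_space_iff)
    then have "emeasure \<nu> K = emeasure (count_space ?L) (w -` K \<inter> ?L)"
      unfolding \<nu>_def by (subst emeasure_distr[OF wm]) auto
    moreover have "w -` K \<inter> ?L \<subseteq> {..<c J}"
    proof
      fix l assume "l \<in> w -` K \<inter> ?L"
      then have "ereal (- real J) < w l" using J by auto
      then show "l \<in> {..<c J}" using w[of J l] by (cases "c J \<le> l") auto
    qed
    then have "finite (w -` K \<inter> ?L)" by (rule finite_subset) simp
    ultimately show ?thesis by (simp add: emeasure_count_space_finite of_nat_less_top)
  qed
  then show "\<nu> \<in> radon_measures" by (simp add: radon_measures_def \<nu>_def)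
  assume f: "f \<in> vague_test_functions" and J: "\<And>y. y \<le> ereal (- real J) \<Longrightarrow> extend_test f y = 0"
  have z: "extend_test f (w l) = 0" if "c J \<le> l" for l using J w that by blast
  have sub: "{l. l \<in> ?L \<and> f (w l) \<noteq> 0} \<subseteq> {..<c J}"
  proof
    fix l assume l: "l \<in> {l. l \<in> ?L \<and> f (w l) \<noteq> 0}"
    then show "l \<in> {..<c J}" using z[of l] by (cases "c J \<le> l") (auto simp: extend_test_def)
  qed
  then have fin: "finite {l. l \<in> ?L \<and> f (w l) \<noteq> 0}" by (rule finite_subset) simp
  have "(\<integral>x. f x \<partial>\<nu>) = (\<integral>l. f (w l) \<partial>count_space ?L)"
    unfolding \<nu>_def by (rule integral_distr[OF wm vague_test_function_borel[OF f]])
  also have "\<dots> = (\<Sum>l | l \<in> ?L \<and> f (w l) \<noteq> 0. f (w l))"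
    by (rule lebesgue_integral_count_space_finite_support[OF fin])
  also have "\<dots> = (\<Sum>l<c J. extend_test f (w l))"
    by (rule sum.mono_neutral_cong_left) (use sub in \<open>auto simp: extend_test_def\<close>)
  finally show "(\<integral>x. f x \<partial>\<nu>) = (\<Sum>l<c J. extend_test f (w l))" .
qed

lemma integral_grid_measure_points:
  assumes f: "f \<in> vague_test_functions" and I: "finite I"
  shows "(\<integral>x. f x \<partial>grid_measure k (map (\<lambda>j. card {p \<in> I. ereal (y p) \<in> grid_cell k j}) [0..<grid_size k])) =
    (\<Sum>p\<in>I. extend_test f (ereal_round k (ereal (y p))))"
proof -
  have "(\<integral>x. f x \<partial>grid_measure k (map (\<lambda>j. card {p \<in> I. ereal (y p) \<in> grid_cell k j}) [0..<grid_size k])) =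
      (\<Sum>j<grid_size k. real (card {p \<in> I. ereal (y p) \<in> grid_cell k j}) * f (grid k j))"
    by (subst integral_grid_measure[OF f]) simp
  also have "\<dots> = (\<Sum>j<grid_size k. \<Sum>p\<in>I. f (grid k j) * indicator (grid_cell k j) (ereal (y p)))"
    using I by (intro sum.cong refl)
      (simp add: sum_distrib_left[symmetric] indicator_def sum.If_cases Int_def conj_commute mult.commute)
  also have "\<dots> = (\<Sum>p\<in>I. extend_test f (ereal_round k (ereal (y p))))"
    unfolding extend_test_round by (rule sum.swap)
  finally show ?thesis .
qed

text \<open>Configurations with at most \<open>c j\<close> points above \<open>-j\<close> for every \<open>j\<close>, listed in decreasing order,
  form a relatively compact family, because sequences in the compact space \<open>ereal\<close> have pointwise
  convergent subsequences; on it the discretisation is uniformly harmless.\<close>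

lemma grid_measure_uniform_approximation:
  fixes F :: "ereal measure \<Rightarrow> real" and c :: "nat \<Rightarrow> nat"
  assumes F: "continuous_map vague_topology euclideanreal F" and e: "0 < e"
  shows "\<exists>k0. \<forall>k\<ge>k0. \<forall>(I :: 'i set) y. finite I \<longrightarrow> (\<forall>j. card {p \<in> I. - real j \<le> y p} \<le> c j) \<longrightarrow>
    \<bar>F (grid_measure k (map (\<lambda>j. card {p \<in> I. ereal (y p) \<in> grid_cell k j}) [0..<grid_size k]))
      - F (distr (count_space I) right_borel (\<lambda>p. ereal (y p)))\<bar> < e"
proof (rule ccontr)
  let ?g = "\<lambda>k (I :: 'i set) y. grid_measure k (map (\<lambda>j. card {p \<in> I. ereal (y p) \<in> grid_cell k j}) [0..<grid_size k])"
  let ?d = "\<lambda>(I :: 'i set) y. distr (count_space I) right_borel (\<lambda>p. ereal (y p))"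
  assume neg: "\<not> ?thesis"
  \<comment> \<open>A counterexample is chosen for each threshold \<open>k0\<close> = i; a
    convergent subsequence of their enumerations then leads to the contradiction.\<close>
  define P where "P k0 k I y \<longleftrightarrow> k0 \<le> k \<and> finite I \<and> (\<forall>j. card {p \<in> I. - real j \<le> y p} \<le> c j) \<and>
      e \<le> \<bar>F (?g k I y) - F (?d I y)\<bar>" for k0 k and I :: "'i set" and y
  have "\<forall>k0. \<exists>k I y. P k0 k I y"
    using neg by (simp add: P_def not_less)
  then have "\<exists>\<kappa> I y. \<forall>i. P i (\<kappa> i) (I i) (y i)"
    by (simp only: choice_iff)
  then obtain \<kappa> I y where P: "\<And>i. P i (\<kappa> i) (I i) (y i)" by blast
  have bad: "i \<le> \<kappa> i" "finite (I i)"
      "card {p \<in> I i. - real j \<le> y i p} \<le> c j" "e \<le> \<bar>F (?g (\<kappa> i) (I i) (y i)) - F (?d (I i) (y i))\<bar>" for i j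
    using P[of i] by (simp_all add: P_def)
  have "\<forall>i. \<exists>z::nat \<Rightarrow> ereal.
    (\<forall>(h :: ereal \<Rightarrow> real) N. h (-\<infinity>) = 0 \<longrightarrow> (\<forall>l\<ge>N. h (z l) = 0) \<longrightarrow> (\<Sum>p\<in>I i. h (ereal (y i p))) = (\<Sum>l<N. h (z l))) \<and>
    (\<forall>a l. card {p \<in> I i. a \<le> y i p} \<le> l \<longrightarrow> z l < ereal a)"
    using decreasing_enumeration[OF bad(2)] by blast
  from choice[OF this] obtain z :: "nat \<Rightarrow> nat \<Rightarrow> ereal" where
    z_sum: "\<And>i (h :: ereal \<Rightarrow> real) N. h (-\<infinity>) = 0 \<Longrightarrow> (\<And>l. N \<le> l \<Longrightarrow> h (z i l) = 0) \<Longrightarrow>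
        (\<Sum>p\<in>I i. h (ereal (y i p))) = (\<Sum>l<N. h (z i l))"
    and z_le: "\<And>i a l. card {p \<in> I i. a \<le> y i p} \<le> l \<Longrightarrow> z i l < ereal a"
    by metis
  have z_c: "z i l < ereal (- real j)" if "c j \<le> l" for i j l
    by (rule z_le) (use bad(3)[of i j] that in simp)
  \<comment> \<open>Tychonoff's theorem; for sequences in \<open>ereal\<close> this yields
    sequential compactness.\<close>
  have "compact (UNIV :: (nat \<Rightarrow> ereal) set)"
  proof -
    have "compact_space (euclidean :: ereal topology)"
      by (simp add: compact_space_def compact_UNIV)
    then have "compact_space (product_topology (\<lambda>_::nat. euclidean :: ereal topology) UNIV)"
      by (simp add: compact_space_product_topology)
    then show ?thesis unfolding euclidean_product_topology compact_space_def by simp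
  qed
  then have "seq_compact (UNIV :: (nat \<Rightarrow> ereal) set)" by (rule compact_imp_seq_compact)
  then obtain w r where r: "strict_mono r" "(z \<circ> r) \<longlonglongrightarrow> w"
    unfolding seq_compact_def by (metis UNIV_I)
  have lim: "(\<lambda>i. z (r i) l) \<longlonglongrightarrow> w l" for l
  proof (rule topological_tendstoI)
    fix S :: "ereal set" assume S: "open S" "w l \<in> S"
    have "open ((\<lambda>x::nat \<Rightarrow> ereal. x l) -` S)"
      by (rule open_vimage[OF S(1) continuous_on_product_coordinates])
    from topological_tendstoD[OF r(2) this] S(2)
    show "eventually (\<lambda>i. z (r i) l \<in> S) sequentially" by simp
  qed
  \<comment> \<open>The strict inequality for the enumerations weakens to a non-strict one in the
    limit, which is the form assumed for sequence measures.\<close>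
  have w: "w l \<le> ereal (- real j)" if "c j \<le> l" for j l
    by (rule tendsto_upperbound[OF lim]) (simp_all add: less_imp_le[OF z_c[OF that]])
  have kr: "filterlim (\<lambda>i. \<kappa> (r i)) at_top sequentially"
    by (rule filterlim_at_top_mono[OF filterlim_subseq[OF r(1)]]) (simp add: bad(1))
  define \<nu> where "\<nu> = distr (count_space {l. w l \<noteq> -\<infinity>}) right_borel w"
  have \<nu>: "\<nu> \<in> radon_measures" unfolding \<nu>_def by (rule sequence_measure_radon[OF w])
  have 1: "(\<lambda>i. F (?d (I (r i)) (y (r i)))) \<longlonglongrightarrow> F \<nu>"
  proof (rule continuous_map_vague_sequentially[OF F points_radon[OF bad(2)] \<nu>])
    fix f assume f: "f \<in> vague_test_functions"
    obtain J where J: "\<And>y. y \<le> ereal (- real J) \<Longrightarrow> extend_test f y = 0"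
      using extend_test_vanishes[OF f] by blast
    have "(\<integral>x. f x \<partial>?d (I i) (y i)) = (\<Sum>l<c J. extend_test f (z i l))" for i
    proof -
      have "(\<integral>x. f x \<partial>?d (I i) (y i)) = (\<Sum>p\<in>I i. extend_test f (ereal (y i p)))"
        by (simp add: integral_points[OF bad(2) f] extend_test_def)
      also have "\<dots> = (\<Sum>l<c J. extend_test f (z i l))"
      proof (rule z_sum)
        show "extend_test f (-\<infinity>) = 0" by (simp add: extend_test_def)
        show "extend_test f (z i l) = 0" if "c J \<le> l" for l
          by (rule J[OF less_imp_le[OF z_c[OF that]]])
      qed
      finally show ?thesis .
    qed
    moreover have "(\<integral>x. f x \<partial>\<nu>) = (\<Sum>l<c J. extend_test f (w l))"
      unfolding \<nu>_def by (rule integral_sequence_measure[OF w f J])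
    ultimately show "(\<lambda>i. \<integral>x. f x \<partial>?d (I (r i)) (y (r i))) \<longlonglongrightarrow> (\<integral>x. f x \<partial>\<nu>)"
      by (simp only:) (intro tendsto_sum extend_test_continuous[OF f] lim)
  qed
  have 2: "(\<lambda>i. F (?g (\<kappa> (r i)) (I (r i)) (y (r i)))) \<longlonglongrightarrow> F \<nu>"
  proof (rule continuous_map_vague_sequentially[OF F grid_measure_radon \<nu>])
    fix f assume f: "f \<in> vague_test_functions"
    obtain J where J: "\<And>y. y \<le> ereal (- real J) \<Longrightarrow> extend_test f y = 0"
      using extend_test_vanishes[OF f] by blast
    have "(\<integral>x. f x \<partial>?g k (I i) (y i)) = (\<Sum>l<c J. extend_test f (ereal_round k (z i l)))" for i k
      unfolding integral_grid_measure_points[OF f bad(2)]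
    proof (rule z_sum[where h = "\<lambda>y. extend_test f (ereal_round k y)"])
      show "extend_test f (ereal_round k (-\<infinity>)) = 0" by (simp add: ereal_round_def extend_test_def)
      show "extend_test f (ereal_round k (z i l)) = 0" if "c J \<le> l" for l
        by (rule J[OF ereal_round_le_neg[OF less_imp_le[OF z_c[OF that]]]])
    qed
    moreover have "(\<integral>x. f x \<partial>\<nu>) = (\<Sum>l<c J. extend_test f (w l))"
      unfolding \<nu>_def by (rule integral_sequence_measure[OF w f J])
    ultimately show "(\<lambda>i. \<integral>x. f x \<partial>?g (\<kappa> (r i)) (I (r i)) (y (r i))) \<longlonglongrightarrow> (\<integral>x. f x \<partial>\<nu>)"
      by (simp only:) (intro tendsto_sum extend_test_continuous[OF f] ereal_round_tendsto[OF kr] lim)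
  qed
  \<comment> \<open>Original and rounded configurations share the limit measure, whereas their
    values under F stay at least e apart.\<close>
  have "(\<lambda>i. \<bar>F (?g (\<kappa> (r i)) (I (r i)) (y (r i))) - F (?d (I (r i)) (y (r i)))\<bar>) \<longlonglongrightarrow> \<bar>F \<nu> - F \<nu>\<bar>"
    by (intro tendsto_intros 1 2)
  from tendsto_lowerbound[OF this, of e] bad(4) e show False by simp
qed

text \<open>The refinement of the grid for one fixed measure, by dominated convergence. It is meant
  for the realisations of the limit process, whose cell counts are almost surely finite
  integers.\<close>

lemma grid_measure_tendsto:
  fixes F :: "ereal measure \<Rightarrow> real"
  assumes F: "continuous_map vague_topology euclideanreal F" and \<nu>: "\<nu> \<in> radon_measures"
    and c: "\<And>k j. j < grid_size k \<Longrightarrow> emeasure \<nu> (grid_cell k j) = of_nat (c k j)"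
  shows "(\<lambda>k. F (grid_measure k (map (c k) [0..<grid_size k]))) \<longlonglongrightarrow> F \<nu>"
proof (rule continuous_map_vague_sequentially[OF F grid_measure_radon \<nu>])
  fix f assume f: "f \<in> vague_test_functions"
  obtain J where J: "\<And>y. y \<le> ereal (- real J) \<Longrightarrow> extend_test f y = 0"
    using extend_test_vanishes[OF f] by blast
  obtain b where b: "\<And>y. \<bar>extend_test f y\<bar> \<le> b" using extend_test_bounded[OF f] by blast
  have sets: "sets \<nu> = sets right_borel" and fin: "\<And>K. compact K \<Longrightarrow> K \<subseteq> right_line \<Longrightarrow> emeasure \<nu> K < \<infinity>"
    using \<nu> by (auto simp: radon_measures_def)
  have sp: "space \<nu> = right_line" using sets_eq_imp_space_eq[OF sets] by (simp add: space_restrict_space)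
  have meas: "h \<in> borel_measurable \<nu>" if "h \<in> borel_measurable borel" for h :: "ereal \<Rightarrow> real"
    using measurable_restrict_space1[OF that] measurable_cong_sets[OF sets refl] by blast
  have cell: "grid_cell k j \<in> sets \<nu>" for k j using grid_cell_right_borel sets by simp
  have eq: "(\<integral>x. f x \<partial>grid_measure k (map (c k) [0..<grid_size k])) = (\<integral>y. extend_test f (ereal_round k y) \<partial>\<nu>)" for k
  proof -
    have "(\<integral>x. f x \<partial>grid_measure k (map (c k) [0..<grid_size k])) = (\<Sum>j<grid_size k. real (c k j) * f (grid k j))"
      by (subst integral_grid_measure[OF f]) simp
    also have "\<dots> = (\<Sum>j<grid_size k. \<integral>y. f (grid k j) * indicator (grid_cell k j) y \<partial>\<nu>)"
    proof (rule sum.cong[OF refl])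
      fix j assume "j \<in> {..<grid_size k}"
      then have "measure \<nu> (grid_cell k j) = real (c k j)" using c[of j k] by (simp add: measure_def)
      then show "real (c k j) * f (grid k j) = (\<integral>y. f (grid k j) * indicator (grid_cell k j) y \<partial>\<nu>)"
        using cell[of k j] sets.sets_into_space[OF cell[of k j]] by (simp add: Int_absorb2 mult.commute)
    qed
    also have "\<dots> = (\<integral>y. (\<Sum>j<grid_size k. f (grid k j) * indicator (grid_cell k j) y) \<partial>\<nu>)"
      using c cell by (intro Bochner_Integration.integral_sum[symmetric] integrable_mult_right integrable_real_indicator)
        (auto simp: of_nat_less_top)
    finally show ?thesis by (simp only: extend_test_round)
  qed
  have A: "{ereal (- real J)<..} \<in> sets \<nu>"
    unfolding sets by (subst sets_restrict_space_iff) (auto intro: less_trans)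
  have "(\<lambda>k. \<integral>y. extend_test f (ereal_round k y) \<partial>\<nu>) \<longlonglongrightarrow> (\<integral>y. f y \<partial>\<nu>)"
  proof (rule integral_dominated_convergence)
    show "f \<in> borel_measurable \<nu>"
      using vague_test_function_borel[OF f] measurable_cong_sets[OF sets refl] by blast
    show "(\<lambda>y. extend_test f (ereal_round k y)) \<in> borel_measurable \<nu>" for k
      by (rule meas) (rule measurable_compose[OF ereal_round_borel extend_test_borel[OF f]])
    \<comment> \<open>The half-line up to infinity lies in a compact set, hence has finite
      mass.\<close>
    show "integrable \<nu> (\<lambda>y. b * indicator {ereal (- real J)<..} y)"
    proof (intro integrable_mult_right integrable_real_indicator A)
      have "emeasure \<nu> {ereal (- real J)<..} \<le> emeasure \<nu> {ereal (- real J)..}"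
        by (rule emeasure_mono) (auto simp: sets sets_restrict_space_iff intro: less_le_trans)
      also have "\<dots> < \<infinity>"
      proof (rule fin)
        show "compact {ereal (- real J)..}"
          using compact_Int_closed[OF compact_UNIV closed_atLeast[of "ereal (- real J)"]] by simp
      qed (auto intro: less_le_trans)
      finally show "emeasure \<nu> {ereal (- real J)<..} < \<infinity>" .
    qed
    show "AE y in \<nu>. (\<lambda>k. extend_test f (ereal_round k y)) \<longlonglongrightarrow> f y"
    proof (rule AE_I2)
      fix y assume "y \<in> space \<nu>"
      then have "extend_test f y = f y" by (auto simp: sp extend_test_def)
      moreover have "(\<lambda>k. extend_test f (ereal_round k y)) \<longlonglongrightarrow> extend_test f y"
        by (intro extend_test_continuous[OF f] ereal_round_tendsto filterlim_ident tendsto_const)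
      ultimately show "(\<lambda>k. extend_test f (ereal_round k y)) \<longlonglongrightarrow> f y" by simp
    qed
    show "AE y in \<nu>. norm (extend_test f (ereal_round k y)) \<le> b * indicator {ereal (- real J)<..} y" for k
      using b J[OF ereal_round_le_neg] by (intro AE_I2) (auto simp: indicator_def not_less)
  qed
  then show "(\<lambda>k. \<integral>x. f x \<partial>grid_measure k (map (c k) [0..<grid_size k])) \<longlonglongrightarrow> (\<integral>x. f x \<partial>\<nu>)"
    by (simp only: eq)
qed

section \<open>Convergence of the exceedance process\<close>

text \<open>The sigma-algebra of \<open>borel_of\<close> is generated by all open sets and not just
  by the subbasic ones. Measurability of the exceedance process is therefore drawn from continuity
  in the entries.\<close>

lemma continuous_map_points:
  fixes g :: "'i \<Rightarrow> 'x::topological_space \<Rightarrow> real"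
  assumes I: "finite I" and g: "\<And>p. p \<in> I \<Longrightarrow> continuous_on UNIV (g p)"
  shows "continuous_map euclidean vague_topology (\<lambda>x. distr (count_space I) right_borel (\<lambda>p. ereal (g p x)))"
  unfolding vague_topology_def
proof (rule continuous_on_generated_topo)
  let ?\<Phi> = "\<lambda>x. distr (count_space I) right_borel (\<lambda>p. ereal (g p x))"
  fix U assume "U \<in> {{\<nu> \<in> radon_measures. integral\<^sup>L \<nu> f \<in> S} |f S. f \<in> vague_test_functions \<and> open S}"
  then obtain f S where U: "U = {\<nu> \<in> radon_measures. integral\<^sup>L \<nu> f \<in> S}" "f \<in> vague_test_functions" "open S"
    by auto
  have "continuous_on UNIV (\<lambda>x. extend_test f (ereal (g p x)))" if "p \<in> I" for p
    using g[OF that] unfolding continuous_on_def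
    by (auto intro!: extend_test_continuous[OF U(2)] tendsto_intros)
  then have "continuous_on UNIV (\<lambda>x. \<Sum>p\<in>I. extend_test f (ereal (g p x)))"
    by (intro continuous_on_sum)
  then have "open ((\<lambda>x. \<Sum>p\<in>I. extend_test f (ereal (g p x))) -` S)"
    by (rule open_vimage[OF U(3)])
  moreover have "?\<Phi> -` U \<inter> topspace euclidean = (\<lambda>x. \<Sum>p\<in>I. extend_test f (ereal (g p x))) -` S"
    by (auto simp: U(1) points_radon[OF I] integral_points[OF I U(2)] extend_test_def)
  ultimately show "openin euclidean (?\<Phi> -` U \<inter> topspace euclidean)" by simp
next
  have "\<Union>{{\<nu> \<in> radon_measures. integral\<^sup>L \<nu> f \<in> S} |f S. f \<in> vague_test_functions \<and> open S} = radon_measures"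
    using topspace_vague_topology unfolding vague_topology_def topology_generated_by_topspace .
  then show "(\<lambda>x. distr (count_space I) right_borel (\<lambda>p. ereal (g p x))) ` topspace euclidean
      \<subseteq> \<Union>{{\<nu> \<in> radon_measures. integral\<^sup>L \<nu> f \<in> S} |f S. f \<in> vague_test_functions \<and> open S}"
    using points_radon[OF I] by auto
qed

lemma exceedance_process_measurable:
  assumes U: "uniform_correlation_matrix M n C"
  shows "(\<lambda>\<omega>. exceedance_process n (C \<omega>)) \<in> M \<rightarrow>\<^sub>M borel_of vague_topology"
proof (rule measurable_borel_ofI)
  let ?\<Phi> = "\<lambda>x :: nat \<times> nat \<Rightarrow> real. distr (count_space (upper_pairs n)) right_borel
      (\<lambda>p. ereal ((real n + 1) * (x p)\<^sup>2 - exceedance_level n))"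
  have eq: "exceedance_process n (C \<omega>) = ?\<Phi> (upper_entries n (C \<omega>))" for \<omega>
    unfolding exceedance_process_def
    by (rule distr_cong) (auto simp: exceedance_point_def upper_entries_def)
  show "exceedance_process n (C \<omega>) \<in> topspace vague_topology" for \<omega>
    unfolding topspace_vague_topology exceedance_process_def by (rule points_radon[OF finite_upper_pairs])
  fix A assume "openin vague_topology A"
  moreover have "continuous_map euclidean vague_topology ?\<Phi>"
    by (rule continuous_map_points[OF finite_upper_pairs]) (intro continuous_intros continuous_on_product_coordinates)
  ultimately have "open {x. ?\<Phi> x \<in> A}"
    using openin_continuous_map_preimage by fastforce
  then have "(\<lambda>\<omega>. upper_entries n (C \<omega>)) -` {x. ?\<Phi> x \<in> A} \<inter> space M \<in> sets M"
    by (intro measurable_sets[OF offdiag_borel[OF U]] borel_open)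
  then show "(\<lambda>\<omega>. exceedance_process n (C \<omega>)) -` A \<inter> space M \<in> sets M"
    by (simp only: eq vimage_def mem_Collect_eq)
qed

text \<open>The means converge, and a convergent sequence is bounded over all n.\<close>

lemma expectation_exceedance_count_bounded:
  fixes M :: "nat \<Rightarrow> 'a measure" and C :: "nat \<Rightarrow> 'a \<Rightarrow> real mat"
  assumes U: "\<And>n. uniform_correlation_matrix (M n) n (C n)"
  obtains L where "0 \<le> L" "\<And>n. (\<integral>\<omega>. real (exceedance_count n (C n \<omega>) {t0..}) \<partial>M n) \<le> L"
proof -
  let ?g = "indicat_real {t0..}"
  have eq: "(\<integral>\<omega>. real (exceedance_count n (C n \<omega>) {t0..}) \<partial>M n) = real n * (real n - 1) / 2 * exceedance_mean n ?g" for n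
  proof -
    interpret prob_space "M n" by (rule uniform_corr_prob_space[OF U])
    have "real (exceedance_count n D {t0..}) = (\<Sum>p\<in>upper_pairs n. ?g (exceedance_point n D p))" for D
      using finite_upper_pairs[of n]
      by (simp add: exceedance_count_def indicator_def sum.If_cases Int_def)
    then have "expectation (\<lambda>\<omega>. real (exceedance_count n (C n \<omega>) {t0..})) =
        (\<Sum>p\<in>upper_pairs n. expectation (\<lambda>\<omega>. ?g (exceedance_point n (C n \<omega>) p)))"
    proof (simp only:, intro Bochner_Integration.integral_sum)
      fix p assume p: "p \<in> upper_pairs n"
      have "(\<lambda>\<omega>. ?g (exceedance_point n (C n \<omega>) p)) \<in> borel_measurable (M n)"
        by (rule measurable_compose[OF exceedance_point_borel[OF U p]]) measurable
      then show "integrable (M n) (\<lambda>\<omega>. ?g (exceedance_point n (C n \<omega>) p))"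
        by (rule integrable_const_bound[of _ 1, rotated]) simp
    qed
    also have "\<dots> = (\<Sum>p\<in>upper_pairs n. exceedance_mean n ?g)"
    proof (rule sum.cong[OF refl])
      fix p assume p: "p \<in> upper_pairs n"
      have "(\<lambda>a. ?g ((real n + 1) * a\<^sup>2 - exceedance_level n)) \<in> borel_measurable borel" by measurable
      from expectation_entry[OF U p this]
      show "expectation (\<lambda>\<omega>. ?g (exceedance_point n (C n \<omega>) p)) =
        exceedance_mean n ?g"
        by (simp add: exceedance_point_def exceedance_mean_def)
    qed
    finally show ?thesis by (simp add: real_card_upper_pairs)
  qed
  have "(\<lambda>n. \<integral>\<omega>. real (exceedance_count n (C n \<omega>) {t0..}) \<partial>M n) \<longlonglongrightarrow> (\<integral>t. ?g t \<partial>intensity)"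
    unfolding eq by (rule marginal_exceedance_tendsto[of ?g t0]) auto
  from convergent_imp_Bseq[OF convergentI[OF this]] obtain L where
    "0 < L" "\<And>n. norm (\<integral>\<omega>. real (exceedance_count n (C n \<omega>) {t0..}) \<partial>M n) \<le> L"
    by (auto simp: Bseq_def)
  then show thesis using that[of L] by (fastforce simp: abs_le_iff)
qed

text \<open>Markov's inequality at each level, with the tolerance d shared out geometrically so that
  one event controls all levels.\<close>

lemma exceedance_counts_tight:
  fixes M :: "nat \<Rightarrow> 'a measure" and C :: "nat \<Rightarrow> 'a \<Rightarrow> real mat"
  assumes U: "\<And>n. uniform_correlation_matrix (M n) n (C n)" and d: "0 < d"
  obtains c :: "nat \<Rightarrow> nat" where
    "\<And>n. {\<omega> \<in> space (M n). \<exists>j. c j < exceedance_count n (C n \<omega>) {- real j..}} \<in> sets (M n)"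
    "\<And>n. measure (M n) {\<omega> \<in> space (M n). \<exists>j. c j < exceedance_count n (C n \<omega>) {- real j..}} \<le> d"
proof -
  have "\<forall>j. \<exists>L. 0 \<le> L \<and> (\<forall>n. (\<integral>\<omega>. real (exceedance_count n (C n \<omega>) {- real j..}) \<partial>M n) \<le> L)"
    using expectation_exceedance_count_bounded[OF U] by metis
  from choice[OF this] obtain L where L: "\<And>j. 0 \<le> L j"
    "\<And>j n. (\<integral>\<omega>. real (exceedance_count n (C n \<omega>) {- real j..}) \<partial>M n) \<le> L j" by auto
  \<comment> \<open>More than \<open>c j\<close> points means at least \<open>c j\<close> + 1, which
    by Markov has probability at most L / (c + 1), below d / 2^(j+1).\<close>
  define c where "c j = nat \<lceil>L j * 2 ^ Suc j / d\<rceil>" for j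
  have c: "L j * 2 ^ Suc j / d < real (Suc (c j))" for j
    unfolding c_def by linarith
  let ?X = "\<lambda>n j \<omega>. exceedance_count n (C n \<omega>) {- real j..}"
  let ?A = "\<lambda>n j. {\<omega> \<in> space (M n). c j < ?X n j \<omega>}"
  have Xm [measurable]: "?X n j \<in> M n \<rightarrow>\<^sub>M count_space UNIV" for n j
    by (rule exceedance_count_measurable[OF U]) simp
  have A: "?A n j \<in> sets (M n)" for n j by measurable
  have small: "measure (M n) (?A n j) \<le> d * (1 / 2) ^ Suc j" for n j
  proof -
    interpret prob_space "M n" by (rule uniform_corr_prob_space[OF U])
    have int: "integrable (M n) (\<lambda>\<omega>. real (?X n j \<omega>))"
    proof (rule integrable_const_bound[of _ "real (card (upper_pairs n))"])
      show "AE \<omega> in M n. norm (real (?X n j \<omega>)) \<le> real (card (upper_pairs n))"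
        by (auto simp: exceedance_count_def finite_upper_pairs intro!: card_mono)
    qed measurable
    have "measure (M n) (?A n j) = measure (M n) {\<omega> \<in> space (M n). real (Suc (c j)) \<le> real (?X n j \<omega>)}"
      by (intro arg_cong[of _ _ "measure (M n)"]) auto
    also have "\<dots> \<le> (\<integral>\<omega>. real (?X n j \<omega>) \<partial>M n) / real (Suc (c j))"
      by (rule integral_Markov_inequality_measure[OF int, where A = "{}"]) auto
    also have "\<dots> \<le> L j / real (Suc (c j))"
      by (intro divide_right_mono L) simp
    also have "\<dots> \<le> d * (1 / 2) ^ Suc j"
      using c[of j] d by (simp add: field_simps del: of_nat_Suc)
    finally show ?thesis .
  qed
  have sums: "(\<lambda>j. d * (1 / 2) ^ Suc j) sums d"
    using sums_mult[OF power_half_series, of d] by simp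
  have eq: "{\<omega> \<in> space (M n). \<exists>j. c j < ?X n j \<omega>} = (\<Union>j. ?A n j)" for n by auto
  show thesis
  proof (rule that[of c])
    fix n
    interpret prob_space "M n" by (rule uniform_corr_prob_space[OF U])
    show "{\<omega> \<in> space (M n). \<exists>j. c j < ?X n j \<omega>} \<in> sets (M n)"
      unfolding eq using A by (intro sets.countable_UN) auto
    have summ: "summable (\<lambda>j. measure (M n) (?A n j))"
      by (rule summable_comparison_test'[OF sums_summable[OF sums], of 0]) (simp only: real_norm_def abs_of_nonneg[OF measure_nonneg] small)
    have "measure (M n) (\<Union>j. ?A n j) \<le> (\<Sum>j. measure (M n) (?A n j))"
      by (rule finite_measure_subadditive_countably) (use A summ in auto)
    also have "\<dots> \<le> (\<Sum>j. d * (1 / 2) ^ Suc j)"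
      by (rule suminf_le[OF small summ sums_summable[OF sums]])
    also have "\<dots> = d" by (rule sums_unique[OF sums, symmetric])
    finally show "measure (M n) {\<omega> \<in> space (M n). \<exists>j. c j < ?X n j \<omega>} \<le> d" unfolding eq .
  qed
qed

lemma borel_vimage_ereal:
  "A \<in> sets borel \<Longrightarrow> ereal -` A \<in> sets borel"
  using measurable_sets[of ereal borel borel A] by simp

lemma bdd_below_grid_cell: "bdd_below (ereal -` grid_cell k j)"
  using ereal_round_gt_cell[of _ k j] by (intro bdd_belowI[of _ "- real (Suc k)"]) fastforce

lemma right_intensity_grid_cell:
  "emeasure right_intensity (grid_cell k j) = emeasure intensity (ereal -` grid_cell k j)"
proof -
  have "ereal \<in> intensity \<rightarrow>\<^sub>M right_borel"
    by (auto simp: measurable_restrict_space2_iff measurable_cong_sets[OF sets_intensity refl])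
  from emeasure_distr[OF this grid_cell_right_borel] show ?thesis
    by (simp add: right_intensity_def intensity_def)
qed

lemma exceedance_grid_counts_tendsto:
  fixes M :: "nat \<Rightarrow> 'a measure" and C :: "nat \<Rightarrow> 'a \<Rightarrow> real mat" and N :: "'p \<Rightarrow> ereal measure"
    and G :: "nat list \<Rightarrow> real"
  assumes U: "\<And>n. uniform_correlation_matrix (M n) n (C n)"
    and N: "poisson_point_process P N right_intensity" and G: "\<And>x. \<bar>G x\<bar> \<le> b"
    and K: "\<And>k j \<omega>. K k j \<omega> = nat \<lfloor>enn2real (emeasure (N \<omega>) (grid_cell k j))\<rfloor>"
  shows grid_count_AE: "AE \<omega> in P. \<forall>k j. emeasure (N \<omega>) (grid_cell k j) = of_nat (K k j \<omega>)"
    and grid_count_measurable: "K k j \<in> P \<rightarrow>\<^sub>M count_space UNIV"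
    and "(\<lambda>n. \<integral>\<omega>. G (map (\<lambda>j. exceedance_count n (C n \<omega>) (ereal -` grid_cell k j)) [0..<m]) \<partial>M n) \<longlonglongrightarrow>
      (\<integral>\<omega>. G (map (\<lambda>j. K k j \<omega>) [0..<m]) \<partial>P)"
proof -
  have P: "prob_space P" using N by (simp add: poisson_point_process_def)
  let ?B = "\<lambda>k j. ereal -` grid_cell k j"
  have B: "?B k j \<in> sets borel" "bdd_below (?B k j)" for k j
    by (rule borel_vimage_ereal[OF grid_cell_borel], rule bdd_below_grid_cell)
  have Bfin: "emeasure right_intensity (grid_cell k j) < \<infinity>" for k j
    unfolding right_intensity_grid_cell by (rule emeasure_intensity_bdd_below[OF B])
  have Bmeas: "measure right_intensity (grid_cell k j) = measure intensity (?B k j)" for k j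
    by (simp add: measure_def right_intensity_grid_cell)
  have pois: "poisson_distributed P (\<lambda>\<omega>. emeasure (N \<omega>) (grid_cell k j)) (measure intensity (?B k j))" for k j
    using N Bfin grid_cell_right_borel unfolding poisson_point_process_def Bmeas[symmetric] by blast
  define f where "f x = nat \<lfloor>enn2real x\<rfloor>" for x :: ennreal
  have f [measurable]: "f \<in> borel \<rightarrow>\<^sub>M count_space UNIV" unfolding f_def by measurable
  have fk: "f (of_nat i) = i" for i by (simp add: f_def)
  have feq: "{y. y = of_nat (f y)} \<in> sets borel"
  proof -
    have [measurable]: "(\<lambda>y. of_nat (f y) :: ennreal) \<in> borel_measurable borel" by measurable
    have "{y \<in> space borel. y = (of_nat (f y) :: ennreal)} \<in> sets borel" by measurable
    then show ?thesis by simp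
  qed
  have Kf: "K k j = (\<lambda>\<omega>. f (emeasure (N \<omega>) (grid_cell k j)))" for k j
    by (simp add: K f_def fun_eq_iff)
  have Km: "K k j \<in> P \<rightarrow>\<^sub>M count_space UNIV" for k j
    unfolding Kf by (rule measurable_compose[OF _ f]) (use pois in \<open>simp add: poisson_distributed_def\<close>)
  then show "K k j \<in> P \<rightarrow>\<^sub>M count_space UNIV" .
  \<comment> \<open>There are countably many cells in all, so a single null set serves every
    mesh.\<close>
  show "AE \<omega> in P. \<forall>k j. emeasure (N \<omega>) (grid_cell k j) = of_nat (K k j \<omega>)"
    unfolding AE_all_countable Kf using poisson_distributed_round(1)[OF pois f fk feq] by blast
  have disj: "disjoint_family_on (grid_cell k) {..<m}" by (rule disjoint_grid_cell)
  have ind: "prob_space.indep_vars P (\<lambda>_. borel) (\<lambda>r \<omega>. emeasure (N \<omega>) (grid_cell k r)) {..<m}"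
    using N disj grid_cell_right_borel unfolding poisson_point_process_def by blast
  show "(\<lambda>n. \<integral>\<omega>. G (map (\<lambda>j. exceedance_count n (C n \<omega>) (?B k j)) [0..<m]) \<partial>M n) \<longlonglongrightarrow>
      (\<integral>\<omega>. G (map (\<lambda>j. K k j \<omega>) [0..<m]) \<partial>P)"
  proof (rule exceedance_counts_tendsto[OF U B _ P Km _ G])
    show "disjoint_family_on (?B k) {..<m}"
      using disj by (auto simp: disjoint_family_on_def)
    show "measure P {\<omega> \<in> space P. \<forall>r<m. K k r \<omega> = i r} = (\<Prod>r<m. pmf (poisson_law (measure intensity (?B k r))) (i r))" for i
      unfolding Kf by (rule poisson_joint_round[OF P pois ind f fk feq])
  qed
qed

text \<open>The order of choices matters: the mesh is fixed first, with an error uniform in n, and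
  only then does n grow for the finitely many cell counts.\<close>

lemma exceedance_process_converges_in_distribution:
  fixes M :: "nat \<Rightarrow> 'a measure" and C :: "nat \<Rightarrow> 'a \<Rightarrow> real mat" and N :: "'p \<Rightarrow> ereal measure"
  assumes U: "\<And>n. uniform_correlation_matrix (M n) n (C n)"
    and N: "poisson_point_process P N right_intensity"
  shows "converges_in_distribution vague_topology M (\<lambda>n \<omega>. exceedance_process n (C n \<omega>)) P N"
  unfolding converges_in_distribution_def
proof (intro conjI allI impI)
  show Xm: "(\<lambda>\<omega>. exceedance_process n (C n \<omega>)) \<in> M n \<rightarrow>\<^sub>M borel_of vague_topology" for n
    by (rule exceedance_process_measurable[OF U])
  show Nm: "N \<in> P \<rightarrow>\<^sub>M borel_of vague_topology" using N by (simp add: poisson_point_process_def)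
  interpret P: prob_space P using N by (simp add: poisson_point_process_def)
  fix F :: "ereal measure \<Rightarrow> real"
  assume "continuous_map vague_topology euclideanreal F \<and> bounded (F ` topspace vague_topology)"
  then obtain b where F: "continuous_map vague_topology euclideanreal F"
    and b: "\<And>\<nu>. \<nu> \<in> radon_measures \<Longrightarrow> \<bar>F \<nu>\<bar> \<le> b"
    by (auto simp: bounded_iff topspace_vague_topology)
  have b0: "0 \<le> b" using b[OF grid_measure_radon] abs_ge_zero order_trans by blast
  have Fm: "F \<in> borel_measurable (borel_of vague_topology)" by (rule borel_measurable_continuous_map[OF F])
  have Nrad: "N \<omega> \<in> radon_measures" if "\<omega> \<in> space P" for \<omega>
    using measurable_space[OF Nm that] by (simp add: borel_of_def space_measure_of_conv topspace_vague_topology)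
  define K where "K k j \<omega> = nat \<lfloor>enn2real (emeasure (N \<omega>) (grid_cell k j))\<rfloor>" for k j \<omega>
  define G where "G k xs = F (grid_measure k xs)" for k xs
  have G: "\<bar>G k xs\<bar> \<le> b" for k xs unfolding G_def by (rule b[OF grid_measure_radon])
  let ?K = "\<lambda>k \<omega>. map (\<lambda>j. K k j \<omega>) [0..<grid_size k]"
  let ?X = "\<lambda>k n \<omega>. map (\<lambda>j. exceedance_count n (C n \<omega>) (ereal -` grid_cell k j)) [0..<grid_size k]"
  have lim_n: "(\<lambda>n. \<integral>\<omega>. G k (?X k n \<omega>) \<partial>M n) \<longlonglongrightarrow> (\<integral>\<omega>. G k (?K k \<omega>) \<partial>P)" for k
    by (rule exceedance_grid_counts_tendsto(3)[OF U N G K_def])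
  have lim_k: "(\<lambda>k. \<integral>\<omega>. G k (?K k \<omega>) \<partial>P) \<longlonglongrightarrow> (\<integral>\<omega>. F (N \<omega>) \<partial>P)"
  proof (rule integral_dominated_convergence[where w = "\<lambda>_. b"])
    show "(\<lambda>\<omega>. F (N \<omega>)) \<in> borel_measurable P" by (rule measurable_compose[OF Nm Fm])
    show "(\<lambda>\<omega>. G k (?K k \<omega>)) \<in> borel_measurable P" for k
      by (rule measurable_compose[OF measurable_map_upt[OF grid_count_measurable[OF U N G K_def]]]) simp
    show "AE \<omega> in P. (\<lambda>k. G k (?K k \<omega>)) \<longlonglongrightarrow> F (N \<omega>)"
      using grid_count_AE[OF U N G K_def] AE_space
    proof eventually_elim
      case (elim \<omega>)
      show ?case unfolding G_def
        by (rule grid_measure_tendsto[OF F Nrad]) (use elim in auto)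
    qed
  qed (use G in auto)
  have close: "\<exists>k0. \<forall>k\<ge>k0. \<forall>n. \<bar>(\<integral>\<omega>. G k (?X k n \<omega>) \<partial>M n) - (\<integral>\<omega>. F (exceedance_process n (C n \<omega>)) \<partial>M n)\<bar> \<le> e"
    if e: "0 < e" for e
  proof -
    \<comment> \<open>On the exceptional event the two values of F differ by at most 2b; its
      probability d is chosen so that this costs at most e/2.\<close>
    define d where "d = e / (4 * (b + 1))"
    have d: "0 < d" "2 * b * d \<le> e / 2" using e b0 by (auto simp: d_def field_simps)
    obtain c :: "nat \<Rightarrow> nat" where c:
      "\<And>n. {\<omega> \<in> space (M n). \<exists>j. c j < exceedance_count n (C n \<omega>) {- real j..}} \<in> sets (M n)"
      "\<And>n. measure (M n) {\<omega> \<in> space (M n). \<exists>j. c j < exceedance_count n (C n \<omega>) {- real j..}} \<le> d"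
      using exceedance_counts_tight[OF U d(1)] by blast
    have "0 < e / 2" using e by simp
    from grid_measure_uniform_approximation[OF F this, where c = c and 'i = "nat \<times> nat"]
    obtain k0 where k0: "\<And>k (I :: (nat \<times> nat) set) y. k \<ge> k0 \<Longrightarrow> finite I \<Longrightarrow>
        (\<And>j. card {p \<in> I. - real j \<le> y p} \<le> c j) \<Longrightarrow>
      \<bar>F (grid_measure k (map (\<lambda>j. card {p \<in> I. ereal (y p) \<in> grid_cell k j}) [0..<grid_size k]))
        - F (distr (count_space I) right_borel (\<lambda>p. ereal (y p)))\<bar> < e / 2"
      by blast
    show ?thesis
    proof (intro exI[of _ k0] allI impI)
      fix k n assume k: "k0 \<le> k"
      interpret prob_space "M n" by (rule uniform_corr_prob_space[OF U])
      define A where "A = {\<omega> \<in> space (M n). \<exists>j. c j < exceedance_count n (C n \<omega>) {- real j..}}"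
      have A: "A \<in> sets (M n)" "measure (M n) A \<le> d" using c by (simp_all add: A_def)
      have rad: "exceedance_process n (C n \<omega>) \<in> radon_measures" for \<omega>
        unfolding exceedance_process_def by (rule points_radon[OF finite_upper_pairs])
      have pt: "\<bar>G k (?X k n \<omega>) - F (exceedance_process n (C n \<omega>))\<bar> \<le> e / 2 + 2 * b * indicator A \<omega>"
        if \<omega>: "\<omega> \<in> space (M n)" for \<omega>
      proof (cases "\<omega> \<in> A")
        case True
        have "\<bar>G k (?X k n \<omega>) - F (exceedance_process n (C n \<omega>))\<bar> \<le> b + b"
          using G[of k "?X k n \<omega>"] b[OF rad, of \<omega>] by linarith
        then show ?thesis using True e by simp
      next
        case False
        then have "card {p \<in> upper_pairs n. - real j \<le> exceedance_point n (C n \<omega>) p} \<le> c j" for j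
          using \<omega> by (auto simp: A_def exceedance_count_def not_less)
        from k0[OF k finite_upper_pairs this]
        have "\<bar>G k (?X k n \<omega>) - F (exceedance_process n (C n \<omega>))\<bar> < e / 2"
          by (simp add: G_def exceedance_process_def exceedance_count_def)
        then show ?thesis using False by simp
      qed
      have Gm: "integrable (M n) (\<lambda>\<omega>. G k (?X k n \<omega>))"
      proof (rule integrable_const_bound[of _ b])
        show "(\<lambda>\<omega>. G k (?X k n \<omega>)) \<in> borel_measurable (M n)"
          by (rule measurable_compose[OF measurable_map_upt[OF exceedance_count_measurable[OF U borel_vimage_ereal[OF grid_cell_borel]]]]) simp
      qed (use G in auto)
      have FXm: "integrable (M n) (\<lambda>\<omega>. F (exceedance_process n (C n \<omega>)))"
        by (rule integrable_const_bound[of _ b, OF _ measurable_compose[OF Xm Fm]]) (use b[OF rad] in auto)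
      have "\<bar>(\<integral>\<omega>. G k (?X k n \<omega>) \<partial>M n) - (\<integral>\<omega>. F (exceedance_process n (C n \<omega>)) \<partial>M n)\<bar> =
          \<bar>\<integral>\<omega>. G k (?X k n \<omega>) - F (exceedance_process n (C n \<omega>)) \<partial>M n\<bar>"
        by (simp only: Bochner_Integration.integral_diff[OF Gm FXm])
      also have "\<dots> \<le> (\<integral>\<omega>. \<bar>G k (?X k n \<omega>) - F (exceedance_process n (C n \<omega>))\<bar> \<partial>M n)"
        by (rule integral_abs_bound)
      also have "\<dots> \<le> (\<integral>\<omega>. e / 2 + 2 * b * indicator A \<omega> \<partial>M n)"
        using pt A(1) by (intro Bochner_Integration.integral_mono integrable_abs Bochner_Integration.integrable_diff Gm FXm
            Bochner_Integration.integrable_add integrable_mult_right integrable_real_indicator) (auto simp: emeasure_eq_measure)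
      also have "\<dots> = e / 2 + 2 * b * measure (M n) A"
        using A(1) by (subst Bochner_Integration.integral_add) (auto simp: prob_space emeasure_eq_measure)
      also have "\<dots> \<le> e / 2 + 2 * b * d"
        using A(2) b0 by (intro add_left_mono mult_left_mono) auto
      also have "\<dots> \<le> e" using d(2) by simp
      finally show "\<bar>(\<integral>\<omega>. G k (?X k n \<omega>) \<partial>M n) - (\<integral>\<omega>. F (exceedance_process n (C n \<omega>)) \<partial>M n)\<bar> \<le> e" .
    qed
  qed
  show "(\<lambda>n. \<integral>\<omega>. F (exceedance_process n (C n \<omega>)) \<partial>M n) \<longlonglongrightarrow> (\<integral>\<omega>. F (N \<omega>) \<partial>P)"
  proof (rule LIMSEQ_I)
    fix e :: real assume e: "0 < e"
    then have e3: "0 < e / 3" by simp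
    obtain k0 where k0: "\<And>k n. k0 \<le> k \<Longrightarrow> \<bar>(\<integral>\<omega>. G k (?X k n \<omega>) \<partial>M n) - (\<integral>\<omega>. F (exceedance_process n (C n \<omega>)) \<partial>M n)\<bar> \<le> e / 3"
      using close[OF e3] by blast
    obtain k1 where k1: "\<And>k. k1 \<le> k \<Longrightarrow> \<bar>(\<integral>\<omega>. G k (?K k \<omega>) \<partial>P) - (\<integral>\<omega>. F (N \<omega>) \<partial>P)\<bar> < e / 3"
      using LIMSEQ_D[OF lim_k e3] unfolding real_norm_def by blast
    \<comment> \<open>One mesh fine enough both for all n and for the limit process.\<close>
    define k where "k = max k0 k1"
    obtain n0 where n0: "\<And>n. n0 \<le> n \<Longrightarrow> \<bar>(\<integral>\<omega>. G k (?X k n \<omega>) \<partial>M n) - (\<integral>\<omega>. G k (?K k \<omega>) \<partial>P)\<bar> < e / 3"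
      using LIMSEQ_D[OF lim_n e3] unfolding real_norm_def by blast
    show "\<exists>n0. \<forall>n\<ge>n0. norm ((\<integral>\<omega>. F (exceedance_process n (C n \<omega>)) \<partial>M n) - (\<integral>\<omega>. F (N \<omega>) \<partial>P)) < e"
    proof (intro exI[of _ n0] allI impI)
      fix n assume "n0 \<le> n"
      have "k0 \<le> k" "k1 \<le> k" by (simp_all add: k_def)
      from n0[OF \<open>n0 \<le> n\<close>] k0[OF this(1), of n] k1[OF this(2)]
      show "norm ((\<integral>\<omega>. F (exceedance_process n (C n \<omega>)) \<partial>M n) - (\<integral>\<omega>. F (N \<omega>) \<partial>P)) < e"
        unfolding real_norm_def by linarith
    qed
  qed
qed

theorem theorem3:
  fixes M :: "nat \<Rightarrow> 'a measure" and C :: "nat \<Rightarrow> 'a \<Rightarrow> real mat"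
  assumes "\<And>n. uniform_correlation_matrix (M n) n (C n)"
  shows
    "(\<forall>(P :: 'p measure) N. poisson_point_process P N right_intensity \<longrightarrow>
        converges_in_distribution vague_topology
          M (\<lambda>n \<omega>. exceedance_process n (C n \<omega>)) P N)
     \<and>
     (\<forall>m (B :: nat \<Rightarrow> real set) (P :: 'q measure) (Z :: nat \<Rightarrow> 'q \<Rightarrow> real).
        (\<forall>r<m. B r \<in> sets borel \<and> bdd_below (B r) \<and>
               emeasure intensity (B r) < \<infinity> \<and> emeasure intensity (frontier (B r)) = 0) \<and>
        disjoint_family_on B {..<m} \<and>
        prob_space P \<and> prob_space.indep_vars P (\<lambda>_. borel) Z {..<m} \<and>
        (\<forall>r<m. poisson_distributed P (Z r) (measure intensity (B r))) \<longrightarrow>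
        converges_in_distribution (product_topology (\<lambda>_. euclideanreal) {..<m})
          M (\<lambda>n \<omega>. \<lambda>r\<in>{..<m}. real (exceedance_count n (C n \<omega>) (B r)))
          P (\<lambda>\<omega>. \<lambda>r\<in>{..<m}. Z r \<omega>))"
proof (intro conjI allI impI)
  fix P :: "'p measure" and N assume "poisson_point_process P N right_intensity"
  then show "converges_in_distribution vague_topology M (\<lambda>n \<omega>. exceedance_process n (C n \<omega>)) P N"
    by (rule exceedance_process_converges_in_distribution[OF assms])
next
  fix m and B :: "nat \<Rightarrow> real set" and P :: "'q measure" and Z :: "nat \<Rightarrow> 'q \<Rightarrow> real"
  assume "(\<forall>r<m. B r \<in> sets borel \<and> bdd_below (B r) \<and>
               emeasure intensity (B r) < \<infinity> \<and> emeasure intensity (frontier (B r)) = 0) \<and>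
        disjoint_family_on B {..<m} \<and>
        prob_space P \<and> prob_space.indep_vars P (\<lambda>_. borel) Z {..<m} \<and>
        (\<forall>r<m. poisson_distributed P (Z r) (measure intensity (B r)))"
  then show "converges_in_distribution (product_topology (\<lambda>_. euclideanreal) {..<m})
          M (\<lambda>n \<omega>. \<lambda>r\<in>{..<m}. real (exceedance_count n (C n \<omega>) (B r)))
          P (\<lambda>\<omega>. \<lambda>r\<in>{..<m}. Z r \<omega>)"
    by (intro exceedance_counts_converge_in_distribution[OF assms]) auto
qed

end
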